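(* Let $g$ be a Gårding polynomial of degree $N\ge 1$ on a finite-dimensional real vector space $V$ with Gårding cone $\Gamma$, let $\Gamma^*$ be the open polar of $\Gamma$, and let $g^*:\Gamma^*\to\mathbb{R}$ be the dual Gårding function. Then: (1) $g^*$ is real analytic on $\Gamma^*$. (2) $\log g^*$ is strictly concave on $\Gamma^*$. (3) $g^*$ is (positively) homogeneous of the same degree $N$ as $g$. (4) (Monotonicity) For all $y,z\in\Gamma^*$, $g^*(y+z)>g^*(y)$. (5) $g^*$ extends to a continuous function on the closure $\overline{\Gamma^*}$ with $g^*\equiv 0$ on $\partial\Gamma^*$ and $g^*>0$ on $\Gamma^*$. (6) For each $x\in\Gamma$, the function $\psi(y)=\langle x,y\rangle-\log g^*(y)$ is a strictly convex exhaustion function on $\Gamma^*$; that is, it is strictly convex and for every $c\in\mathbb{R}$ the set $\{y\in\Gamma^*:\psi(y)\le c\}$ is compact.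
   Context: A Gårding polynomial of degree $N$ on a finite-dimensional real vector space $V$ is a homogeneous real polynomial $g$ of degree $N$ on $V$ together with a connected component $\Gamma$ of $\{g>0\}$ (the Gårding cone) such that for some $e\in\Gamma$ and every $v\in V$ the one-variable polynomial $t\mapsto g(te+v)$ has exactly $N$ real roots counted with multiplicity. The cone $\Gamma$ is then open and convex. Its edge is the linear subspace $E=\overline\Gamma\cap(-\overline\Gamma)$, and $g(x+v)=g(x)$ for all $x\in V$, $v\in E$. The polar is $\Gamma^0=\{y\in V^*:\langle y,x\rangle\ge 0\ \forall x\in\Gamma\}$. Let $S=\mathrm{span}(\Gamma^0)\subset V^*$, which is the annihilator of $E$. The open polar $\Gamma^*$ is the interior of $\Gamma^0$ relative to $S$; it is an open convex cone in $S$, and boundary, closure and real analyticity are understood relative to $S$. For $x\in\Gamma$ put $F(x)=D_x\log g\in V^*$. This depends only on the class of $x$ in $\Gamma/E\subset V/E$, and $F$ induces a bijection $\Gamma/E\to\Gamma^*$. The dual Gårding function is $g^*(y)=1/g(x)$ for $y\in\Gamma^*$, where $x\in\Gamma$ is any point with $F(x)=y$. *)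

theory Defs
  imports "HOL-Analysis.Analysis" "HOL-Computational_Algebra.Polynomial"
begin

text \<open>
  \<^verbatim>\<open>V\<close> is a type of class \<^class>\<open>euclidean_space\<close>; its inner product is never used.
  \<^verbatim>\<open>V*\<close> is the type of bounded linear functionals on \<^verbatim>\<open>V\<close>, which are all the linear
  functionals, and the pairing is application.
\<close>

text \<open>
  For a polynomial function on a real vector space, homogeneity of degree \<^verbatim>\<open>N\<close> as a polynomial
  is the scaling identity below. The \<^verbatim>\<open>p\<close> in the last clause is unique, and \<^const>\<open>proots\<close>
  collects its real roots with multiplicity.
\<close>

definition garding :: "nat \<Rightarrow> ('a::euclidean_space \<Rightarrow> real) \<Rightarrow> 'a set \<Rightarrow> bool" where
  "garding N g \<Gamma> \<longleftrightarrow>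
     real_polynomial_function g \<and>
     (\<forall>t x. g (t *\<^sub>R x) = t ^ N * g x) \<and>
     \<Gamma> \<in> components {x. g x > 0} \<and>
     (\<exists>e\<in>\<Gamma>. \<forall>v. \<exists>p::real poly.
        (\<forall>t. poly p t = g (t *\<^sub>R e + v)) \<and> p \<noteq> 0 \<and> size (proots p) = N)"

definition polar :: "'a::euclidean_space set \<Rightarrow> ('a \<Rightarrow>\<^sub>L real) set" where
  "polar \<Gamma> = {y. \<forall>x\<in>\<Gamma>. blinfun_apply y x \<ge> 0}"

definition open_polar :: "'a::euclidean_space set \<Rightarrow> ('a \<Rightarrow>\<^sub>L real) set" where
  "open_polar \<Gamma> = top_of_set (span (polar \<Gamma>)) interior_of polar \<Gamma>"

definition dlog :: "('a::euclidean_space \<Rightarrow> real) \<Rightarrow> 'a \<Rightarrow> ('a \<Rightarrow>\<^sub>L real)" where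
  "dlog g x = Blinfun (frechet_derivative (\<lambda>z. ln (g z)) (at x))"

text \<open>
  The description is meaningful when the value \<^verbatim>\<open>1 / g x\<close> exists and does not depend on the
  point \<^verbatim>\<open>x\<close> of \<^verbatim>\<open>\<Gamma>\<close> with \<^verbatim>\<open>dlog g x = y\<close>. For a Garding polynomial this holds for
  \<^verbatim>\<open>y\<close> in the open polar; elsewhere the value is unspecified.
\<close>

definition dual_garding :: "('a::euclidean_space \<Rightarrow> real) \<Rightarrow> 'a set \<Rightarrow> ('a \<Rightarrow>\<^sub>L real) \<Rightarrow> real" where
  "dual_garding g \<Gamma> y = (THE r. \<exists>x\<in>\<Gamma>. dlog g x = y \<and> r = 1 / g x)"

text \<open>
  Real analyticity on a relatively open subset \<^verbatim>\<open>U\<close> of a finite-dimensional subspace \<^verbatim>\<open>S\<close>: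
  in linear coordinates with respect to any basis \<^verbatim>\<open>B\<close> of \<^verbatim>\<open>S\<close>, the function is locally the
  unconditional (equivalently, absolute) sum of a multivariate power series. Multi-indices are the
  functions \<^verbatim>\<open>\<alpha>\<close> to the naturals that vanish off \<^verbatim>\<open>B\<close>.
\<close>

definition real_analytic_on ::
    "'v::real_normed_vector set \<Rightarrow> 'v set \<Rightarrow> ('v \<Rightarrow> real) \<Rightarrow> bool" where
  "real_analytic_on S U f \<longleftrightarrow>
     (\<forall>B. independent B \<and> span B = S \<longrightarrow>
       (\<forall>y\<in>U. \<exists>r>0. \<exists>c :: ('v \<Rightarrow> nat) \<Rightarrow> real. \<forall>s :: 'v \<Rightarrow> real.
          (\<forall>b\<in>B. \<bar>s b\<bar> < r) \<longrightarrow>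
          ((\<lambda>\<alpha>. c \<alpha> * (\<Prod>b\<in>B. s b ^ \<alpha> b)) has_sum f (y + (\<Sum>b\<in>B. s b *\<^sub>R b)))
            {\<alpha>. \<forall>b. b \<notin> B \<longrightarrow> \<alpha> b = 0}))"

definition strictly_convex_on :: "'v::real_vector set \<Rightarrow> ('v \<Rightarrow> real) \<Rightarrow> bool" where
  "strictly_convex_on S f \<longleftrightarrow> convex S \<and>
     (\<forall>x\<in>S. \<forall>y\<in>S. \<forall>u>0. \<forall>v>0. x \<noteq> y \<and> u + v = 1 \<longrightarrow>
        f (u *\<^sub>R x + v *\<^sub>R y) < u * f x + v * f y)"

definition strictly_concave_on :: "'v::real_vector set \<Rightarrow> ('v \<Rightarrow> real) \<Rightarrow> bool" where
  "strictly_concave_on S f \<longleftrightarrow> strictly_convex_on S (\<lambda>x. - f x)"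

end

theory Submission
  imports Defs "HOL-Computational_Algebra.Fundamental_Theorem_Algebra"
begin

text \<open>
  Along any line through a point \<open>x\<close> of the cone the polynomial splits,
  \<open>g (x + t v) = g x * \<Prod>(1 + t l)\<close> with real \<open>l\<close>, and everything about the convexity of \<open>ln g\<close> is
  read off from the numbers \<open>l\<close>. The splitting is given for one direction \<open>e\<close>;
  \<open>hyperbolic_along_transfer\<close> carries it to every direction of the cone. There the parameter of
  \<open>e\<close> is made imaginary, which keeps the complex roots off the real axis, and the roots are followed
  along a connected family of polynomials.

  Since \<open>ln (1 + l) \<le> l\<close> with equality only at \<open>l = 0\<close>, the graph of \<open>ln g\<close> lies below its tangents,
  and it touches a tangent again only along the edge, the largest subspace along which \<open>g\<close> is
  constant on the cone (\<open>dlog_tangent\<close>). The map \<open>F = dlog g\<close> reaches each \<open>y\<close> of the open polar: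
  such a \<open>y\<close> is coercive on the part of the closed cone orthogonal to the edge, so
  \<open>g x * exp (- y x)\<close> attains its maximum, and the maximum is a solution of \<open>F x = y\<close> (\<open>dlog_surj\<close>).
  Consequently \<open>ln g*\<close> is a Legendre transform,
  \<open>ln g* y = min (y z - ln g z) - N\<close> over \<open>z\<close> in the cone, the minimum being attained exactly where
  \<open>F z = y\<close>. Strict concavity, strict monotonicity and the two bounds behind the exhaustion property
  are immediate from this formula. For the continuous extension by zero, \<open>g*\<close> is
  dominated by the functions \<open>exp (y z) / g z\<close>; at a boundary point \<open>y\<close> these become small when \<open>z\<close>
  runs to infinity along a direction of the closed cone on which \<open>y\<close> is not positive. At an interior point
  monotonicity and homogeneity trap \<open>g*\<close> between \<open>(1 - \<eta>)^N g* y\<close> and \<open>(1 + \<eta>)^N g* y\<close>.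

  For analyticity the equation \<open>F x = y\<close>, cleared of its denominator, is a polynomial equation in \<open>x\<close>
  with coefficients affine in \<open>y\<close>. Its linearisation is invertible modulo the edge, because
  the second derivative of \<open>ln g\<close> along \<open>v\<close> is minus the sum of the squares of the \<open>l\<close>
  (\<open>hessian_nondegenerate\<close>). Picard iteration then solves it inside the functions that have an
  absolutely convergent power series on a small polydisc, with the \<open>l\<^sup>1\<close> norm of the
  weighted coefficients as the norm (\<open>analytic_fixed_point\<close>), and the power series of \<open>1 / g x\<close> follows from
  a geometric series.
\<close>

section \<open>Polynomials along lines and their real roots\<close>

lemma real_polynomial_on_line:
  assumes "real_polynomial_function f"
  shows "\<exists>p. \<forall>t. poly p t = f (a + t *\<^sub>R b)"
  using assms
proof (induction f rule: real_polynomial_function.induct)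
  case (linear f)
  interpret bounded_linear f by fact
  have "\<forall>t. poly [:f a, f b:] t = f (a + t *\<^sub>R b)" by (simp add: add scaleR)
  then show ?case by (rule exI)
next
  case (const c)
  have "\<forall>t. poly [:c:] t = c" by simp
  then show ?case by (rule exI)
next
  case (add f g)
  then obtain p q where "\<forall>t. poly p t = f (a + t *\<^sub>R b)" "\<forall>t. poly q t = g (a + t *\<^sub>R b)" by blast
  then have "\<forall>t. poly (p+q) t = f (a + t *\<^sub>R b) + g (a + t *\<^sub>R b)" by simp
  then show ?case by (rule exI)
next
  case (mult f g)
  then obtain p q where "\<forall>t. poly p t = f (a + t *\<^sub>R b)" "\<forall>t. poly q t = g (a + t *\<^sub>R b)" by blast
  then have "\<forall>t. poly (p*q) t = f (a + t *\<^sub>R b) * g (a + t *\<^sub>R b)" by simp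
  then show ?case by (rule exI)
qed

text \<open>
  The relation says that \<open>p\<close> is \<open>r\<close> with its coefficients listed backwards from degree \<open>N\<close>. It is how
  homogeneity enters: for \<open>p t = g (t e + v)\<close> and \<open>r t = g (e + t v)\<close> it turns \<open>g e \<noteq> 0\<close> into
  information about the degree.
\<close>

lemma degree_of_reversed_poly:
  fixes p r :: "'b::field_char_0 poly"
  assumes pr: "\<And>w. w \<noteq> 0 \<Longrightarrow> poly p w = w ^ N * poly r (1 / w)" and r0: "poly r 0 \<noteq> 0"
  shows "degree p = N" "lead_coeff p = poly r 0"
proof -
  let ?n = "degree r"
  have c0: "coeff r 0 \<noteq> 0" using r0 by (simp add: poly_0_coeff_0)
  have "poly (monom 1 ?n * p - monom 1 N * reflect_poly r) w = 0" if "w \<noteq> 0" for w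
    using pr[OF that] that by (simp add: poly_monom poly_reflect_poly_nz inverse_eq_divide)
  then have "UNIV - {0} \<subseteq> {w. poly (monom 1 ?n * p - monom 1 N * reflect_poly r) w = 0}" by auto
  then have "infinite {w. poly (monom 1 ?n * p - monom 1 N * reflect_poly r) w = 0}"
    using infinite_UNIV_char_0[where 'a='b] by (meson finite.emptyI finite_Diff2 finite_insert finite_subset)
  then have eq: "monom 1 ?n * p = monom 1 N * reflect_poly r"
    using poly_roots_finite by (metis eq_iff_diff_eq_0)
  have rr: "reflect_poly r \<noteq> 0" using r0 by auto
  then have p0: "p \<noteq> 0" using eq by (metis monom_eq_0_iff mult_eq_0_iff mult_zero_right zero_neq_one)
  have "?n + degree p = N + degree (reflect_poly r)"
    using arg_cong[OF eq, of degree] p0 rr by (simp add: degree_mult_eq degree_monom_eq)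
  then show "degree p = N" using c0 by simp
  show "lead_coeff p = poly r 0"
    using arg_cong[OF eq, of lead_coeff] c0 
    by (simp add: lead_coeff_mult coeff_reflect_poly poly_0_coeff_0 degree_monom_eq)
qed

lemma proots_factor:
  fixes p :: "'b::field_char_0 poly"
  assumes "p \<noteq> 0"
  shows "\<exists>q. p = q * (\<Prod>r\<in>#proots p. [:-r, 1:])"
  using assms
proof (induction "degree p" arbitrary: p rule: less_induct)
  case less
  show ?case
  proof (cases "proots p = {#}")
    case True
    then show ?thesis by simp
  next
    case False
    then obtain r where "r \<in># proots p" by (meson multiset_nonemptyE)
    then have "poly p r = 0" using less.prems by simp
    then obtain p' where p': "p = [:-r, 1:] * p'" by (meson dvdE poly_eq_0_iff_dvd)
    have p'0: "p' \<noteq> 0" using less.prems p' by auto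
    have "degree p' < degree p" unfolding p' using p'0 by (subst degree_mult_eq) auto
    with less.hyps p'0 obtain q where q: "p' = q * (\<Prod>r\<in>#proots p'. [:-r, 1:])" by blast
    have "proots p = {#r#} + proots p'" unfolding p' using p'0
      by (subst proots_mult) auto
    then have "p = q * (\<Prod>r\<in>#proots p. [:-r, 1:])"
      using p' q by (metis (no_types, lifting) image_mset_add_mset mult.left_commute prod_mset.add_mset union_mset_add_mset_left add_0)
    then show ?thesis ..
  qed
qed

section \<open>Complex stability and change of direction\<close>

text \<open>
  The restriction of \<open>f\<close> to the span of three vectors, extended to complex coefficients. The last clause,
  polynomiality along every complex line, replaces an explicit list of coefficients: it is preserved by
  sums and products, and it is all that the identity theorem for polynomials requires.
\<close>

definition complexifies ::
    "('a::real_normed_vector \<Rightarrow> real) \<Rightarrow> 'a \<Rightarrow> 'a \<Rightarrow> 'a \<Rightarrow> (complex \<Rightarrow> complex \<Rightarrow> complex \<Rightarrow> complex) \<Rightarrow> bool"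
  where "complexifies f e d x h \<longleftrightarrow>
    (\<forall>a t b. h (of_real a) (of_real t) (of_real b) = of_real (f (a *\<^sub>R e + t *\<^sub>R d + b *\<^sub>R x))) \<and>
    continuous_on UNIV (\<lambda>(z,w,v). h z w v) \<and>
    (\<forall>z w v z' w' v'. \<exists>p. \<forall>s. poly p s = h (z + s * z') (w + s * w') (v + s * v'))"

lemma complexifies_exists:
  assumes "real_polynomial_function f"
  shows "\<exists>h. complexifies f e d x h"
  using assms
proof (induction f rule: real_polynomial_function.induct)
  case (linear f)
  interpret bounded_linear f by fact
  let ?h = "\<lambda>z w v. z * complex_of_real (f e) + w * of_real (f d) + v * of_real (f x)"
  have "\<exists>p. \<forall>s. poly p s = ?h (z + s * z') (w + s * w') (v + s * v')" for z w v z' w' v'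
    by (rule exI[of _ "[:?h z w v, ?h z' w' v':]"]) (simp add: algebra_simps)
  moreover have "continuous_on UNIV (\<lambda>(z, w, v). ?h z w v)"
    by (auto simp: case_prod_unfold intro!: continuous_intros)
  moreover have "?h (of_real a) (of_real t) (of_real b) = of_real (f (a *\<^sub>R e + t *\<^sub>R d + b *\<^sub>R x))" for a t b
    by (simp add: add scaleR)
  ultimately have "complexifies f e d x ?h" unfolding complexifies_def by blast
  then show ?case by blast
next
  case (const c)
  have "\<exists>p. \<forall>s. poly p s = complex_of_real c"
    by (rule exI[of _ "[:of_real c:]"]) simp
  then have "complexifies (\<lambda>_. c) e d x (\<lambda>_ _ _. of_real c)" unfolding complexifies_def by simp
  then show ?case by blast
next
  case (add f g)
  then obtain h k where hk: "complexifies f e d x h" "complexifies g e d x k" by blast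
  have "\<exists>p. \<forall>s. poly p s = h (z + s * z') (w + s * w') (v + s * v') + k (z + s * z') (w + s * w') (v + s * v')"
    for z w v z' w' v' using hk unfolding complexifies_def by (metis poly_add)
  with hk have "complexifies (\<lambda>x. f x + g x) e d x (\<lambda>z w v. h z w v + k z w v)"
    unfolding complexifies_def by (auto simp: case_prod_unfold intro!: continuous_intros)
  then show ?case by blast
next
  case (mult f g)
  then obtain h k where hk: "complexifies f e d x h" "complexifies g e d x k" by blast
  have "\<exists>p. \<forall>s. poly p s = h (z + s * z') (w + s * w') (v + s * v') * k (z + s * z') (w + s * w') (v + s * v')"
    for z w v z' w' v' using hk unfolding complexifies_def by (metis poly_mult)
  with hk have "complexifies (\<lambda>x. f x * g x) e d x (\<lambda>z w v. h z w v * k z w v)"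
    unfolding complexifies_def by (auto simp: case_prod_unfold intro!: continuous_intros)
  then show ?case by blast
qed

lemma complex_poly_eq_on_reals:
  fixes p q :: "complex poly"
  assumes "\<And>t::real. poly p (of_real t) = poly q (of_real t)"
  shows "p = q"
proof (rule ccontr)
  assume "p \<noteq> q"
  then have "finite {z. poly (p - q) z = 0}" by (intro poly_roots_finite) simp
  moreover have "of_real ` (UNIV::real set) \<subseteq> {z. poly (p - q) z = 0}" using assms by auto
  ultimately have "finite (of_real ` (UNIV::real set) :: complex set)" by (rule rev_finite_subset)
  then show False using finite_imageD[of complex_of_real UNIV] infinite_UNIV_char_0[where 'a=real]
    by (auto simp: inj_on_def)
qed

text \<open>
  The identity holds for real arguments, and each of the four variables is freed in turn, since
  two polynomials that agree on the reals coincide.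
\<close>

lemma complexification_homogeneous:
  fixes h :: "complex \<Rightarrow> complex \<Rightarrow> complex \<Rightarrow> complex"
  assumes h: "complexifies f e d x h"
    and hom: "\<And>t y. f (t *\<^sub>R y) = t ^ N * f y"
  shows "h (s * z) (s * w) (s * v) = s ^ N * h z w v"
proof -
  have real: "h (of_real a) (of_real t) (of_real b) = of_real (f (a *\<^sub>R e + t *\<^sub>R d + b *\<^sub>R x))" for a t b
    using h unfolding complexifies_def by blast
  have poly: "\<exists>p. \<forall>s. poly p s = h (z + s * z') (w + s * w') (v + s * v')" for z w v z' w' v'
    using h unfolding complexifies_def by blast
  have 1: "h (of_real s * of_real z) (of_real s * of_real w) (of_real s * of_real v) 
      = of_real s ^ N * h (of_real z) (of_real w) (of_real v)" for s z w v :: real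
  proof -
    have "f ((s * z) *\<^sub>R e + (s * w) *\<^sub>R d + (s * v) *\<^sub>R x) = s ^ N * f (z *\<^sub>R e + w *\<^sub>R d + v *\<^sub>R x)"
      unfolding hom[symmetric] by (simp add: scaleR_add_right)
    then show ?thesis using real[of "s * z" "s * w" "s * v"] real[of z w v] by simp
  qed
  have step: "F z = G z" if F: "\<exists>p. \<forall>s. poly p s = F s" "\<exists>p. \<forall>s. poly p s = G s" "\<And>t. F (of_real t) = G (of_real t)" 
    for F G :: "complex \<Rightarrow> complex" and z
  proof -
    obtain p q where "\<forall>s. poly p s = F s" "\<forall>s. poly q s = G s" using F(1,2) by blast
    with complex_poly_eq_on_reals[of p q] F(3) show ?thesis by metis
  qed
  have sm: "\<exists>p. \<forall>s. poly p s = c * F s" if "\<exists>p. \<forall>s. poly p s = F s" for F and c :: complex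
    using that by (metis poly_smult)
  have sp: "\<exists>p. \<forall>s. poly p s = s ^ N * c" for c :: complex
    by (metis mult.commute poly_monom)
  have 2: "h (of_real s * z) (of_real s * of_real w) (of_real s * of_real v) 
      = of_real s ^ N * h z (of_real w) (of_real v)" for s w v :: real and z
    apply (rule step[of "\<lambda>z. h (of_real s * z) (of_real s * of_real w) (of_real s * of_real v)" "\<lambda>z. of_real s ^ N * h z (of_real w) (of_real v)"])
    subgoal using poly[of 0 "of_real s" "of_real s * of_real w" 0 "of_real s * of_real v" 0] by (simp add: mult.commute)
    subgoal using sm[OF poly[of 0 1 "of_real w" 0 "of_real v" 0]] by simp
    by (rule 1)
  have 3: "h (of_real s * z) (of_real s * w) (of_real s * of_real v) 
      = of_real s ^ N * h z w (of_real v)" for s v :: real and z w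
    apply (rule step[of "\<lambda>w. h (of_real s * z) (of_real s * w) (of_real s * of_real v)" "\<lambda>w. of_real s ^ N * h z w (of_real v)"])
    subgoal using poly[of "of_real s * z" 0 0 "of_real s" "of_real s * of_real v" 0] by (simp add: mult.commute)
    subgoal using sm[OF poly[of z 0 0 1 "of_real v" 0]] by simp
    by (rule 2)
  have 4: "h (of_real s * z) (of_real s * w) (of_real s * v) 
      = of_real s ^ N * h z w v" for s :: real and z w v
    apply (rule step[of "\<lambda>v. h (of_real s * z) (of_real s * w) (of_real s * v)" "\<lambda>v. of_real s ^ N * h z w v"])
    subgoal using poly[of "of_real s * z" 0 "of_real s * w" 0 0 "of_real s"] by (simp add: mult.commute)
    subgoal using sm[OF poly[of z 0 w 0 0 1]] by simp
    by (rule 3)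
  show ?thesis
    apply (rule step[of "\<lambda>s. h (s * z) (s * w) (s * v)" "\<lambda>s. s ^ N * h z w v"])
    subgoal using poly[of 0 z 0 w 0 v] by simp
    subgoal by (rule sp)
    by (rule 4)
qed

text \<open>
  The numbers \<open>l\<close> are the negatives of the roots; they are positive when \<open>v\<close> lies in the cone of \<open>e\<close>.
\<close>

definition hyperbolic_along :: "nat \<Rightarrow> ('a::real_vector \<Rightarrow> real) \<Rightarrow> 'a \<Rightarrow> bool" where
  "hyperbolic_along N g e \<longleftrightarrow>
     (\<forall>v. \<exists>\<Lambda>::real multiset. size \<Lambda> = N \<and> (\<forall>t. g (t *\<^sub>R e + v) = g e * (\<Prod>l\<in>#\<Lambda>. t + l)))"

text \<open>
  Homogeneity makes the degree of \<open>t \<mapsto> g (t e + v)\<close> equal to \<open>N\<close>, so the \<open>N\<close> real roots are all of them.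
\<close>

lemma hyperbolic_alongI:
  fixes g :: "'a::real_normed_vector \<Rightarrow> real"
  assumes g: "real_polynomial_function g" and hom: "\<And>t y. g (t *\<^sub>R y) = t ^ N * g y"
    and ge: "g e \<noteq> 0"
    and p: "\<And>v. \<exists>p::real poly. (\<forall>t. poly p t = g (t *\<^sub>R e + v)) \<and> p \<noteq> 0 \<and> size (proots p) = N"
  shows "hyperbolic_along N g e"
  unfolding hyperbolic_along_def
proof
  fix v
  obtain p where p: "\<And>t. poly p t = g (t *\<^sub>R e + v)" "p \<noteq> 0" "size (proots p) = N" using p by blast
  obtain r where r: "\<And>t. poly r t = g (e + t *\<^sub>R v)" using real_polynomial_on_line[OF g] by blast
  have pr: "poly p w = w ^ N * poly r (1/w)" if "w \<noteq> 0" for w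
    using hom[of w "e + (1/w) *\<^sub>R v"] that by (simp add: p r scaleR_add_right)
  have r0: "poly r 0 = g e" by (simp add: r)
  note deg = degree_of_reversed_poly[OF pr, unfolded r0, OF _ ge]
  obtain q where q: "p = q * (\<Prod>r\<in>#proots p. [:-r, 1:])" using proots_factor[OF p(2)] by blast
  have d1: "degree (\<Prod>r\<in>#M. [:-r, 1::real:]) = size M" and l1: "lead_coeff (\<Prod>r\<in>#M. [:-r, 1::real:]) = 1" for M
  proof (induction M)
    case (add x M)
    { case 1 show ?case using add by (simp del: mult_pCons_left) (subst degree_mult_eq, auto) }
    { case 2 show ?case using add by (simp del: mult_pCons_left add: lead_coeff_mult) }
  qed auto
  have q0: "q \<noteq> 0" and n0: "(\<Prod>r\<in>#proots p. [:-r, 1:]) \<noteq> 0" using q p(2) by auto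
  have "degree q = 0" using deg(1) p(3) d1[of "proots p"] arg_cong[OF q, of degree] degree_mult_eq[OF q0 n0]
    by (simp)
  moreover have "lead_coeff q = g e" using deg(2) arg_cong[OF q, of lead_coeff] l1[of "proots p"] by (simp add: lead_coeff_mult)
  ultimately have qq: "q = [:g e:]" by (metis degree_0_id)
  have "g (t *\<^sub>R e + v) = g e * (\<Prod>l\<in>#image_mset uminus (proots p). t + l)" for t
  proof -
    have "g (t *\<^sub>R e + v) = poly p t" by (simp add: p)
    also have "\<dots> = g e * poly (\<Prod>r\<in>#proots p. [:-r, 1:]) t" by (subst q) (simp add: qq)
    also have "poly (\<Prod>r\<in>#proots p. [:-r, 1:]) t = (\<Prod>l\<in>#image_mset uminus (proots p). t + l)"
      by (simp add: poly_prod_mset image_mset.compositionality o_def)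
    finally show ?thesis .
  qed
  then show "\<exists>\<Lambda>. size \<Lambda> = N \<and> (\<forall>t. g (t *\<^sub>R e + v) = g e * (\<Prod>l\<in>#\<Lambda>. t + l))"
    using p(3) by (metis size_image_mset)
qed

lemma prod_mset_real_roots:
  assumes "\<And>r. r \<in># A \<Longrightarrow> Im r = 0"
  shows "(\<Prod>r\<in>#A. of_real t - r) = complex_of_real (\<Prod>r\<in>#A. t - Re r)"
  using assms
proof (induction A)
  case (add r A)
  have eq: "complex_of_real t - r = of_real (t - Re r)" using add.prems by (simp add: complex_eq_iff)
  have IH: "(\<Prod>r\<in>#A. of_real t - r) = complex_of_real (\<Prod>r\<in>#A. t - Re r)" using add.prems by (intro add.IH) simp
  show ?case unfolding image_mset_add_mset prod_mset.add_mset of_real_mult eq IH by (rule refl)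
qed simp

text \<open>
  A polynomial whose roots lie in the open lower half plane is bounded below on the upper half plane. Unlike the
  condition on the roots, the resulting lower bound is closed under limits of polynomials.
\<close>

lemma norm_prod_mset_lower_half_plane:
  fixes A :: "complex multiset"
  assumes "\<And>r. r \<in># A \<Longrightarrow> Im r < 0" "Im w > 0"
  shows "Im w ^ size A \<le> norm (\<Prod>r\<in>#A. w - r)"
  using assms(1)
proof (induction A)
  case (add r A)
  have "Im w \<le> Im (w - r)" using add.prems[of r] by simp
  also have "\<dots> \<le> norm (w - r)" using abs_Im_le_cmod[of "w - r"] by linarith
  finally have "Im w \<le> norm (w - r)" .
  moreover have "Im w ^ size A \<le> norm (\<Prod>r\<in>#A. w - r)" using add.prems by (intro add.IH) simp
  ultimately show ?case using assms(2) by (simp add: norm_mult mult_mono)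
qed simp

text \<open>
  Consider the roots \<open>w\<close> of \<open>g (\<i> e + w d + b x)\<close>, with real \<open>b\<close>. None is real, because \<open>g\<close> has only real roots
  in the direction \<open>e\<close>. For \<open>b = 0\<close> homogeneity and the hypothesis on \<open>d\<close> place all of them in
  the lower half plane, and as they cannot cross the real axis they stay there for every \<open>b\<close>. Rescaling replaces \<open>\<i> e\<close>
  by \<open>\<i> s e\<close>; as \<open>s\<close> tends to \<open>0\<close> the roots of \<open>g (w d + x)\<close> are seen to have nonpositive imaginary
  part. The same for \<open>- x\<close> shows that they are real.
\<close>

lemma hyperbolic_along_transfer:
  fixes g :: "'a::euclidean_space \<Rightarrow> real"
  assumes g: "real_polynomial_function g" and hom: "\<And>t y. g (t *\<^sub>R y) = t ^ N * g y"
    and e: "hyperbolic_along N g e" "g e > 0"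
    and d: "\<And>t. t \<ge> 0 \<Longrightarrow> g (d + t *\<^sub>R e) > 0"
  shows "hyperbolic_along N g d"
  unfolding hyperbolic_along_def
proof
  fix x
  obtain h where h: "complexifies g e d x h" using complexifies_exists[OF g] by blast
  have h_real: "h (of_real a) (of_real t) (of_real b) = of_real (g (a *\<^sub>R e + t *\<^sub>R d + b *\<^sub>R x))" for a t b
    using h unfolding complexifies_def by blast
  have h_cont: "continuous_on UNIV (\<lambda>(z,w,v). h z w v)"
    using h unfolding complexifies_def by blast
  have h_poly: "\<exists>p. \<forall>s. poly p s = h (z + s * z') (w + s * w') (v + s * v')" for z w v z' w' v'
    using h unfolding complexifies_def by blast
  have h_hom: "h (s * z) (s * w) (s * v) = s ^ N * h z w v" for s z w v
    by (rule complexification_homogeneous[OF h hom])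
  have h_cont': "continuous_on S (\<lambda>y. h (z y) (w y) (v y))"
    if "continuous_on S z" "continuous_on S w" "continuous_on S v" for z w v and S :: "'c::topological_space set"
    using continuous_on_compose2[OF h_cont, of S "\<lambda>y. (z y, w y, v y)"] that
    by (simp add: continuous_on_Pair)
  have gd: "g d > 0" using d[of 0] by simp
  have h010: "h 0 1 0 = of_real (g d)" using h_real[of 0 1 0] by simp
  have nonreal: "z \<in> \<real>" if "h z (of_real t) (of_real b) = 0" for z t b
  proof -
    obtain \<Lambda> where L: "\<And>s. g (s *\<^sub>R e + (t *\<^sub>R d + b *\<^sub>R x)) = g e * (\<Prod>l\<in>#\<Lambda>. s + l)"
      using e(1) unfolding hyperbolic_along_def by blast
    obtain p where p: "\<And>s. poly p s = h s (of_real t) (of_real b)"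
      using h_poly[of 0 1 "of_real t" 0 "of_real b" 0] by auto
    let ?q = "smult (of_real (g e)) (\<Prod>l\<in>#\<Lambda>. [:complex_of_real l, 1:])"
    have prod_real: "(\<Prod>l\<in>#M. complex_of_real l + of_real s) = of_real (\<Prod>l\<in>#M. s + l)" for s M
      by (induction M) (auto simp: add.commute)
    have "p = ?q"
    proof (rule complex_poly_eq_on_reals)
      fix s :: real
      have "poly p (of_real s) = of_real (g (s *\<^sub>R e + (t *\<^sub>R d + b *\<^sub>R x)))"
        unfolding p h_real by (simp add: add.assoc)
      also have "\<dots> = poly ?q (of_real s)"
        unfolding L by (simp add: poly_prod_mset image_mset.compositionality o_def prod_real)
      finally show "poly p (of_real s) = poly ?q (of_real s)" .
    qed
    then have "poly ?q z = 0" using that p by metis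
    then have "\<exists>l\<in>#\<Lambda>. of_real l + z = 0"
      using e(2) by (auto simp: poly_prod_mset image_mset.compositionality o_def prod_mset_zero_iff)
    then show ?thesis by (metis Reals_minus_iff Reals_of_real add_eq_0_iff minus_minus)
  qed
  have deg: "degree p = N" "lead_coeff p = of_real (g d)" if p: "\<And>w. poly p w = h z w v" for p z v
  proof -
    obtain r where r: "\<And>s. poly r s = h (s * z) 1 (s * v)"
      using h_poly[of 0 z 1 0 0 v] by auto
    have pr: "poly p w = w ^ N * poly r (1/w)" if "w \<noteq> 0" for w
      using h_hom[of w "z/w" 1 "v/w"] that by (simp add: p r)
    have r0: "poly r 0 = of_real (g d)" by (simp add: r h010)
    show "degree p = N" "lead_coeff p = of_real (g d)"
      using degree_of_reversed_poly[OF pr] r0 gd by auto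
  qed
  have split: "\<exists>A. size A = N \<and> (\<forall>w. h z w v = of_real (g d) * (\<Prod>r\<in>#A. w - r))" for z v
  proof -
    obtain p where p: "\<And>w. poly p w = h z w v"
      using h_poly[of z 0 0 1 v 0] by auto
    have "p \<noteq> 0" using deg(2)[OF p] gd by auto
    then obtain A where A: "size A = degree p" "p = smult (lead_coeff p) (\<Prod>x\<in>#A. [:-x, 1:])"
      using alg_closed_imp_factorization by blast
    have "h z w v = of_real (g d) * (\<Prod>r\<in>#A. w - r)" for w
    proof -
      have "h z w v = poly p w" by (simp add: p)
      also have "\<dots> = of_real (g d) * poly (\<Prod>x\<in>#A. [:-x, 1:]) w"
        by (subst A(2)) (simp add: deg(2)[OF p])
      also have "\<dots> = of_real (g d) * (\<Prod>r\<in>#A. w - r)"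
        by (simp add: poly_prod_mset image_mset.compositionality o_def)
      finally show ?thesis .
    qed
    with A(1) deg(1)[OF p] show ?thesis by auto
  qed

  \<comment> \<open>Both sets are closed, they are disjoint and they cover the line, so that connectedness applies.\<close>
  define P where "P = {b::real. \<forall>w. Im w > 0 \<longrightarrow> g d * Im w ^ N \<le> norm (h \<i> w (of_real b))}"
  define Q where "Q = {b::real. \<exists>w. Im w \<ge> 0 \<and> h \<i> w (of_real b) = 0}"
  have "closed P"
    unfolding P_def by (intro closed_Collect_all closed_Collect_imp closed_Collect_le continuous_intros h_cont') auto
  moreover have "closed Q"
    unfolding closed_sequential_limits
  proof (intro allI impI, elim conjE)
    fix b :: "nat \<Rightarrow> real" and b0
    assume bQ: "\<forall>n. b n \<in> Q" and lim: "b \<longlonglongrightarrow> b0"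
    obtain w where w: "\<And>n. Im (w n) \<ge> 0" "\<And>n. h \<i> (w n) (of_real (b n)) = 0"
      using bQ unfolding Q_def by simp metis
    have "continuous_on UNIV (\<lambda>(z,v). h z 1 v)"
      unfolding case_prod_unfold by (intro h_cont' continuous_intros)
    then have "isCont (\<lambda>(z,v). h z 1 v) (0,0)" by (simp add: continuous_on_eq_continuous_at)
    moreover have "norm (h 0 1 0) > 0" using h010 gd by simp
    ultimately have "\<exists>\<delta>>0. \<forall>y. dist y (0,0) < \<delta> \<longrightarrow> dist ((\<lambda>(z,v). h z 1 v) y) ((\<lambda>(z,v). h z 1 v) (0,0)) < norm (h 0 1 0)"
      unfolding continuous_at_eps_delta by blast
    then obtain \<delta> where \<delta>: "\<delta> > 0" "\<And>y. dist y (0,0) < \<delta> \<Longrightarrow> dist ((\<lambda>(z,v). h z 1 v) y) (h 0 1 0) < norm (h 0 1 0)"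
      by auto
    \<comment> \<open>After division by \<open>w ^ N\<close> a large root would be a zero close to \<open>h 0 1 0 = g d\<close>, so the roots stay bounded.\<close>
    have nz: "h z 1 v \<noteq> 0" if "norm z + norm v < \<delta>" for z v
    proof -
      have "norm (z,v) \<le> norm z + norm v" by (rule norm_Pair_le)
      then have "dist (z,v) (0,0) < \<delta>" using that by (simp add: dist_norm flip: zero_prod_def)
      from \<delta>(2)[OF this] show ?thesis by auto
    qed
    obtain K where K: "\<And>n. \<bar>b n\<bar> \<le> K" 
      using convergent_imp_Bseq[of b] lim by (auto simp: convergent_def Bseq_def)
    have "norm (w n) \<le> (1 + K) / \<delta>" for n
    proof (rule ccontr)
      assume "\<not> ?thesis"
      then have big: "norm (w n) > (1 + K) / \<delta>" by simp
      have K0: "K \<ge> 0" using K[of n] by linarith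
      have pos: "norm (w n) > 0" using big \<delta>(1) K0
        by (meson add_nonneg_nonneg divide_nonneg_pos le_less_trans zero_le_one)
      have "norm (\<i> / w n) + norm (of_real (b n) / w n) = (1 + \<bar>b n\<bar>) / norm (w n)"
        by (simp add: norm_divide add_divide_distrib)
      also have "\<dots> \<le> (1 + K) / norm (w n)" using K[of n] pos by (simp add: divide_right_mono)
      also have "\<dots> < \<delta>" using big \<delta>(1) pos by (simp add: field_simps)
      finally have "h (\<i> / w n) 1 (of_real (b n) / w n) \<noteq> 0" by (rule nz)
      with h_hom[of "w n" "\<i> / w n" 1 "of_real (b n) / w n"] pos w(2)[of n]
      show False by simp
    qed
    then have "bounded (range w)" by (auto simp: bounded_iff)
    then obtain l f where f: "strict_mono f" "(w \<circ> f) \<longlonglongrightarrow> l"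
      using bounded_imp_convergent_subsequence by blast
    have "((\<lambda>n. Im (w (f n))) \<longlonglongrightarrow> Im l)" using f(2) by (auto simp: o_def intro: tendsto_Im)
    then have "Im l \<ge> 0" by (rule LIMSEQ_le_const) (use w(1) in auto)
    moreover have "(\<lambda>n. h \<i> (w (f n)) (of_real (b (f n)))) \<longlonglongrightarrow> h \<i> l (of_real b0)"
    proof -
      have "isCont (\<lambda>(z,w,v). h z w v) (\<i>, l, of_real b0)" using h_cont by (simp add: continuous_on_eq_continuous_at)
      moreover have "(\<lambda>n. (\<i>, w (f n), complex_of_real (b (f n)))) \<longlonglongrightarrow> (\<i>, l, of_real b0)"
        using f(2) LIMSEQ_subseq_LIMSEQ[OF lim f(1)] by (auto simp: o_def intro!: tendsto_Pair tendsto_of_real)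
      ultimately have "(\<lambda>n. (\<lambda>(z,w,v). h z w v) (\<i>, w (f n), complex_of_real (b (f n)))) \<longlonglongrightarrow> (\<lambda>(z,w,v). h z w v) (\<i>, l, of_real b0)"
        by (rule isCont_tendsto_compose)
      then show ?thesis by simp
    qed
    then have "h \<i> l (of_real b0) = 0" using w(2) by (simp add: LIMSEQ_const_iff)
    ultimately show "b0 \<in> Q" unfolding Q_def by blast
  qed
  moreover have "UNIV \<subseteq> P \<union> Q"
  proof
    fix b :: real
    show "b \<in> P \<union> Q"
    proof (cases "b \<in> Q")
      case False
      obtain A where A: "size A = N" "\<And>w. h \<i> w (of_real b) = of_real (g d) * (\<Prod>r\<in>#A. w - r)"
        using split[of \<i> "of_real b"] by blast
      have neg: "Im r < 0" if "r \<in># A" for r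
      proof -
        have "h \<i> r (of_real b) = 0" unfolding A(2) using that by (auto simp: prod_mset_zero_iff)
        with False have "\<not> 0 \<le> Im r" unfolding Q_def by blast
        then show ?thesis by simp
      qed
      have "g d * Im w ^ N \<le> norm (h \<i> w (of_real b))" if w: "Im w > 0" for w
      proof -
        have "Im w ^ size A \<le> norm (\<Prod>r\<in>#A. w - r)"
          using neg w by (intro norm_prod_mset_lower_half_plane) auto
        then show ?thesis unfolding A(2) using A(1) neg gd by (auto simp: norm_mult)
      qed
      then show ?thesis unfolding P_def by simp
    qed simp
  qed
  moreover have "P \<inter> Q \<inter> UNIV = {}"
  proof -
    have False if bP: "b \<in> P" and bQ: "b \<in> Q" for b
    proof -
      obtain w where w: "Im w \<ge> 0" "h \<i> w (of_real b) = 0" using bQ unfolding Q_def by blast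
      have "Im w = 0"
      proof (rule ccontr)
        assume "Im w \<noteq> 0"
        with w(1) have "Im w > 0" by simp
        with bP w(2) have "g d * Im w ^ N \<le> 0" unfolding P_def by auto
        moreover have "g d * Im w ^ N > 0" using \<open>Im w > 0\<close> gd by simp
        ultimately show False by linarith
      qed
      then have "w = of_real (Re w)" by (simp add: complex_eq_iff)
      with w(2) have "h \<i> (of_real (Re w)) (of_real b) = 0" by simp
      then have "\<i> \<in> \<real>" by (rule nonreal)
      then show False by (simp add: complex_is_Real_iff)
    qed
    then show ?thesis by blast
  qed
  moreover have "0 \<notin> Q"
  proof
    assume "0 \<in> Q"
    then obtain w where w: "Im w \<ge> 0" "h \<i> w 0 = 0" unfolding Q_def by auto
    have "w \<noteq> 0"
    proof
      assume "w = 0"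
      with w(2) h_hom[of \<i> 1 0 0] have "h 1 0 0 = 0" by simp
      with h_real[of 1 0 0] e(2) show False by simp
    qed
    have "h (\<i> / w) 1 0 = 0" using h_hom[of w "\<i> / w" 1 0] w(2) \<open>w \<noteq> 0\<close> by simp
    then have "\<i> / w \<in> \<real>" using nonreal[of "\<i> / w" 1 0] by simp
    then obtain s where s: "\<i> / w = of_real s" by (auto elim: Reals_cases)
    with \<open>h (\<i> / w) 1 0 = 0\<close> h_real[of s 1 0] have gs: "g (d + s *\<^sub>R e) = 0" by (simp add: add.commute)
    have "s < 0" using d[of s] gs by (rule_tac ccontr) simp
    have "\<i> = of_real s * w" using s \<open>w \<noteq> 0\<close> by (simp add: field_simps)
    then have "Im \<i> = Im (of_real s * w)" by (rule arg_cong)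
    then have "1 = s * Im w" by simp
    moreover have "s * Im w \<le> 0" using \<open>s < 0\<close> w(1) by (simp add: mult_nonpos_nonneg)
    ultimately show False by simp
  qed
  ultimately have "0 \<notin> Q" "UNIV \<subseteq> P \<union> Q" "P \<inter> UNIV = {} \<or> Q \<inter> UNIV = {}"
    using connected_closedD[OF connected_UNIV, of P Q] by simp_all
  then have PU: "P = UNIV" by auto
  \<comment> \<open>Rescaling puts \<open>s * \<i>\<close> in place of \<open>\<i>\<close> in the bound that defines \<open>P\<close> and leaves its left side unchanged; then \<open>s\<close> tends to \<open>0\<close>.\<close>
  have P1: "g d * Im w ^ N \<le> norm (h 0 w (of_real b))" if w: "Im w > 0" for w b
  proof -
    have "g d * Im w ^ N \<le> norm (h (of_real s * \<i>) w (of_real b))" if s: "s > 0" for s :: real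
    proof -
      have "Im (w / of_real s) = Im w / s" by (simp add: Im_divide_of_real)
      moreover have "b / s \<in> P" using PU by simp
      ultimately have "g d * (Im w / s) ^ N \<le> norm (h \<i> (w / of_real s) (of_real (b / s)))"
        using w s unfolding P_def by (metis (no_types, lifting) divide_pos_pos mem_Collect_eq)
      then have "s ^ N * (g d * (Im w / s) ^ N) \<le> s ^ N * norm (h \<i> (w / of_real s) (of_real (b / s)))"
        using s by (intro mult_left_mono) auto
      also have "\<dots> = norm (h (of_real s * \<i>) w (of_real b))"
        using h_hom[of "of_real s" \<i> "w / of_real s" "of_real (b / s)"] s by (simp add: norm_mult norm_power)
      finally show ?thesis using s by (simp add: power_divide)
    qed
    moreover have "((\<lambda>s. norm (h (of_real s * \<i>) w (of_real b))) \<longlongrightarrow> norm (h (of_real 0 * \<i>) w (of_real b))) (at_right 0)"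
    proof -
      have "continuous_on UNIV (\<lambda>s. norm (h (of_real s * \<i>) w (of_real b)))"
        by (intro continuous_intros h_cont')
      then have "isCont (\<lambda>s. norm (h (of_real s * \<i>) w (of_real b))) 0" by (simp add: continuous_on_eq_continuous_at)
      then show ?thesis by (simp add: isCont_def filterlim_at_split)
    qed
    moreover have "\<forall>\<^sub>F s in at_right 0. (0::real) < s" by (rule eventually_at_right_less)
    ultimately have "g d * Im w ^ N \<le> norm (h (of_real 0 * \<i>) w (of_real b))"
      by (intro tendsto_lowerbound[where F = "at_right 0"]) (auto elim: eventually_mono)
    then show ?thesis by simp
  qed
  obtain A where A: "size A = N" "\<And>w. h 0 w 1 = of_real (g d) * (\<Prod>r\<in>#A. w - r)"
    using split[of 0 1] by blast
  have Areal: "Im r = 0" if "r \<in># A" for r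
  proof -
    have z: "h 0 r 1 = 0" unfolding A(2) using that by (auto simp: prod_mset_zero_iff)
    have nz: "h 0 w (of_real b) \<noteq> 0" if "Im w > 0" for w b
    proof -
      have "0 < g d * Im w ^ N" using that gd by simp
      then show ?thesis using P1[OF that, of b] by auto
    qed
    have "\<not> Im r > 0" using nz[of r 1] z by auto
    moreover have "\<not> Im (-r) > 0" using nz[of "-r" "-1"] h_hom[of "-1" 0 r 1] z by auto
    ultimately show ?thesis by simp
  qed
  have "g (t *\<^sub>R d + x) = g d * (\<Prod>l\<in>#image_mset (\<lambda>r. - Re r) A. t + l)" for t
  proof -
    let ?p = "\<Prod>r\<in>#A. t - Re r"
    have "complex_of_real (g d * ?p) = complex_of_real (g d) * (\<Prod>r\<in>#A. of_real t - r)"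
      unfolding of_real_mult using prod_mset_real_roots[of A t] Areal by simp
    also have "\<dots> = h 0 (of_real t) 1" by (rule A(2)[symmetric])
    also have "\<dots> = complex_of_real (g (t *\<^sub>R d + x))" using h_real[of 0 t 1] by simp
    finally have "g (t *\<^sub>R d + x) = g d * ?p" by (simp only: of_real_eq_iff)
    then show ?thesis by (simp add: image_mset.compositionality o_def)
  qed
  then show "\<exists>\<Lambda>. size \<Lambda> = N \<and> (\<forall>t. g (t *\<^sub>R d + x) = g d * (\<Prod>l\<in>#\<Lambda>. t + l))"
    using A(1) by (intro exI[of _ "image_mset (\<lambda>r. - Re r) A"]) auto
qed

section \<open>Products over the roots\<close>

lemma ln_prod_mset_le_sum:
  fixes A :: "real multiset"
  assumes "\<And>l. l \<in># A \<Longrightarrow> 1 + l > 0"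
  shows "(\<Prod>l\<in>#A. 1 + l) > 0" "ln (\<Prod>l\<in>#A. 1 + l) \<le> \<Sum>\<^sub># A"
    "ln (\<Prod>l\<in>#A. 1 + l) = \<Sum>\<^sub># A \<Longrightarrow> l \<in># A \<Longrightarrow> l = 0"
proof -
  have "(\<Prod>l\<in>#A. 1 + l) > 0 \<and> ln (\<Prod>l\<in>#A. 1 + l) \<le> \<Sum>\<^sub># A \<and>
    (ln (\<Prod>l\<in>#A. 1 + l) = \<Sum>\<^sub># A \<longrightarrow> (\<forall>l. l \<in># A \<longrightarrow> l = 0))"
    using assms
  proof (induction A)
    case (add l A)
    have IH: "(\<Prod>l\<in>#A. 1 + l) > 0" "ln (\<Prod>l\<in>#A. 1 + l) \<le> \<Sum>\<^sub># A"
      "ln (\<Prod>l\<in>#A. 1 + l) = \<Sum>\<^sub># A \<longrightarrow> (\<forall>l. l \<in># A \<longrightarrow> l = 0)"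
      using add by simp_all
    have l: "1 + l > 0" using add.prems by simp
    have ln: "ln (\<Prod>l\<in>#add_mset l A. 1 + l) = ln (1 + l) + ln (\<Prod>l\<in>#A. 1 + l)"
      using l IH(1) by (simp add: ln_mult_pos)
    have le: "ln (1 + l) \<le> l" using l by (simp add: ln_add_one_self_le_self2)
    have "l = 0" if "ln (1 + l) = l" using ln_eq_minus_one[of "1 + l"] l that by simp
    then show ?case using ln l le IH by auto
  qed simp
  then show "(\<Prod>l\<in>#A. 1 + l) > 0" "ln (\<Prod>l\<in>#A. 1 + l) \<le> \<Sum>\<^sub># A"
    "ln (\<Prod>l\<in>#A. 1 + l) = \<Sum>\<^sub># A \<Longrightarrow> l \<in># A \<Longrightarrow> l = 0" by blast+
qed

lemma has_derivative_prod_mset_at_0: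
  fixes A :: "real multiset"
  shows "((\<lambda>t. \<Prod>l\<in>#A. 1 + t * l) has_real_derivative \<Sum>\<^sub># A) (at 0)"
proof (induction A)
  case (add l A)
  have "((\<lambda>t. (1 + t * l) * (\<Prod>l\<in>#A. 1 + t * l)) has_real_derivative l * (\<Prod>l\<in>#A. 1 + 0 * l) + (1 + 0 * l) * \<Sum>\<^sub># A) (at 0)"
    by (rule derivative_eq_intros refl add | simp)+
  then show ?case by simp
qed simp

lemma prod_roots_zero: "(\<And>l. l \<in># A \<Longrightarrow> l = 0) \<Longrightarrow> (\<Prod>l\<in>#A. 1 + t * l) = (1::real)"
  by (induction A) auto

section \<open>The Garding cone\<close>

locale garding_pair =
  fixes g :: "'a::euclidean_space \<Rightarrow> real" and \<Gamma> :: "'a set" and N :: nat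
  assumes degree_pos: "N \<ge> 1" and garding: "garding N g \<Gamma>"
begin

lemma poly: "real_polynomial_function g"
  using garding unfolding garding_def by blast

lemma homogeneous: "g (t *\<^sub>R x) = t ^ N * g x"
  using garding unfolding garding_def by blast

lemma component: "\<Gamma> \<in> components {x. g x > 0}"
  using garding unfolding garding_def by blast

lemma g_0: "g 0 = 0"
proof -
  have "(0::real) ^ N = 0" using degree_pos by simp
  then show ?thesis using homogeneous[of 0 0] by (metis mult_zero_left scaleR_zero_left)
qed

lemma pos: "x \<in> \<Gamma> \<Longrightarrow> g x > 0"
  using component in_components_subset by blast

lemma continuous_g: "continuous_on S (\<lambda>x. g (f x))" if "continuous_on S f" for f :: "'b::topological_space \<Rightarrow> 'a"
  using continuous_on_compose2[OF _ that, of UNIV g] continuous_real_polymonial_function[OF poly]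
  by (simp add: continuous_at_imp_continuous_on)

lemma open_pos: "open {x. g x > 0}"
  by (intro open_Collect_less continuous_intros continuous_g)

lemma open_cone: "open \<Gamma>"
  using open_components[OF open_pos component] .

text \<open>
  The right-hand side is star-shaped with centre \<open>e\<close>, hence connected. It is open because, after rescaling, it
  asks for positivity on the compact segment from \<open>d\<close> to \<open>e\<close>. It is closed in the set where \<open>g\<close> is positive because
  for its members \<open>g (d + t e)\<close> is nondecreasing in \<open>t \<ge> 0\<close>, and the inequality \<open>g (d + t e) \<ge> g d\<close> passes to limits.
\<close>

lemma component_of_direction:
  assumes e: "e \<in> \<Gamma>" "hyperbolic_along N g e"
  shows "\<Gamma> = {d. \<forall>t\<ge>0. g (d + t *\<^sub>R e) > 0}" (is "_ = ?C")
proof -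
  have ge: "g e > 0" using pos e(1) by blast
  have C_pos: "?C \<subseteq> {x. g x > 0}"
    by (auto dest: spec[of _ 0])
  have seg: "g ((1 - s) *\<^sub>R d + s *\<^sub>R e) > 0" if d: "d \<in> ?C" and s: "0 \<le> s" "s \<le> 1" for d s
  proof (cases "s = 1")
    case False
    then have s1: "1 - s > 0" using s by simp
    have "(1 - s) *\<^sub>R d + s *\<^sub>R e = (1 - s) *\<^sub>R (d + (s / (1 - s)) *\<^sub>R e)" using s1 by (simp add: scaleR_add_right)
    moreover have "g (d + (s / (1 - s)) *\<^sub>R e) > 0" using d s s1 by simp
    ultimately show ?thesis using s1 by (simp add: homogeneous)
  qed (simp add: ge)
  have C_seg: "?C = {d. \<forall>s\<in>{0..1}. g ((1 - s) *\<^sub>R d + s *\<^sub>R e) > 0}" (is "_ = ?D")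
  proof
    show "?C \<subseteq> ?D" using seg by auto
    show "?D \<subseteq> ?C"
    proof
      fix d assume d: "d \<in> ?D"
      have "g (d + t *\<^sub>R e) > 0" if t: "t \<ge> 0" for t
      proof -
        have "1 + t > 0" using t by simp
        moreover have "1 - t / (1 + t) = 1 / (1 + t)" using t by (simp add: field_simps)
        ultimately have "d + t *\<^sub>R e = (1 + t) *\<^sub>R ((1 - t / (1 + t)) *\<^sub>R d + (t / (1 + t)) *\<^sub>R e)"
          by (simp add: scaleR_add_right)
        moreover have "g ((1 - t / (1 + t)) *\<^sub>R d + (t / (1 + t)) *\<^sub>R e) > 0" using d t by auto
        ultimately show ?thesis using t by (simp add: homogeneous)
      qed
      then show "d \<in> ?C" by simp
    qed
  qed
  have "open ?C"
  proof -
    have "closed {(s::real, d). g ((1 - s) *\<^sub>R d + s *\<^sub>R e) \<le> 0}"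
      unfolding case_prod_unfold by (intro closed_Collect_le continuous_intros continuous_g)
    then have "closed {d. \<exists>s. s \<in> {0..1} \<and> (s, d) \<in> {(s::real, d). g ((1 - s) *\<^sub>R d + s *\<^sub>R e) \<le> 0}}"
      by (intro closed_compact_projection) auto
    moreover have "{d. \<exists>s. s \<in> {0..1} \<and> (s, d) \<in> {(s::real, d). g ((1 - s) *\<^sub>R d + s *\<^sub>R e) \<le> 0}} = - ?C"
      unfolding C_seg by (auto simp flip: not_less)
    ultimately show ?thesis by (simp add: closed_def)
  qed
  have C_mono: "?C = {x. g x > 0} \<inter> {d. \<forall>t. t \<ge> 0 \<longrightarrow> g (d + t *\<^sub>R e) \<ge> g d}" (is "_ = _ \<inter> ?M")
  proof
    show "{x. g x > 0} \<inter> ?M \<subseteq> ?C" by (auto intro: less_le_trans)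
    show "?C \<subseteq> {x. g x > 0} \<inter> ?M"
    proof
      fix d assume d: "d \<in> ?C"
      obtain \<Lambda> where L: "\<And>t. g (t *\<^sub>R e + d) = g e * (\<Prod>l\<in>#\<Lambda>. t + l)"
        using e(2) unfolding hyperbolic_along_def by blast
      have l: "l > 0" if "l \<in># \<Lambda>" for l
      proof (rule ccontr)
        assume "\<not> l > 0"
        then have "0 \<le> - l" by simp
        then have "g (d + (- l) *\<^sub>R e) > 0" using d by blast
        moreover have "g (d + (- l) *\<^sub>R e) = 0" using L[of "- l"] that by (auto simp: add.commute prod_mset_zero_iff)
        ultimately show False by simp
      qed
      have "g (d + t *\<^sub>R e) \<ge> g d" if t: "t \<ge> 0" for t
      proof -
        have "(\<Prod>l\<in>#\<Lambda>. l) \<le> (\<Prod>l\<in>#\<Lambda>. t + l) \<and> (\<Prod>l\<in>#\<Lambda>. l) \<ge> 0"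
          using l
        proof (induction \<Lambda>)
          case (add l A)
          then show ?case using t by (auto intro!: mult_mono simp: less_imp_le)
        qed simp
        then show ?thesis using L[of t] L[of 0] ge by (simp add: add.commute)
      qed
      with d C_pos show "d \<in> {x. g x > 0} \<inter> ?M" by auto
    qed
  qed
  have "closed ?M"
    by (intro closed_Collect_all closed_Collect_imp closed_Collect_le continuous_intros continuous_g) auto
  have eC: "e \<in> ?C"
  proof -
    have "e + t *\<^sub>R e = (1 + t) *\<^sub>R e" for t by (simp add: scaleR_add_left)
    then show ?thesis using ge by (simp add: homogeneous)
  qed
  have "connected ?C"
  proof (rule starlike_imp_connected)
    have "closed_segment e x \<subseteq> ?C" if x: "x \<in> ?C" for x
    proof
      fix y assume "y \<in> closed_segment e x"
      then obtain u where u: "0 \<le> u" "u \<le> 1" "y = (1 - u) *\<^sub>R e + u *\<^sub>R x" by (auto simp: in_segment)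
      have "g ((1 - s) *\<^sub>R y + s *\<^sub>R e) > 0" if s: "0 \<le> s" "s \<le> 1" for s
      proof -
        have "(1 - s) *\<^sub>R y + s *\<^sub>R e = (1 - (1 - (1 - s) * u)) *\<^sub>R x + (1 - (1 - s) * u) *\<^sub>R e"
          unfolding u(3) by (simp add: algebra_simps)
        moreover have "0 \<le> 1 - (1 - s) * u" "1 - (1 - s) * u \<le> 1" using s u by (auto simp: mult_le_one)
        ultimately show ?thesis using seg[OF x, of "1 - (1 - s) * u"] by presburger
      qed
      then show "y \<in> ?C" unfolding C_seg by simp
    qed
    then show "starlike ?C" unfolding starlike_def using eC by blast
  qed
  then have "?C \<subseteq> \<Gamma>"
    using components_maximal[OF component] C_pos eC e(1) by blast
  moreover have "\<Gamma> \<subseteq> ?C"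
  proof -
    have "connected \<Gamma>" using component by (rule in_components_connected)
    moreover have "openin (top_of_set \<Gamma>) (\<Gamma> \<inter> ?C)"
      using \<open>open ?C\<close> by (rule openin_open_Int)
    moreover have "closedin (top_of_set \<Gamma>) (\<Gamma> \<inter> ?C)"
    proof -
      have "\<Gamma> \<inter> ?C = \<Gamma> \<inter> ?M" using C_mono pos by blast
      then show ?thesis using closedin_closed_Int[OF \<open>closed ?M\<close>] by simp
    qed
    ultimately have "\<Gamma> \<inter> ?C = {} \<or> \<Gamma> \<inter> ?C = \<Gamma>" unfolding connected_clopen by blast
    then show ?thesis using e(1) eC by blast
  qed
  ultimately show ?thesis by blast
qed

lemma hyperbolic: "d \<in> \<Gamma> \<Longrightarrow> hyperbolic_along N g d"
proof -
  assume d: "d \<in> \<Gamma>"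
  obtain e where e: "e \<in> \<Gamma>" and p: "\<And>v. \<exists>p::real poly. (\<forall>t. poly p t = g (t *\<^sub>R e + v)) \<and> p \<noteq> 0 \<and> size (proots p) = N"
    using garding unfolding garding_def by blast
  have e': "hyperbolic_along N g e"
    using hyperbolic_alongI[OF poly homogeneous _ p] pos[OF e] by simp
  show ?thesis
    using hyperbolic_along_transfer[OF poly homogeneous e' pos[OF e]] component_of_direction[OF e e'] d by blast
qed

text \<open>
  Every point of the cone serves as a direction; this symmetry is what makes the cone convex.
\<close>

lemma cone_eq: "e \<in> \<Gamma> \<Longrightarrow> \<Gamma> = {d. \<forall>t\<ge>0. g (d + t *\<^sub>R e) > 0}"
  using component_of_direction hyperbolic by blast

lemma add_scaled_mem: "a \<in> \<Gamma> \<Longrightarrow> b \<in> \<Gamma> \<Longrightarrow> t \<ge> 0 \<Longrightarrow> a + t *\<^sub>R b \<in> \<Gamma>"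
proof -
  assume a: "a \<in> \<Gamma>" and b: "b \<in> \<Gamma>" and t: "t \<ge> 0"
  have "g (a + t *\<^sub>R b + s *\<^sub>R b) > 0" if "s \<ge> 0" for s
  proof -
    have "g (a + (t + s) *\<^sub>R b) > 0" using cone_eq[OF b] a t that by auto
    then show ?thesis by (simp add: scaleR_add_left add.assoc)
  qed
  then show ?thesis using cone_eq[OF b] by blast
qed

lemma add_mem: "a \<in> \<Gamma> \<Longrightarrow> b \<in> \<Gamma> \<Longrightarrow> a + b \<in> \<Gamma>"
  using add_scaled_mem[of a b 1] by simp

lemma scale_mem: "a \<in> \<Gamma> \<Longrightarrow> t > 0 \<Longrightarrow> t *\<^sub>R a \<in> \<Gamma>"
proof -
  assume a: "a \<in> \<Gamma>" and t: "t > 0"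
  have "g (t *\<^sub>R a + s *\<^sub>R a) > 0" if "s \<ge> 0" for s
    using homogeneous[of "t + s" a] pos[OF a] t that by (simp add: scaleR_add_left)
  then show ?thesis using cone_eq[OF a] by blast
qed

lemma convex_cone: "convex \<Gamma>"
proof (rule convexI)
  fix a b and u v :: real
  assume *: "a \<in> \<Gamma>" "b \<in> \<Gamma>" "0 \<le> u" "0 \<le> v" "u + v = 1"
  show "u *\<^sub>R a + v *\<^sub>R b \<in> \<Gamma>"
  proof (cases "u = 0")
    case False
    then show ?thesis using * by (intro add_scaled_mem scale_mem) auto
  qed (use * in auto)
qed

lemma cone_nonempty: "\<Gamma> \<noteq> {}"
  using component in_components_nonempty by blast

lemma add_closure_mem:
  assumes "a \<in> \<Gamma>" "b \<in> closure \<Gamma>"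
  shows "a + b \<in> \<Gamma>"
proof -
  obtain \<epsilon> where \<epsilon>: "\<epsilon> > 0" "ball a \<epsilon> \<subseteq> \<Gamma>" using open_cone assms(1) open_contains_ball by blast
  obtain c where c: "c \<in> \<Gamma>" "dist c b < \<epsilon>" using assms(2) \<epsilon>(1) closure_approachable by blast
  have "a + (b - c) \<in> \<Gamma>" using \<epsilon>(2) c(2) by (auto simp: subset_eq dist_norm norm_minus_commute)
  from add_mem[OF this c(1)] show ?thesis by simp
qed

lemma scale_closure_mem: "b \<in> closure \<Gamma> \<Longrightarrow> t \<ge> 0 \<Longrightarrow> t *\<^sub>R b \<in> closure \<Gamma>"
proof (cases "t = 0")
  case True
  assume "b \<in> closure \<Gamma>"
  have "0 \<in> closure \<Gamma>"
    unfolding closure_approachable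
  proof (intro allI impI)
    fix e :: real assume e: "e > 0"
    obtain a where a: "a \<in> \<Gamma>" using cone_nonempty by blast
    have "(e / (1 + norm a)) *\<^sub>R a \<in> \<Gamma>" using a e by (intro scale_mem) (auto intro!: divide_pos_pos add_pos_nonneg)
    moreover have "dist ((e / (1 + norm a)) *\<^sub>R a) 0 < e" using e
      by (simp add: field_simps add_pos_nonneg)
    ultimately show "\<exists>y\<in>\<Gamma>. dist y 0 < e" by blast
  qed
  then show ?thesis using True by simp
next
  case False
  assume b: "b \<in> closure \<Gamma>" and "t \<ge> 0"
  then have t: "t > 0" using False by simp
  have "(*\<^sub>R) t ` closure \<Gamma> \<subseteq> closure \<Gamma>"
    using closure_scaleR[of t \<Gamma>] scale_mem t closure_mono[of "(*\<^sub>R) t ` \<Gamma>" \<Gamma>] by (metis image_subsetI)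
  then show ?thesis using b by blast
qed

lemma pos_closure_mem: "x \<in> closure \<Gamma> \<Longrightarrow> g x > 0 \<Longrightarrow> x \<in> \<Gamma>"
proof -
  assume x: "x \<in> closure \<Gamma>" "g x > 0"
  have "connected (insert x \<Gamma>)"
    by (rule connected_intermediate_closure[of \<Gamma>])
      (use x(1) closure_subset in_components_connected[OF component] in auto)
  then have "insert x \<Gamma> \<subseteq> \<Gamma>"
    using components_maximal[OF component, of "insert x \<Gamma>"] x(2) pos cone_nonempty by auto
  then show ?thesis by blast
qed

text \<open>
  The homogeneous form of hyperbolicity: \<open>g (t a + v)\<close> with \<open>t\<close> replaced by \<open>1 / t\<close>.
\<close>

lemma line_roots:
  assumes "a \<in> \<Gamma>"
  shows "\<exists>\<Lambda>. size \<Lambda> = N \<and> (\<forall>t. g (a + t *\<^sub>R v) = g a * (\<Prod>l\<in>#\<Lambda>. 1 + t * l))"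
proof -
  obtain \<Lambda> where L: "size \<Lambda> = N" "\<And>t. g (t *\<^sub>R a + v) = g a * (\<Prod>l\<in>#\<Lambda>. t + l)"
    using hyperbolic[OF assms] unfolding hyperbolic_along_def by blast
  have pw: "t ^ size M * (\<Prod>l\<in>#M. 1 / t + l) = (\<Prod>l\<in>#M. 1 + t * l)" if "t \<noteq> 0" for t and M :: "real multiset"
  proof (induction M)
    case (add l M)
    have "t ^ size (add_mset l M) * (\<Prod>l\<in>#add_mset l M. 1 / t + l) = (t * (1 / t + l)) * (t ^ size M * (\<Prod>l\<in>#M. 1 / t + l))"
      by simp
    also have "\<dots> = (1 + t * l) * (\<Prod>l\<in>#M. 1 + t * l)" unfolding add using that by (simp add: distrib_left)
    finally show ?case by simp
  qed simp
  have "g (a + t *\<^sub>R v) = g a * (\<Prod>l\<in>#\<Lambda>. 1 + t * l)" for t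
  proof (cases "t = 0")
    case False
    have "g (a + t *\<^sub>R v) = g (t *\<^sub>R ((1 / t) *\<^sub>R a + v))" using False by (simp add: scaleR_add_right)
    also have "\<dots> = g a * (t ^ size \<Lambda> * (\<Prod>l\<in>#\<Lambda>. 1 / t + l))" unfolding homogeneous L(2) using L(1) by simp
    finally show ?thesis using pw[OF False] by simp
  qed simp
  with L(1) show ?thesis by blast
qed

section \<open>The edge and the concavity of the logarithm\<close>

text \<open>
  Defined through the cone instead of its closure; the two descriptions give the same subspace, and here the
  subspace laws hold by mere composition of translations.
\<close>

definition edge :: "'a set" where "edge = {v. \<forall>x\<in>\<Gamma>. \<forall>t. x + t *\<^sub>R v \<in> \<Gamma>}"

text \<open>
  A line on which \<open>g\<close> is constant and positive stays in the component. A point \<open>x\<close> of the open cone is \<open>\<delta> a\<close> plus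
  another point of the cone, which moves the line from \<open>a\<close> to \<open>x\<close>.
\<close>

lemma edgeI:
  assumes a: "a \<in> \<Gamma>" and v: "\<And>t. g (a + t *\<^sub>R v) = g a"
  shows "v \<in> edge"
proof -
  have "connected (range (\<lambda>t. a + t *\<^sub>R v))"
    by (intro connected_continuous_image continuous_intros) auto
  then have "range (\<lambda>t. a + t *\<^sub>R v) \<subseteq> \<Gamma>"
    using a v pos[OF a] by (intro components_maximal[OF component]) (auto intro: exI[of _ 0] simp: image_iff intro!: ex_in_conv[THEN iffD1] exI[of _ a])
  then have line: "a + t *\<^sub>R v \<in> \<Gamma>" for t by blast
  have "x + t *\<^sub>R v \<in> \<Gamma>" if x: "x \<in> \<Gamma>" for x t
  proof -
    obtain \<epsilon> where \<epsilon>: "\<epsilon> > 0" "ball x \<epsilon> \<subseteq> \<Gamma>" using open_cone x open_contains_ball by blast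
    define \<delta> where "\<delta> = \<epsilon> / (1 + norm a)"
    have \<delta>: "\<delta> > 0" unfolding \<delta>_def using \<epsilon>(1) by (simp add: add_pos_nonneg)
    have "norm (\<delta> *\<^sub>R a) < \<epsilon>" unfolding \<delta>_def using \<epsilon>(1) by (simp add: field_simps add_pos_nonneg)
    then have "x - \<delta> *\<^sub>R a \<in> \<Gamma>" using \<epsilon>(2) by (auto simp: subset_eq dist_norm)
    from add_scaled_mem[OF this line[of "t / \<delta>"], of \<delta>] show ?thesis using \<delta> by (simp add: scaleR_add_right)
  qed
  then show ?thesis unfolding edge_def by blast
qed

text \<open>
  A nonzero \<open>l\<close> would be a zero of \<open>g\<close> on a line that lies in the cone.
\<close>

lemma edge_roots_zero:
  assumes v: "v \<in> edge" and a: "a \<in> \<Gamma>" and L: "\<And>t. g (a + t *\<^sub>R v) = g a * (\<Prod>l\<in>#\<Lambda>. 1 + t * l)"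
    and l: "l \<in># \<Lambda>"
  shows "l = 0"
proof (rule ccontr)
  assume "l \<noteq> 0"
  then have "g (a + (- 1 / l) *\<^sub>R v) = 0" unfolding L using l by (auto simp: prod_mset_zero_iff)
  moreover have "a + (- 1 / l) *\<^sub>R v \<in> \<Gamma>" using v a unfolding edge_def by blast
  ultimately show False using pos by fastforce
qed

lemma edge_g:
  assumes v: "v \<in> edge" and a: "a \<in> \<Gamma>"
  shows "g (a + v) = g a"
proof -
  obtain \<Lambda> where L: "\<And>t. g (a + t *\<^sub>R v) = g a * (\<Prod>l\<in>#\<Lambda>. 1 + t * l)" using line_roots[OF a] by blast
  show ?thesis using L[of 1] prod_roots_zero[of \<Lambda> 1] edge_roots_zero[OF v a L] by simp
qed

lemma edgeD: "v \<in> edge \<Longrightarrow> a \<in> \<Gamma> \<Longrightarrow> a + v \<in> \<Gamma>"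
  unfolding edge_def by (metis (mono_tags) mem_Collect_eq scaleR_one)

lemma subspace_edge: "subspace edge"
  unfolding subspace_def
proof (intro conjI ballI allI)
  show "0 \<in> edge" unfolding edge_def by simp
  show "x + y \<in> edge" if "x \<in> edge" "y \<in> edge" for x y
    using that unfolding edge_def by (simp add: scaleR_add_right add.assoc[symmetric])
  show "c *\<^sub>R x \<in> edge" if "x \<in> edge" for c x
    using that unfolding edge_def by simp
qed

lemma cone_disjoint_edge: "b \<in> \<Gamma> \<Longrightarrow> b \<notin> edge"
proof
  assume b: "b \<in> \<Gamma>" "b \<in> edge"
  then have "b + (-1) *\<^sub>R b \<in> \<Gamma>" unfolding edge_def by blast
  then show False using pos[of 0] g_0 by simp
qed

lemma dlog_has_derivative:
  assumes "x \<in> \<Gamma>"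
  shows "((\<lambda>z. ln (g z)) has_derivative blinfun_apply (dlog g x)) (at x)"
proof -
  have "g differentiable (at x)" using differentiable_at_real_polynomial_function[OF poly] .
  then obtain g' where "(g has_derivative g') (at x)" unfolding differentiable_def by blast
  from has_derivative_ln[OF pos[OF assms] this]
  have "(\<lambda>z. ln (g z)) differentiable (at x)" unfolding differentiable_def by blast
  then have *: "((\<lambda>z. ln (g z)) has_derivative frechet_derivative (\<lambda>z. ln (g z)) (at x)) (at x)"
    by (simp add: frechet_derivative_works)
  then show ?thesis unfolding dlog_def
    by (simp add: bounded_linear_Blinfun_apply has_derivative_bounded_linear)
qed

lemma dlog_eqI:
  assumes "x \<in> \<Gamma>" "((\<lambda>t. g (x + t *\<^sub>R v)) has_real_derivative g x * m) (at 0)"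
  shows "blinfun_apply (dlog g x) v = m"
proof -
  have "((\<lambda>t. x + t *\<^sub>R v) has_derivative (\<lambda>t. t *\<^sub>R v)) (at 0)"
    by (auto intro!: derivative_eq_intros)
  then have "((\<lambda>t. ln (g (x + t *\<^sub>R v))) has_derivative (\<lambda>t. blinfun_apply (dlog g x) (t *\<^sub>R v))) (at 0)"
    using has_derivative_compose[of "\<lambda>t. x + t *\<^sub>R v" "\<lambda>t. t *\<^sub>R v" 0 UNIV "\<lambda>z. ln (g z)" "blinfun_apply (dlog g x)"] dlog_has_derivative[OF assms(1)]
    by simp
  then have "((\<lambda>t. ln (g (x + t *\<^sub>R v))) has_real_derivative blinfun_apply (dlog g x) v) (at 0)"
    by (rule has_derivative_imp_has_field_derivative) (simp add: blinfun.scaleR_right mult.commute)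
  moreover have "((\<lambda>t. ln (g (x + t *\<^sub>R v))) has_real_derivative m) (at 0)"
    using assms(2) pos[OF assms(1)] by (auto intro!: derivative_eq_intros)
  ultimately show ?thesis by (rule DERIV_unique)
qed

lemma dlog_eq_sum_roots:
  assumes "x \<in> \<Gamma>" "\<And>t. g (x + t *\<^sub>R v) = g x * (\<Prod>l\<in>#\<Lambda>. 1 + t * l)"
  shows "blinfun_apply (dlog g x) v = \<Sum>\<^sub># \<Lambda>"
proof (rule dlog_eqI[OF assms(1)])
  show "((\<lambda>t. g (x + t *\<^sub>R v)) has_real_derivative g x * \<Sum>\<^sub># \<Lambda>) (at 0)"
    unfolding assms(2) by (rule DERIV_cmult[OF has_derivative_prod_mset_at_0])
qed

lemma dlog_self: "x \<in> \<Gamma> \<Longrightarrow> blinfun_apply (dlog g x) x = real N"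
proof -
  assume x: "x \<in> \<Gamma>"
  have "g (x + t *\<^sub>R x) = g x * (\<Prod>l\<in>#replicate_mset N 1. 1 + t * l)" for t
    using homogeneous[of "1 + t" x] by (simp add: scaleR_add_left)
  from dlog_eq_sum_roots[OF x this] show ?thesis by (simp add: sum_mset_replicate_mset)
qed

lemma dlog_edge: "x \<in> \<Gamma> \<Longrightarrow> v \<in> edge \<Longrightarrow> blinfun_apply (dlog g x) v = 0"
proof -
  assume *: "x \<in> \<Gamma>" "v \<in> edge"
  obtain \<Lambda> where L: "\<And>t. g (x + t *\<^sub>R v) = g x * (\<Prod>l\<in>#\<Lambda>. 1 + t * l)" using line_roots[OF *(1)] by blast
  have "\<Sum>\<^sub># \<Lambda> = 0" using edge_roots_zero[OF *(2,1) L] by (simp add: sum_mset.neutral)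
  then show ?thesis using dlog_eq_sum_roots[OF *(1) L] by simp
qed

text \<open>
  With \<open>g z = g x * \<Prod>(1 + l)\<close> this is \<open>ln (1 + l) \<le> l\<close> summed over the roots. Convexity of the cone makes all factors
  positive, and equality forces every \<open>l\<close> to vanish.
\<close>

lemma dlog_tangent:
  assumes x: "x \<in> \<Gamma>" and z: "z \<in> \<Gamma>"
  shows "ln (g z) \<le> ln (g x) + blinfun_apply (dlog g x) (z - x)"
    and "ln (g z) = ln (g x) + blinfun_apply (dlog g x) (z - x) \<Longrightarrow> z - x \<in> edge"
proof -
  obtain \<Lambda> where L: "\<And>t. g (x + t *\<^sub>R (z - x)) = g x * (\<Prod>l\<in>#\<Lambda>. 1 + t * l)" using line_roots[OF x] by blast
  have l: "1 + l > 0" if "l \<in># \<Lambda>" for l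
  proof (rule ccontr)
    assume "\<not> 1 + l > 0"
    then have l: "l \<le> -1" by simp
    have "x + (- 1 / l) *\<^sub>R (z - x) = (1 + 1 / l) *\<^sub>R x + (- 1 / l) *\<^sub>R z" by (simp add: algebra_simps)
    also have "\<dots> \<in> \<Gamma>" using x z l by (intro convexD[OF convex_cone]) (auto simp: field_simps)
    finally have "g (x + (- 1 / l) *\<^sub>R (z - x)) > 0" by (rule pos)
    moreover have "g (x + (- 1 / l) *\<^sub>R (z - x)) = 0" unfolding L using l that by (auto simp: prod_mset_zero_iff)
    ultimately show False by simp
  qed
  have gz: "g z = g x * (\<Prod>l\<in>#\<Lambda>. 1 + l)" using L[of 1] by simp
  have ln: "ln (g z) = ln (g x) + ln (\<Prod>l\<in>#\<Lambda>. 1 + l)"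
    unfolding gz using pos[OF x] ln_prod_mset_le_sum(1)[of \<Lambda>] l by (simp add: ln_mult_pos)
  have d: "blinfun_apply (dlog g x) (z - x) = \<Sum>\<^sub># \<Lambda>" by (rule dlog_eq_sum_roots[OF x L])
  show "ln (g z) \<le> ln (g x) + blinfun_apply (dlog g x) (z - x)"
    unfolding ln d using ln_prod_mset_le_sum(2)[of \<Lambda>] l by simp
  assume "ln (g z) = ln (g x) + blinfun_apply (dlog g x) (z - x)"
  then have "ln (\<Prod>l\<in>#\<Lambda>. 1 + l) = \<Sum>\<^sub># \<Lambda>" unfolding ln d by simp
  then have "l = 0" if "l \<in># \<Lambda>" for l using ln_prod_mset_le_sum(3)[of \<Lambda>] l that by blast
  then have "g (x + t *\<^sub>R (z - x)) = g x" for t unfolding L using prod_roots_zero[of \<Lambda> t] by simp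
  then show "z - x \<in> edge" by (rule edgeI[OF x])
qed

lemma closure_roots_nonneg:
  assumes x: "x \<in> \<Gamma>" and b: "b \<in> closure \<Gamma>" and L: "\<And>t. g (x + t *\<^sub>R b) = g x * (\<Prod>l\<in>#\<Lambda>. 1 + t * l)"
    and l: "l \<in># \<Lambda>"
  shows "l \<ge> 0"
proof (rule ccontr)
  assume neg: "\<not> l \<ge> 0"
  then have "x + (- 1 / l) *\<^sub>R b \<in> \<Gamma>" using x b by (intro add_closure_mem scale_closure_mem) (auto simp: field_simps)
  then have "g (x + (- 1 / l) *\<^sub>R b) > 0" by (rule pos)
  moreover have "g (x + (- 1 / l) *\<^sub>R b) = 0" unfolding L using l neg by (auto simp: prod_mset_zero_iff)
  ultimately show False by simp
qed

text \<open>
  The derivative is the sum of the \<open>l\<close>, which are nonnegative for a direction in the closed cone; a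
  vanishing sum would put the direction into the edge.
\<close>

lemma dlog_nonneg:
  assumes x: "x \<in> \<Gamma>" and b: "b \<in> closure \<Gamma>"
  shows "blinfun_apply (dlog g x) b \<ge> 0" "b \<notin> edge \<Longrightarrow> blinfun_apply (dlog g x) b > 0"
proof -
  obtain \<Lambda> where L: "\<And>t. g (x + t *\<^sub>R b) = g x * (\<Prod>l\<in>#\<Lambda>. 1 + t * l)" using line_roots[OF x] by blast
  note l = closure_roots_nonneg[OF x b L]
  have sum: "\<Sum>\<^sub># A \<ge> 0 \<and> (\<Sum>\<^sub># A = 0 \<longrightarrow> (\<forall>l. l \<in># A \<longrightarrow> l = 0))" if "\<And>l. l \<in># A \<Longrightarrow> l \<ge> 0" for A :: "real multiset"
    using that
  proof (induction A)
    case (add l A)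
    then have "\<Sum>\<^sub># A \<ge> 0 \<and> (\<Sum>\<^sub># A = 0 \<longrightarrow> (\<forall>l. l \<in># A \<longrightarrow> l = 0))" "l \<ge> 0" by auto
    then show ?case by (auto simp: add_nonneg_eq_0_iff)
  qed simp
  note d = dlog_eq_sum_roots[OF x L]
  show ge: "blinfun_apply (dlog g x) b \<ge> 0" unfolding d using sum l by blast
  assume b': "b \<notin> edge"
  show "blinfun_apply (dlog g x) b > 0"
  proof (rule ccontr)
    assume "\<not> ?thesis"
    then have "\<Sum>\<^sub># \<Lambda> = 0" using ge unfolding d by simp
    then have "l = 0" if "l \<in># \<Lambda>" for l using sum[of \<Lambda>] l that by blast
    then have "g (x + t *\<^sub>R b) = g x" for t unfolding L using prod_roots_zero[of \<Lambda> t] by simp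
    then show False using edgeI[OF x] b' by blast
  qed
qed

end

section \<open>The open polar as the image of the logarithmic derivative\<close>

lemma riesz_representation:
  fixes y :: "'a::euclidean_space \<Rightarrow>\<^sub>L real"
  shows "\<exists>r. y = blinfun_inner_right r"
proof (intro exI blinfun_eqI)
  fix x
  have "blinfun_apply y x = blinfun_apply y (\<Sum>i\<in>Basis. (x \<bullet> i) *\<^sub>R i)" by (simp add: euclidean_representation)
  also have "\<dots> = (\<Sum>i\<in>Basis. blinfun_apply y i *\<^sub>R i) \<bullet> x"
    by (simp add: blinfun.sum_right blinfun.scaleR_right inner_sum_left inner_commute[of x] mult.commute)
  finally show "blinfun_apply y x = blinfun_apply (blinfun_inner_right (\<Sum>i\<in>Basis. blinfun_apply y i *\<^sub>R i)) x"
    by simp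
qed

context garding_pair
begin

definition annihilator :: "('a \<Rightarrow>\<^sub>L real) set" where
  "annihilator = {y. \<forall>v\<in>edge. blinfun_apply y v = 0}"

text \<open>
  The orthogonal complement of the edge, a set of representatives modulo the edge. In it the closed cone
  contains no line.
\<close>

definition transversal :: "'a set" where
  "transversal = {w. \<forall>v\<in>edge. w \<bullet> v = 0}"

lemma subspace_annihilator: "subspace annihilator"
  unfolding subspace_def annihilator_def by (auto simp: blinfun.add_left blinfun.scaleR_left)

lemma closed_annihilator: "closed annihilator"
  unfolding annihilator_def Ball_def
  by (intro closed_Collect_all closed_Collect_imp closed_Collect_eq continuous_intros) auto

lemma closed_transversal: "closed transversal"
  unfolding transversal_def Ball_def
  by (intro closed_Collect_all closed_Collect_imp closed_Collect_eq continuous_intros) auto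

lemma transversal_not_edge: "x \<in> transversal \<Longrightarrow> x \<noteq> 0 \<Longrightarrow> x \<notin> edge"
  unfolding transversal_def by auto

lemma transversal_decomposition: "\<exists>w v. w \<in> transversal \<and> v \<in> edge \<and> z = w + v"
proof -
  obtain v w where vw: "v \<in> span edge" "\<And>u. u \<in> span edge \<Longrightarrow> orthogonal w u" "z = v + w"
    using orthogonal_subspace_decomp_exists[of edge z] by metis
  have "w \<in> transversal"
    unfolding transversal_def using vw(2) span_base by (auto simp: orthogonal_def)
  moreover have "v \<in> edge" using vw(1) subspace_edge by (metis span_eq_iff)
  ultimately show ?thesis using vw(3) add.commute by blast
qed

lemma transversal_part_mem: "w + v \<in> \<Gamma> \<Longrightarrow> v \<in> edge \<Longrightarrow> w \<in> \<Gamma>"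
  using edgeD[of "- v" "w + v"] subspace_neg[OF subspace_edge, of v] by simp

lemma polar_subset_annihilator: "polar \<Gamma> \<subseteq> annihilator"
proof
  fix y assume y: "y \<in> polar \<Gamma>"
  obtain x where x: "x \<in> \<Gamma>" using cone_nonempty by blast
  have "blinfun_apply y v = 0" if v: "v \<in> edge" for v
  proof (rule ccontr)
    assume nz: "blinfun_apply y v \<noteq> 0"
    define t where "t = - (blinfun_apply y x + 1) / blinfun_apply y v"
    have "x + t *\<^sub>R v \<in> \<Gamma>" using x v unfolding edge_def by blast
    then have "blinfun_apply y (x + t *\<^sub>R v) \<ge> 0" using y unfolding polar_def by blast
    moreover have "blinfun_apply y (x + t *\<^sub>R v) = -1"
      using nz unfolding t_def by (simp add: blinfun.add_right blinfun.scaleR_right)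
    ultimately show False by simp
  qed
  then show "y \<in> annihilator" unfolding annihilator_def by blast
qed

lemma polar_closure_nonneg:
  assumes "y \<in> polar \<Gamma>" "x \<in> closure \<Gamma>"
  shows "blinfun_apply y x \<ge> 0"
proof -
  have "closed {x. 0 \<le> blinfun_apply y x}" by (intro closed_Collect_le continuous_intros)
  moreover have "\<Gamma> \<subseteq> {x. 0 \<le> blinfun_apply y x}" using assms(1) unfolding polar_def by blast
  ultimately show ?thesis using closure_minimal assms(2) by blast
qed

lemma dlog_mem_polar: "x \<in> \<Gamma> \<Longrightarrow> dlog g x \<in> polar \<Gamma>"
  unfolding polar_def using dlog_nonneg(1) closure_subset by blast

text \<open>
  The tangent inequality from \<open>x\<close> to \<open>x + t q\<close> and the one back give equality in both.
\<close>

lemma edge_if_dlog_zero: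
  assumes q: "\<And>x. x \<in> \<Gamma> \<Longrightarrow> blinfun_apply (dlog g x) q = 0"
  shows "q \<in> edge"
proof -
  obtain x where x: "x \<in> \<Gamma>" using cone_nonempty by blast
  obtain \<epsilon> where \<epsilon>: "\<epsilon> > 0" "ball x \<epsilon> \<subseteq> \<Gamma>" using open_cone x open_contains_ball by blast
  define t where "t = \<epsilon> / (1 + norm q)"
  have t: "t > 0" unfolding t_def using \<epsilon>(1) by (simp add: add_pos_nonneg)
  have "norm (t *\<^sub>R q) < \<epsilon>" unfolding t_def using \<epsilon>(1) by (simp add: field_simps add_pos_nonneg)
  then have xt: "x + t *\<^sub>R q \<in> \<Gamma>" using \<epsilon>(2) by (auto simp: subset_eq dist_norm)
  have "ln (g x) \<le> ln (g (x + t *\<^sub>R q))"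
    using dlog_tangent(1)[OF xt x] q[OF xt] by (simp add: blinfun.minus_right blinfun.scaleR_right)
  moreover have "ln (g (x + t *\<^sub>R q)) \<le> ln (g x)"
    using dlog_tangent(1)[OF x xt] q[OF x] by (simp add: blinfun.scaleR_right)
  ultimately have "t *\<^sub>R q \<in> edge"
    using dlog_tangent(2)[OF x xt] q[OF x] by (simp add: blinfun.scaleR_right)
  then show ?thesis using subspace_scale[OF subspace_edge, of "t *\<^sub>R q" "1 / t"] t by simp
qed

text \<open>
  The values of \<open>dlog g\<close> lie in the polar, and by \<open>edge_if_dlog_zero\<close> only edge vectors are orthogonal to all of
  them; so these values alone span the annihilator.
\<close>

lemma span_polar: "span (polar \<Gamma>) = annihilator"
proof
  show "span (polar \<Gamma>) \<subseteq> annihilator"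
    using polar_subset_annihilator subspace_annihilator by (rule span_minimal)
  show "annihilator \<subseteq> span (polar \<Gamma>)"
  proof
    fix y assume y: "y \<in> annihilator"
    define R where "R = {r. blinfun_inner_right r \<in> span (polar \<Gamma>)}"
    have lin: "linear (blinfun_inner_right :: 'a \<Rightarrow> _)"
      using bounded_linear_blinfun_inner_right bounded_linear.linear by blast
    have "subspace R"
      unfolding R_def using linear_subspace_vimage[OF lin subspace_span] by (simp add: vimage_def)
    obtain r where r: "y = blinfun_inner_right r" using riesz_representation by blast
    obtain p q where pq: "p \<in> span R" "\<And>u. u \<in> span R \<Longrightarrow> orthogonal q u" "r = p + q"
      using orthogonal_subspace_decomp_exists[of R r] by metis
    have "blinfun_apply (dlog g x) q = 0" if x: "x \<in> \<Gamma>" for x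
    proof -
      obtain s where s: "dlog g x = blinfun_inner_right s" using riesz_representation by blast
      have "s \<in> R" unfolding R_def using dlog_mem_polar[OF x] s span_base by auto
      then have "q \<bullet> s = 0" using pq(2) span_base by (auto simp: orthogonal_def)
      then show ?thesis unfolding s by (simp add: inner_commute)
    qed
    then have "q \<in> edge" by (rule edge_if_dlog_zero)
    then have "r \<bullet> q = 0" using y unfolding annihilator_def r by simp
    moreover have "p \<bullet> q = 0" using pq(1,2) by (simp add: orthogonal_def inner_commute)
    ultimately have "q = 0" unfolding pq(3) by (simp add: inner_add_left)
    then have "r \<in> R" using pq(1,3) \<open>subspace R\<close> by (metis add.right_neutral span_eq_iff)
    then show "y \<in> span (polar \<Gamma>)" unfolding R_def r by simp
  qed
qed

lemma openin_open_polar: "openin (top_of_set annihilator) (open_polar \<Gamma>)"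
  unfolding open_polar_def span_polar by (rule openin_interior_of)

lemma open_polar_subset_annihilator: "open_polar \<Gamma> \<subseteq> annihilator"
  using openin_open_polar openin_imp_subset by blast

lemma open_polar_subset_polar: "open_polar \<Gamma> \<subseteq> polar \<Gamma>"
  unfolding open_polar_def by (rule interior_of_subset)

text \<open>
  Room for the perturbation \<open>y - (\<delta> / 2) x / norm x\<close> inside the polar, tested on \<open>x\<close> itself.
\<close>

lemma open_polar_coercive:
  assumes "y \<in> open_polar \<Gamma>"
  shows "\<exists>\<epsilon>>0. \<forall>x\<in>closure \<Gamma> \<inter> transversal. blinfun_apply y x \<ge> \<epsilon> * norm x"
proof -
  obtain \<delta> where \<delta>: "\<delta> > 0" "ball y \<delta> \<inter> annihilator \<subseteq> open_polar \<Gamma>"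
    using openin_open_polar assms unfolding openin_contains_ball by blast
  have "blinfun_apply y x \<ge> (\<delta> / 2) * norm x" if x: "x \<in> closure \<Gamma>" "x \<in> transversal" for x
  proof (cases "x = 0")
    case False
    define y' where "y' = y - (\<delta> / 2 / norm x) *\<^sub>R blinfun_inner_right x"
    have "norm (blinfun_inner_right x) \<le> norm x"
      by (rule norm_blinfun_bound) (auto simp: Cauchy_Schwarz_ineq2)
    then have "(\<delta> / 2 / norm x) * norm (blinfun_inner_right x) \<le> (\<delta> / 2 / norm x) * norm x"
      using \<delta>(1) by (intro mult_left_mono) auto
    then have "dist y y' < \<delta>" unfolding y'_def using \<delta>(1) False by (simp add: dist_norm)
    moreover have "blinfun_inner_right x \<in> annihilator"
      using x(2) unfolding annihilator_def transversal_def by simp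
    then have "y' \<in> annihilator" unfolding y'_def using assms open_polar_subset_annihilator
      by (intro subspace_diff[OF subspace_annihilator] subspace_scale[OF subspace_annihilator]) auto
    ultimately have "y' \<in> polar \<Gamma>" using \<delta>(2) open_polar_subset_polar by auto
    then have "blinfun_apply y' x \<ge> 0" using x(1) by (rule polar_closure_nonneg)
    moreover have "blinfun_apply y' x = blinfun_apply y x - \<delta> / 2 * norm x"
      unfolding y'_def using False by (simp add: blinfun.diff_left blinfun.scaleR_left dot_square_norm power2_eq_square)
    ultimately show ?thesis by simp
  qed simp
  then show ?thesis using \<delta>(1) by (intro exI[of _ "\<delta> / 2"]) auto
qed

text \<open>
  By compactness of the unit vectors in the closed cone orthogonal to the edge, strict positivity is
  uniform, hence stable under small changes of \<open>y\<close> in the annihilator. Edge components do not contribute.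
\<close>

lemma open_polarI:
  assumes y: "y \<in> annihilator" and pos: "\<And>x. x \<in> closure \<Gamma> \<Longrightarrow> x \<in> transversal \<Longrightarrow> x \<noteq> 0 \<Longrightarrow> blinfun_apply y x > 0"
  shows "y \<in> open_polar \<Gamma>"
proof -
  define K where "K = closure \<Gamma> \<inter> transversal \<inter> sphere 0 1"
  have "compact K" unfolding K_def
    by (intro closed_Int_compact closed_Int closed_transversal) auto
  have "\<exists>\<epsilon>>0. \<forall>x\<in>K. blinfun_apply y x \<ge> \<epsilon>"
  proof (cases "K = {}")
    case False
    obtain k where k: "k \<in> K" "\<And>x. x \<in> K \<Longrightarrow> blinfun_apply y k \<le> blinfun_apply y x"
      using continuous_attains_inf[OF \<open>compact K\<close> False linear_continuous_on[OF blinfun.bounded_linear_right, of K y]] by blast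
    have "blinfun_apply y k > 0" using k(1) unfolding K_def by (intro pos) auto
    then show ?thesis using k(2) by blast
  qed (auto intro: exI[of _ 1])
  then obtain \<epsilon> where \<epsilon>: "\<epsilon> > 0" "\<And>x. x \<in> K \<Longrightarrow> blinfun_apply y x \<ge> \<epsilon>" by blast
  have "ball y \<epsilon> \<inter> annihilator \<subseteq> polar \<Gamma>"
  proof
    fix y' assume y': "y' \<in> ball y \<epsilon> \<inter> annihilator"
    have "blinfun_apply y' z \<ge> 0" if z: "z \<in> \<Gamma>" for z
    proof -
      obtain w v where wv: "w \<in> transversal" "v \<in> edge" "z = w + v" using transversal_decomposition by blast
      have w: "w \<in> \<Gamma>" using transversal_part_mem z wv by blast
      then have w0: "norm w > 0" using cone_disjoint_edge subspace_0[OF subspace_edge] by auto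
      have "(1 / norm w) *\<^sub>R w \<in> K"
        unfolding K_def using w wv(1) w0 scale_mem[of w "1 / norm w"] closure_subset
        by (auto simp: transversal_def)
      then have "blinfun_apply y ((1 / norm w) *\<^sub>R w) \<ge> \<epsilon>" by (rule \<epsilon>(2))
      then have "blinfun_apply y w \<ge> \<epsilon> * norm w" using w0 by (simp add: blinfun.scaleR_right field_simps)
      moreover have "\<bar>blinfun_apply (y' - y) w\<bar> \<le> norm (y' - y) * norm w" using norm_blinfun[of "y' - y" w] by simp
      moreover have "norm (y' - y) * norm w \<le> \<epsilon> * norm w"
        using y' w0 by (intro mult_right_mono) (auto simp: dist_norm norm_minus_commute)
      ultimately have "blinfun_apply y' w \<ge> 0" by (simp add: blinfun.diff_left)
      moreover have "blinfun_apply y' v = 0" using y' wv(2) unfolding annihilator_def by blast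
      ultimately show ?thesis unfolding wv(3) by (simp add: blinfun.add_right)
    qed
    then show "y' \<in> polar \<Gamma>" unfolding polar_def by blast
  qed
  moreover have "openin (top_of_set annihilator) (ball y \<epsilon> \<inter> annihilator)"
    by (metis Int_commute open_ball openin_open_Int)
  ultimately show ?thesis
    unfolding open_polar_def span_polar interior_of_def using y \<epsilon>(1) by fastforce
qed

lemma open_polar_iff:
  "y \<in> open_polar \<Gamma> \<longleftrightarrow> y \<in> annihilator \<and> (\<forall>x\<in>closure \<Gamma> \<inter> transversal. x \<noteq> 0 \<longrightarrow> blinfun_apply y x > 0)"
proof
  assume y: "y \<in> open_polar \<Gamma>"
  then obtain \<epsilon> where \<epsilon>: "\<epsilon> > 0" "\<And>x. x \<in> closure \<Gamma> \<inter> transversal \<Longrightarrow> blinfun_apply y x \<ge> \<epsilon> * norm x"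
    using open_polar_coercive by blast
  have "blinfun_apply y x > 0" if "x \<in> closure \<Gamma> \<inter> transversal" "x \<noteq> 0" for x
    using \<epsilon>(2)[OF that(1)] \<epsilon>(1) that(2) by (smt (verit) mult_pos_pos zero_less_norm_iff)
  then show "y \<in> annihilator \<and> (\<forall>x\<in>closure \<Gamma> \<inter> transversal. x \<noteq> 0 \<longrightarrow> blinfun_apply y x > 0)"
    using y open_polar_subset_annihilator by blast
qed (auto intro: open_polarI)

lemma open_polar_add: "y \<in> open_polar \<Gamma> \<Longrightarrow> z \<in> open_polar \<Gamma> \<Longrightarrow> y + z \<in> open_polar \<Gamma>"
  unfolding open_polar_iff using subspace_add[OF subspace_annihilator] by (auto simp: blinfun.add_left add_pos_pos)

lemma open_polar_scale: "y \<in> open_polar \<Gamma> \<Longrightarrow> t > 0 \<Longrightarrow> t *\<^sub>R y \<in> open_polar \<Gamma>"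
  unfolding open_polar_iff using subspace_scale[OF subspace_annihilator] by (auto simp: blinfun.scaleR_left)

lemma convex_open_polar: "convex (open_polar \<Gamma>)"
proof (rule convexI)
  fix y z and u v :: real
  assume *: "y \<in> open_polar \<Gamma>" "z \<in> open_polar \<Gamma>" "0 \<le> u" "0 \<le> v" "u + v = 1"
  show "u *\<^sub>R y + v *\<^sub>R z \<in> open_polar \<Gamma>"
  proof (cases "u = 0 \<or> v = 0")
    case False
    then show ?thesis using * by (intro open_polar_add open_polar_scale) auto
  qed (use * in auto)
qed

lemma growth_bound: "\<exists>M>0. \<forall>x. g x \<le> M * norm x ^ N"
proof -
  have "compact (g ` sphere 0 1)" 
    using continuous_g[of UNIV "\<lambda>x. x"] by (intro compact_continuous_image) (auto intro: continuous_on_subset)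
  then obtain M where M: "\<And>x. x \<in> sphere 0 1 \<Longrightarrow> norm (g x) \<le> M" "M > 0"
    using compact_imp_bounded bounded_pos by (metis imageI)
  have "g x \<le> M * norm x ^ N" for x
  proof (cases "x = 0")
    case False
    have "g x = norm x ^ N * g ((1 / norm x) *\<^sub>R x)"
      using homogeneous[of "norm x" "(1 / norm x) *\<^sub>R x"] False by simp
    moreover have "g ((1 / norm x) *\<^sub>R x) \<le> M" using M(1)[of "(1 / norm x) *\<^sub>R x"] False by auto
    ultimately show ?thesis using mult_left_mono[of "g ((1 / norm x) *\<^sub>R x)" M "norm x ^ N"] by (simp add: mult.commute)
  qed (use g_0 M(2) in auto)
  then show ?thesis using M(2) by blast
qed

text \<open>
  \<open>g x * exp (- y x)\<close> has a maximum over the closed cone modulo the edge: it vanishes on the boundary and tends to \<open>0\<close> at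
  infinity, as \<open>y\<close> grows linearly and \<open>g\<close> polynomially. At the maximum the derivative of \<open>ln g - y\<close> is zero.
\<close>

lemma dlog_surj:
  assumes y: "y \<in> open_polar \<Gamma>"
  shows "\<exists>x\<in>\<Gamma>. dlog g x = y"
proof -
  obtain \<epsilon> where \<epsilon>: "\<epsilon> > 0" "\<And>x. x \<in> closure \<Gamma> \<inter> transversal \<Longrightarrow> blinfun_apply y x \<ge> \<epsilon> * norm x"
    using open_polar_coercive[OF y] by blast
  obtain M where M: "M > 0" "\<And>x. g x \<le> M * norm x ^ N" using growth_bound by blast
  define \<psi> where "\<psi> x = g x * exp (- blinfun_apply y x)" for x
  obtain z0 where "z0 \<in> \<Gamma>" using cone_nonempty by blast
  then obtain w0 where w0: "w0 \<in> \<Gamma>" "w0 \<in> transversal"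
    using transversal_decomposition[of z0] transversal_part_mem by blast
  have \<psi>w0: "\<psi> w0 > 0" unfolding \<psi>_def using pos[OF w0(1)] by simp
  have "((\<lambda>r. M / \<epsilon> ^ N * ((\<epsilon> * r) ^ N / exp (\<epsilon> * r))) \<longlongrightarrow> M / \<epsilon> ^ N * 0) at_top"
    by (intro tendsto_intros filterlim_compose[OF tendsto_power_div_exp_0] filterlim_tendsto_pos_mult_at_top[of _ \<epsilon>] filterlim_ident \<epsilon>(1))
  then have "\<forall>\<^sub>F r in at_top. M / \<epsilon> ^ N * ((\<epsilon> * r) ^ N / exp (\<epsilon> * r)) < \<psi> w0"
    using \<psi>w0 by (simp add: order_tendstoD(2))
  then obtain R0 where R0: "\<And>r. r \<ge> R0 \<Longrightarrow> M / \<epsilon> ^ N * ((\<epsilon> * r) ^ N / exp (\<epsilon> * r)) < \<psi> w0"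
    unfolding eventually_at_top_linorder by blast
  define R where "R = max R0 (norm w0)"
  have far: "\<psi> x < \<psi> w0" if x: "x \<in> closure \<Gamma> \<inter> transversal" "norm x \<ge> R" for x
  proof -
    have "\<psi> x \<le> (M * norm x ^ N) * exp (- blinfun_apply y x)" unfolding \<psi>_def using M(2) by (intro mult_right_mono) auto
    also have "\<dots> \<le> (M * norm x ^ N) * exp (- (\<epsilon> * norm x))" using \<epsilon>(2)[OF x(1)] M(1) by (intro mult_left_mono) auto
    also have "\<dots> = M / \<epsilon> ^ N * ((\<epsilon> * norm x) ^ N / exp (\<epsilon> * norm x))"
      using \<epsilon>(1) by (simp add: exp_minus power_mult_distrib field_simps)
    also have "\<dots> < \<psi> w0" using R0[of "norm x"] x(2) unfolding R_def by simp
    finally show ?thesis .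
  qed
  define K where "K = closure \<Gamma> \<inter> transversal \<inter> cball 0 R"
  have "compact K" unfolding K_def
    by (intro closed_Int_compact closed_Int closed_transversal) auto
  moreover have w0K: "w0 \<in> K" unfolding K_def R_def using w0 closure_subset by auto
  moreover have "continuous_on K \<psi>" unfolding \<psi>_def by (intro continuous_intros continuous_g)
  ultimately obtain x0 where x0: "x0 \<in> K" "\<And>x. x \<in> K \<Longrightarrow> \<psi> x \<le> \<psi> x0"
    using continuous_attains_sup[of K \<psi>] by blast
  have "\<psi> x0 > 0" using x0(2)[OF w0K] \<psi>w0 by simp
  then have gx0: "g x0 > 0" unfolding \<psi>_def by (simp add: zero_less_mult_iff)
  have x0\<Gamma>: "x0 \<in> \<Gamma>" using pos_closure_mem gx0 x0(1) unfolding K_def by blast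
  have "\<psi> z \<le> \<psi> x0" if z: "z \<in> \<Gamma>" for z
  proof -
    obtain w v where wv: "w \<in> transversal" "v \<in> edge" "z = w + v" using transversal_decomposition by blast
    have w: "w \<in> \<Gamma>" using transversal_part_mem z wv by blast
    have "blinfun_apply y v = 0" using y open_polar_subset_annihilator wv(2) unfolding annihilator_def by blast
    then have "\<psi> z = \<psi> w" unfolding \<psi>_def wv(3) using edge_g[OF wv(2) w] by (simp add: blinfun.add_right)
    moreover have "\<psi> w \<le> \<psi> x0"
    proof (cases "norm w \<le> R")
      case True
      then show ?thesis using x0(2) w wv(1) closure_subset unfolding K_def by auto
    next
      case False
      then have "\<psi> w < \<psi> w0" using far[of w] w wv(1) closure_subset by auto
      then show ?thesis using x0(2)[OF w0K] by simp
    qed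
    ultimately show ?thesis by simp
  qed
  then have max: "ln (g z) - blinfun_apply y z \<le> ln (g x0) - blinfun_apply y x0" if "z \<in> \<Gamma>" for z
  proof -
    have "ln (\<psi> z) \<le> ln (\<psi> x0)" using \<open>\<And>z. z \<in> \<Gamma> \<Longrightarrow> \<psi> z \<le> \<psi> x0\<close>[OF that] pos[OF that] gx0 unfolding \<psi>_def by simp
    then show ?thesis unfolding \<psi>_def using pos[OF that] gx0 by (simp add: ln_mult_pos)
  qed
  have "((\<lambda>z. ln (g z) - blinfun_apply y z) has_derivative (\<lambda>v. blinfun_apply (dlog g x0) v - blinfun_apply y v)) (at x0)"
    by (intro derivative_intros dlog_has_derivative x0\<Gamma> bounded_linear_imp_has_derivative blinfun.bounded_linear_right)
  then have "(\<lambda>v. blinfun_apply (dlog g x0) v - blinfun_apply y v) = (\<lambda>v. 0)"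
    using differential_zero_maxmin[OF x0\<Gamma> open_cone] max by blast
  then have "dlog g x0 = y" by (intro blinfun_eqI) (metis eq_iff_diff_eq_0)
  then show ?thesis using x0\<Gamma> by blast
qed

text \<open>
  The tangent inequalities at the two points add up to an equality, so the points differ by an edge vector.
  This makes the dual function well defined.
\<close>

lemma dlog_inj:
  assumes "x \<in> \<Gamma>" "z \<in> \<Gamma>" "dlog g x = dlog g z"
  shows "g x = g z"
proof -
  have "ln (g z) \<le> ln (g x) + blinfun_apply (dlog g x) (z - x)" using dlog_tangent(1)[OF assms(1,2)] .
  moreover have "ln (g x) \<le> ln (g z) - blinfun_apply (dlog g x) (z - x)"
    using dlog_tangent(1)[OF assms(2,1)] unfolding assms(3)[symmetric] by (simp add: blinfun.diff_right)
  ultimately have "z - x \<in> edge" using dlog_tangent(2)[OF assms(1,2)] by simp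
  then show ?thesis using edge_g[of "z - x" x] assms(1) by simp
qed

section \<open>The dual function as a Legendre transform\<close>

lemma dual_dlog: "x \<in> \<Gamma> \<Longrightarrow> dual_garding g \<Gamma> (dlog g x) = 1 / g x"
  unfolding dual_garding_def by (rule the_equality) (blast, metis dlog_inj)

lemma dual_pos: "y \<in> open_polar \<Gamma> \<Longrightarrow> dual_garding g \<Gamma> y > 0"
  using dlog_surj dual_dlog pos by fastforce

lemma ln_dual: "x \<in> \<Gamma> \<Longrightarrow> ln (dual_garding g \<Gamma> (dlog g x)) = blinfun_apply (dlog g x) x - ln (g x) - real N"
  by (simp add: dual_dlog dlog_self ln_div pos)

text \<open>
  The tangent inequality at the point \<open>x\<close> with \<open>F x = y\<close>, rewritten by Euler's identity \<open>F x x = N\<close>.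
\<close>

lemma ln_dual_le:
  assumes "y \<in> open_polar \<Gamma>" "z \<in> \<Gamma>"
  shows "ln (dual_garding g \<Gamma> y) \<le> blinfun_apply y z - ln (g z) - real N"
proof -
  obtain x where x: "x \<in> \<Gamma>" "dlog g x = y" using dlog_surj[OF assms(1)] by blast
  show ?thesis using dlog_tangent(1)[OF x(1) assms(2)] ln_dual[OF x(1)] unfolding x(2)
    by (simp add: blinfun.diff_right)
qed

text \<open>
  In case of equality \<open>ln g - y\<close> is maximal at \<open>z\<close>.
\<close>

lemma ln_dual_eqD:
  assumes "y \<in> open_polar \<Gamma>" "z \<in> \<Gamma>"
    "ln (dual_garding g \<Gamma> y) = blinfun_apply y z - ln (g z) - real N"
  shows "dlog g z = y"
proof -
  have "(\<lambda>v. blinfun_apply (dlog g z) v - blinfun_apply y v) = (\<lambda>v. 0)"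
  proof (rule differential_zero_maxmin[OF assms(2) open_cone])
    show "((\<lambda>z. ln (g z) - blinfun_apply y z) has_derivative (\<lambda>v. blinfun_apply (dlog g z) v - blinfun_apply y v)) (at z)"
      by (intro derivative_intros dlog_has_derivative assms(2) bounded_linear_imp_has_derivative blinfun.bounded_linear_right)
    show "(\<forall>w\<in>\<Gamma>. ln (g w) - blinfun_apply y w \<le> ln (g z) - blinfun_apply y z) \<or>
        (\<forall>w\<in>\<Gamma>. ln (g z) - blinfun_apply y z \<le> ln (g w) - blinfun_apply y w)"
      using ln_dual_le[OF assms(1)] assms(3) by force
  qed
  then show ?thesis by (intro blinfun_eqI) (metis eq_iff_diff_eq_0)
qed

text \<open>
  The minimum in the Legendre formula is over affine functions of \<open>y\<close>. Strictness: a point \<open>x\<close> that attains the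
  minimum for the convex combination attains it for \<open>y\<close> or \<open>z\<close> only if \<open>F x\<close> is equal to that one, and it cannot be equal to both.
\<close>

theorem ln_dual_strictly_concave: "strictly_concave_on (open_polar \<Gamma>) (\<lambda>y. ln (dual_garding g \<Gamma> y))"
  unfolding strictly_concave_on_def strictly_convex_on_def
proof (intro conjI ballI allI impI convex_open_polar, elim conjE)
  fix y z and u v :: real
  assume y: "y \<in> open_polar \<Gamma>" and z: "z \<in> open_polar \<Gamma>" and u: "u > 0" and v: "v > 0"
    and ne: "y \<noteq> z" and uv: "u + v = 1"
  let ?p = "u *\<^sub>R y + v *\<^sub>R z"
  let ?l = "\<lambda>y. ln (dual_garding g \<Gamma> y)"
  have "?p \<in> open_polar \<Gamma>" using convexD[OF convex_open_polar y z _ _ uv] u v by simp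
  then obtain x where x: "x \<in> \<Gamma>" "dlog g x = ?p" using dlog_surj by blast
  have eq: "?l ?p = u * (blinfun_apply y x - ln (g x) - real N) + v * (blinfun_apply z x - ln (g x) - real N)"
  proof -
    have v1: "v = 1 - u" using uv by simp
    show ?thesis using ln_dual[OF x(1)] unfolding x(2) v1
      by (simp add: blinfun.add_left blinfun.scaleR_left blinfun.diff_left algebra_simps)
  qed
  have ly: "?l y \<le> blinfun_apply y x - ln (g x) - real N" and lz: "?l z \<le> blinfun_apply z x - ln (g x) - real N"
    using ln_dual_le y z x(1) by blast+
  have "?l y < blinfun_apply y x - ln (g x) - real N \<or> ?l z < blinfun_apply z x - ln (g x) - real N"
    using ln_dual_eqD[OF y x(1)] ln_dual_eqD[OF z x(1)] ne ly lz by force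
  then have "u * ?l y + v * ?l z < ?l ?p"
    unfolding eq using ly lz u v by (smt (verit) mult_less_cancel_left_pos mult_left_mono)
  then show "- ?l ?p < u * - ?l y + v * - ?l z" by simp
qed

theorem dual_homogeneous:
  assumes y: "y \<in> open_polar \<Gamma>" and t: "t > 0"
  shows "dual_garding g \<Gamma> (t *\<^sub>R y) = t ^ N * dual_garding g \<Gamma> y"
proof -
  obtain x where x: "x \<in> \<Gamma>" "dlog g x = y" using dlog_surj[OF y] by blast
  have tx: "(1 / t) *\<^sub>R x \<in> \<Gamma>" using x(1) t by (intro scale_mem) auto
  have "dlog g ((1 / t) *\<^sub>R x) = t *\<^sub>R y"
  proof (rule blinfun_eqI)
    fix v
    obtain \<Lambda> where L: "\<And>s. g (x + s *\<^sub>R v) = g x * (\<Prod>l\<in>#\<Lambda>. 1 + s * l)" using line_roots[OF x(1)] by blast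
    have "g ((1 / t) *\<^sub>R x + s *\<^sub>R v) = g ((1 / t) *\<^sub>R x) * (\<Prod>l\<in>#image_mset ((*) t) \<Lambda>. 1 + s * l)" for s
    proof -
      have "g ((1 / t) *\<^sub>R x + s *\<^sub>R v) = g ((1 / t) *\<^sub>R (x + (s * t) *\<^sub>R v))"
        using t by (simp add: scaleR_add_right)
      then show ?thesis unfolding homogeneous L by (simp add: image_mset.compositionality o_def mult_ac)
    qed
    from dlog_eq_sum_roots[OF tx this] dlog_eq_sum_roots[OF x(1) L]
    show "blinfun_apply (dlog g ((1 / t) *\<^sub>R x)) v = blinfun_apply (t *\<^sub>R y) v"
      by (simp add: x(2) blinfun.scaleR_left sum_mset_distrib_left[of t "\<lambda>l. l", simplified])
  qed
  then have "dual_garding g \<Gamma> (t *\<^sub>R y) = 1 / g ((1 / t) *\<^sub>R x)" using dual_dlog[OF tx] by simp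
  also have "\<dots> = t ^ N * (1 / g x)" using t by (simp add: homogeneous power_divide)
  finally show ?thesis using dual_dlog[OF x(1)] x(2) by simp
qed

text \<open>
  Test the Legendre formula for \<open>y\<close> at the point \<open>x\<close> with \<open>F x = y + z\<close>; the gain is \<open>z x > 0\<close>.
\<close>

theorem dual_monotone:
  assumes y: "y \<in> open_polar \<Gamma>" and z: "z \<in> open_polar \<Gamma>"
  shows "dual_garding g \<Gamma> (y + z) > dual_garding g \<Gamma> y"
proof -
  note yz = open_polar_add[OF y z]
  obtain x where x: "x \<in> \<Gamma>" "dlog g x = y + z" using dlog_surj[OF yz] by blast
  obtain x' where x': "x' \<in> \<Gamma>" "dlog g x' = z" using dlog_surj[OF z] by blast
  have "blinfun_apply z x > 0"
    using dlog_nonneg(2)[OF x'(1)] x(1) closure_subset cone_disjoint_edge unfolding x'(2) by blast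
  then have "ln (dual_garding g \<Gamma> y) < ln (dual_garding g \<Gamma> (y + z))"
    using ln_dual_le[OF y x(1)] ln_dual[OF x(1)] unfolding x(2) by (simp add: blinfun.add_left)
  then show ?thesis using dual_pos[OF y] dual_pos[OF yz] by simp
qed

section \<open>Boundary behaviour and exhaustion\<close>

definition dual_extension :: "('a \<Rightarrow>\<^sub>L real) \<Rightarrow> real" where
  "dual_extension y = (if y \<in> open_polar \<Gamma> then dual_garding g \<Gamma> y else 0)"

lemma dual_extension_nonneg: "dual_extension y \<ge> 0"
  unfolding dual_extension_def using dual_pos less_imp_le by auto

lemma dual_extension_le:
  assumes "z \<in> \<Gamma>"
  shows "dual_extension y \<le> exp (blinfun_apply y z) / g z"
proof (cases "y \<in> open_polar \<Gamma>")
  case True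
  have "dual_garding g \<Gamma> y = exp (ln (dual_garding g \<Gamma> y))" using dual_pos[OF True] by simp
  also have "\<dots> \<le> exp (blinfun_apply y z - ln (g z))" using ln_dual_le[OF True assms] by simp
  also have "\<dots> = exp (blinfun_apply y z) / g z" using pos[OF assms] by (simp add: exp_diff)
  finally show ?thesis unfolding dual_extension_def using True by simp
qed (use pos[OF assms] in \<open>auto simp: dual_extension_def\<close>)

text \<open>
  Outside the open polar some \<open>x\<close> of the closed cone, not in the edge, has \<open>y x \<le> 0\<close>. Along \<open>a + t x\<close> the
  exponential stays bounded, while \<open>g\<close> grows at least like \<open>1 + t l0\<close> with a root \<open>l0 > 0\<close>.
\<close>

lemma dual_upper_bound_small:
  assumes y: "y \<in> annihilator" "y \<notin> open_polar \<Gamma>" and e: "e > 0"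
  shows "\<exists>z\<in>\<Gamma>. exp (blinfun_apply y z) / g z < e"
proof -
  obtain x where x: "x \<in> closure \<Gamma>" "x \<in> transversal" "x \<noteq> 0" "blinfun_apply y x \<le> 0"
    using y unfolding open_polar_iff by (auto simp: not_less)
  obtain a where a: "a \<in> \<Gamma>" using cone_nonempty by blast
  obtain \<Lambda> where L: "\<And>t. g (a + t *\<^sub>R x) = g a * (\<Prod>l\<in>#\<Lambda>. 1 + t * l)" using line_roots[OF a] by blast
  note l = closure_roots_nonneg[OF a x(1) L]
  have "\<exists>l\<in>#\<Lambda>. l \<noteq> 0"
  proof (rule ccontr)
    assume "\<not> ?thesis"
    then have "g (a + t *\<^sub>R x) = g a" for t unfolding L using prod_roots_zero[of \<Lambda> t] by simp
    then show False using edgeI[OF a] transversal_not_edge[OF x(2,3)] by blast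
  qed
  then obtain l0 where l0: "l0 \<in># \<Lambda>" "l0 > 0" using l by force
  obtain \<Lambda>' where L': "\<Lambda> = add_mset l0 \<Lambda>'" using l0(1) by (meson multi_member_split)
  have big: "(\<Prod>l\<in>#\<Lambda>. 1 + t * l) \<ge> 1 + t * l0" if t: "t \<ge> 0" for t
  proof -
    have "(\<Prod>l\<in>#A. 1 + t * l) \<ge> 1" if "\<And>l. l \<in># A \<Longrightarrow> l \<ge> 0" for A
      using that
    proof (induction A)
      case (add l A)
      then have "1 \<le> 1 + t * l" "1 \<le> (\<Prod>l\<in>#A. 1 + t * l)" using t by auto
      then show ?case using mult_mono[of 1 "1 + t * l" 1 "\<Prod>l\<in>#A. 1 + t * l"] by simp
    qed simp
    then have "(\<Prod>l\<in>#\<Lambda>'. 1 + t * l) \<ge> 1" using l L' by simp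
    then show ?thesis unfolding L' using mult_left_mono[of 1 "\<Prod>l\<in>#\<Lambda>'. 1 + t * l" "1 + t * l0"] t l0(2) by simp
  qed
  define c where "c = exp (blinfun_apply y a) / g a"
  have c: "c > 0" unfolding c_def using pos[OF a] by simp
  \<comment> \<open>Chosen so that \<open>e * (1 + t * l0) = e + c\<close>.\<close>
  define t where "t = c / (e * l0)"
  have t: "t > 0" unfolding t_def using c e l0(2) by simp
  have z: "a + t *\<^sub>R x \<in> \<Gamma>" using add_closure_mem[OF a scale_closure_mem[OF x(1)]] t by simp
  have "exp (blinfun_apply y (a + t *\<^sub>R x)) \<le> exp (blinfun_apply y a)"
    using x(4) t by (simp add: blinfun.add_right blinfun.scaleR_right mult_nonneg_nonpos)
  moreover have "g (a + t *\<^sub>R x) \<ge> g a * (1 + t * l0)" unfolding L using big[of t] t pos[OF a] by simp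
  ultimately have "exp (blinfun_apply y (a + t *\<^sub>R x)) / g (a + t *\<^sub>R x) \<le> exp (blinfun_apply y a) / (g a * (1 + t * l0))"
    using pos[OF a] t l0(2) by (intro frac_le) (auto intro!: mult_pos_pos add_pos_pos)
  also have "\<dots> = c / (1 + t * l0)" unfolding c_def by simp
  also have "\<dots> < e"
  proof -
    have "e * (1 + t * l0) = e + c" unfolding t_def using e l0(2) by (simp add: field_simps)
    then show ?thesis using e t l0(2) by (simp add: pos_divide_less_eq add_pos_pos)
  qed
  finally show ?thesis using z by blast
qed

text \<open>
  At an interior point \<open>y\<close>, a nearby \<open>y'\<close> lies between \<open>(1 - \<eta>) y\<close> and \<open>(1 + \<eta>) y\<close> in the order of the open polar,
  so monotonicity and homogeneity bound its value. Elsewhere the upper bounds \<open>exp (y z) / g z\<close> suffice.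
\<close>

lemma dual_extension_continuous: "continuous_on annihilator dual_extension"
  unfolding continuous_on_iff
proof (intro ballI allI impI)
  fix y and e :: real
  assume y: "y \<in> annihilator" and e: "e > 0"
  show "\<exists>d>0. \<forall>y'\<in>annihilator. dist y' y < d \<longrightarrow> dist (dual_extension y') (dual_extension y) < e"
  proof (cases "y \<in> open_polar \<Gamma>")
    case True
    let ?c = "dual_garding g \<Gamma> y"
    have "((\<lambda>s. (1 + s) ^ N * ?c) \<longlongrightarrow> (1 + 0) ^ N * ?c) (at (0::real))"
      by (intro tendsto_intros)
    then obtain \<eta>0 where \<eta>0: "\<eta>0 > 0" "\<And>s. s \<noteq> 0 \<Longrightarrow> \<bar>s\<bar> < \<eta>0 \<Longrightarrow> \<bar>(1 + s) ^ N * ?c - ?c\<bar> < e"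
      using e unfolding LIM_def by (auto simp: dist_real_def)
    define \<eta> where "\<eta> = min (1 / 2) (\<eta>0 / 2)"
    have \<eta>: "0 < \<eta>" "\<eta> < 1" "\<eta> < \<eta>0" unfolding \<eta>_def using \<eta>0(1) by auto
    have hi: "(1 + \<eta>) ^ N * ?c < ?c + e" using \<eta>0(2)[of \<eta>] \<eta> by (auto simp: abs_if split: if_splits)
    have lo: "(1 - \<eta>) ^ N * ?c > ?c - e" using \<eta>0(2)[of "- \<eta>"] \<eta> by (auto simp: abs_if split: if_splits)
    obtain d where d: "d > 0" "ball (\<eta> *\<^sub>R y) d \<inter> annihilator \<subseteq> open_polar \<Gamma>"
      using openin_open_polar open_polar_scale[OF True \<eta>(1)] unfolding openin_contains_ball by blast
    have "dist (dual_extension y') (dual_extension y) < e" if y': "y' \<in> annihilator" "dist y' y < d" for y'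
    proof -
      have diff: "y' - y \<in> annihilator" using subspace_diff[OF subspace_annihilator y'(1) y] .
      have \<eta>y: "\<eta> *\<^sub>R y \<in> annihilator" using subspace_scale[OF subspace_annihilator y] .
      have up: "\<eta> *\<^sub>R y + (y' - y) \<in> open_polar \<Gamma>"
        using d(2) subspace_add[OF subspace_annihilator \<eta>y diff] y'(2) by (auto simp: dist_norm norm_minus_commute)
      have down: "\<eta> *\<^sub>R y - (y' - y) \<in> open_polar \<Gamma>"
        using d(2) subspace_diff[OF subspace_annihilator \<eta>y diff] y'(2) by (auto simp: dist_norm norm_minus_commute)
      have "(1 - \<eta>) *\<^sub>R y \<in> open_polar \<Gamma>" using open_polar_scale[OF True, of "1 - \<eta>"] \<eta>(2) by simp
      moreover have y'eq: "(1 - \<eta>) *\<^sub>R y + (\<eta> *\<^sub>R y + (y' - y)) = y'" by (simp add: algebra_simps)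
      ultimately have y'p: "y' \<in> open_polar \<Gamma>" and "dual_garding g \<Gamma> ((1 - \<eta>) *\<^sub>R y) < dual_garding g \<Gamma> y'"
        using open_polar_add[OF _ up, of "(1 - \<eta>) *\<^sub>R y"] dual_monotone[OF _ up, of "(1 - \<eta>) *\<^sub>R y"] unfolding y'eq by blast+
      then have "?c - e < dual_garding g \<Gamma> y'"
        using dual_homogeneous[OF True, of "1 - \<eta>"] \<eta>(2) lo by simp
      moreover have "y' + (\<eta> *\<^sub>R y - (y' - y)) = (1 + \<eta>) *\<^sub>R y" by (simp add: algebra_simps)
      then have "dual_garding g \<Gamma> y' < dual_garding g \<Gamma> ((1 + \<eta>) *\<^sub>R y)"
        using dual_monotone[OF y'p down] by simp
      then have "dual_garding g \<Gamma> y' < ?c + e"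
        using dual_homogeneous[OF True, of "1 + \<eta>"] \<eta>(1) hi by simp
      ultimately show ?thesis using True y'p unfolding dual_extension_def by (simp add: dist_real_def abs_less_iff)
    qed
    then show ?thesis using d(1) by blast
  next
    case False
    obtain z where z: "z \<in> \<Gamma>" "exp (blinfun_apply y z) / g z < e"
      using dual_upper_bound_small[OF y False e] by blast
    have "open {y'. exp (blinfun_apply y' z) / g z < e}"
      by (intro open_Collect_less continuous_intros) (use pos[OF z(1)] in auto)
    then obtain d where d: "d > 0" "ball y d \<subseteq> {y'. exp (blinfun_apply y' z) / g z < e}"
      using z(2) open_contains_ball by (metis (no_types, lifting) mem_Collect_eq)
    have "dist (dual_extension y') (dual_extension y) < e" if "dist y' y < d" for y'
    proof -
      have "y' \<in> ball y d" using that by (simp add: dist_commute)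
      then have "exp (blinfun_apply y' z) / g z < e" using d(2) by blast
      then have "dual_extension y' < e" using dual_extension_le[OF z(1), of y'] by simp
      then show ?thesis using False dual_extension_nonneg[of y'] by (simp add: dist_real_def dual_extension_def)
    qed
    then show ?thesis using d(1) by blast
  qed
qed

lemma closure_of_open_polar_subset: "top_of_set annihilator closure_of open_polar \<Gamma> \<subseteq> annihilator"
  using closure_of_subset_topspace by fastforce

lemma frontier_of_open_polar:
  "y \<in> top_of_set annihilator frontier_of open_polar \<Gamma> \<Longrightarrow> y \<notin> open_polar \<Gamma>"
  unfolding frontier_of_def using openin_open_polar by (simp add: interior_of_openin)

theorem psi_strictly_convex:
  "strictly_convex_on (open_polar \<Gamma>) (\<lambda>y. blinfun_apply y x - ln (dual_garding g \<Gamma> y))"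
  unfolding strictly_convex_on_def
proof (intro conjI ballI allI impI convex_open_polar, elim conjE)
  fix y z and u v :: real
  assume *: "y \<in> open_polar \<Gamma>" "z \<in> open_polar \<Gamma>" "u > 0" "v > 0" "y \<noteq> z" "u + v = 1"
  then have "- ln (dual_garding g \<Gamma> (u *\<^sub>R y + v *\<^sub>R z))
      < u * - ln (dual_garding g \<Gamma> y) + v * - ln (dual_garding g \<Gamma> z)"
    using ln_dual_strictly_concave unfolding strictly_concave_on_def strictly_convex_on_def by blast
  then show "blinfun_apply (u *\<^sub>R y + v *\<^sub>R z) x - ln (dual_garding g \<Gamma> (u *\<^sub>R y + v *\<^sub>R z))
      < u * (blinfun_apply y x - ln (dual_garding g \<Gamma> y)) + v * (blinfun_apply z x - ln (dual_garding g \<Gamma> z))"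
    by (simp add: blinfun.add_left blinfun.scaleR_left right_diff_distrib)
qed

text \<open>
  The sublevel set is also the set where the continuous extension is at least \<open>exp (y x - c)\<close>: the extension vanishes
  outside the open polar, hence the set is closed in the whole annihilator. It is bounded because the Legendre inequality
  at \<open>x / 2\<close> bounds \<open>y x\<close>, and on the polar \<open>y x\<close> controls the norm of \<open>y\<close> for \<open>x\<close> in the open cone.
\<close>

theorem psi_exhaustion:
  assumes x: "x \<in> \<Gamma>"
  shows "compact {y \<in> open_polar \<Gamma>. blinfun_apply y x - ln (dual_garding g \<Gamma> y) \<le> c}" (is "compact ?S")
proof -
  have S_eq: "?S = {y \<in> annihilator. exp (blinfun_apply y x - c) \<le> dual_extension y}"
  proof (intro set_eqI iffI)
    fix y assume "y \<in> ?S"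
    then have y: "y \<in> open_polar \<Gamma>" "blinfun_apply y x - ln (dual_garding g \<Gamma> y) \<le> c" by auto
    have "exp (blinfun_apply y x - c) \<le> exp (ln (dual_garding g \<Gamma> y))" using y(2) by simp
    then show "y \<in> {y \<in> annihilator. exp (blinfun_apply y x - c) \<le> dual_extension y}"
      using y(1) dual_pos[OF y(1)] open_polar_subset_annihilator by (auto simp: dual_extension_def)
  next
    fix y assume y: "y \<in> {y \<in> annihilator. exp (blinfun_apply y x - c) \<le> dual_extension y}"
    have p: "y \<in> open_polar \<Gamma>"
    proof (rule ccontr)
      assume "y \<notin> open_polar \<Gamma>"
      then have "exp (blinfun_apply y x - c) \<le> 0" using y by (simp add: dual_extension_def)
      then show False by (simp add: not_le)
    qed
    then have "blinfun_apply y x - c \<le> ln (dual_garding g \<Gamma> y)"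
      using y dual_pos[OF p] by (simp add: dual_extension_def ln_ge_iff)
    then show "y \<in> ?S" using p by simp
  qed
  have "closed ?S" unfolding S_eq
    by (intro continuous_on_closed_Collect_le closed_annihilator dual_extension_continuous continuous_intros)
  moreover have "bounded ?S"
  proof -
    obtain \<delta> where \<delta>: "\<delta> > 0" "cball x \<delta> \<subseteq> \<Gamma>" using open_cone x open_contains_cball by blast
    have half: "(1 / 2) *\<^sub>R x \<in> \<Gamma>" using scale_mem[OF x] by simp
    define c' where "c' = 2 * (c - ln (g ((1 / 2) *\<^sub>R x)) - real N)"
    have "norm y \<le> c' / \<delta>" if y: "y \<in> open_polar \<Gamma>" "blinfun_apply y x - ln (dual_garding g \<Gamma> y) \<le> c" for y
    proof -
      have yx: "blinfun_apply y x \<le> c'" using ln_dual_le[OF y(1) half] y(2) unfolding c'_def by (simp add: blinfun.scaleR_right)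
      have nonneg: "blinfun_apply y w \<ge> 0" if "w \<in> \<Gamma>" for w using y(1) open_polar_subset_polar that unfolding polar_def by blast
      have "norm (blinfun_apply y u) \<le> c' / \<delta> * norm u" for u
      proof (cases "u = 0")
        case False
        define s where "s = \<delta> / norm u"
        have s: "s > 0" "norm (s *\<^sub>R u) = \<delta>" unfolding s_def using False \<delta>(1) by auto
        have "x + s *\<^sub>R u \<in> \<Gamma>" "x - s *\<^sub>R u \<in> \<Gamma>" using \<delta> s(2) by (auto simp: subset_eq dist_norm)
        then have "s * \<bar>blinfun_apply y u\<bar> \<le> c'" using nonneg yx s(1)
          by (fastforce simp: blinfun.add_right blinfun.diff_right blinfun.scaleR_right abs_if)
        then show ?thesis unfolding s_def using False \<delta>(1) by (simp add: field_simps)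
      qed (simp add: blinfun.zero_right)
      moreover have "c' / \<delta> \<ge> 0" using yx nonneg[OF x] \<delta>(1) by simp
      ultimately show ?thesis by (intro norm_blinfun_bound)
    qed
    then show ?thesis by (auto simp: bounded_iff)
  qed
  ultimately show ?thesis by (simp add: compact_eq_bounded_closed)
qed

end

section \<open>Functions with an absolutely convergent power series\<close>

definition multi_indices :: "'v set \<Rightarrow> ('v \<Rightarrow> nat) set" where
  "multi_indices B = {\<alpha>. \<forall>b. b \<notin> B \<longrightarrow> \<alpha> b = 0}"

definition monomial_at :: "'v set \<Rightarrow> ('v \<Rightarrow> nat) \<Rightarrow> ('v \<Rightarrow> real) \<Rightarrow> real" where
  "monomial_at B \<alpha> s = (\<Prod>b\<in>B. s b ^ \<alpha> b)"

definition polydisc :: "'v set \<Rightarrow> real \<Rightarrow> ('v \<Rightarrow> real) set" where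
  "polydisc B r = {s. \<forall>b\<in>B. \<bar>s b\<bar> < r}"

text \<open>
  \<open>f\<close> is on the polydisc the sum of a power series whose coefficients have weighted \<open>l\<^sup>1\<close> norm at most \<open>M\<close>. Keeping the
  series existential gives the calculus of a Banach algebra norm, with its completeness expressed by
  \<open>majorized_infsum\<close>, directly for functions.
\<close>

definition majorized :: "'v set \<Rightarrow> real \<Rightarrow> real \<Rightarrow> (('v \<Rightarrow> real) \<Rightarrow> real) \<Rightarrow> bool" where
  "majorized B r M f \<longleftrightarrow> (\<exists>c m.
     ((\<lambda>\<alpha>. \<bar>c \<alpha>\<bar> * monomial_at B \<alpha> (\<lambda>_. r)) has_sum m) (multi_indices B) \<and> m \<le> M \<and>
     (\<forall>s\<in>polydisc B r. ((\<lambda>\<alpha>. c \<alpha> * monomial_at B \<alpha> s) has_sum f s) (multi_indices B)))"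

lemma monomial_at_pos: "r > 0 \<Longrightarrow> monomial_at B \<alpha> (\<lambda>_. r) > 0"
  unfolding monomial_at_def by (intro prod_pos) auto

lemma monomial_at_nonneg: "r > 0 \<Longrightarrow> monomial_at B \<alpha> (\<lambda>_. r) \<ge> 0"
  by (rule less_imp_le[OF monomial_at_pos])

lemma abs_monomial_at_le: "s \<in> polydisc B r \<Longrightarrow> \<bar>monomial_at B \<alpha> s\<bar> \<le> monomial_at B \<alpha> (\<lambda>_. r)"
  unfolding monomial_at_def polydisc_def abs_prod
  by (intro prod_mono) (auto simp: power_abs intro!: power_mono intro: less_imp_le)

lemma monomial_at_add: "monomial_at B (\<lambda>b. \<alpha> b + \<beta> b) s = monomial_at B \<alpha> s * monomial_at B \<beta> s"
  unfolding monomial_at_def by (simp add: power_add prod.distrib)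

lemma majorized_mono: "majorized B r M f \<Longrightarrow> M \<le> M' \<Longrightarrow> majorized B r M' f"
  unfolding majorized_def by (meson order_trans)

lemma majorized_cong: "majorized B r M f \<Longrightarrow> (\<And>s. s \<in> polydisc B r \<Longrightarrow> f s = f' s) \<Longrightarrow> majorized B r M f'"
  unfolding majorized_def by simp

lemma majorized_bound:
  assumes "majorized B r M f" "s \<in> polydisc B r"
  shows "\<bar>f s\<bar> \<le> M"
proof -
  obtain c m where c: "((\<lambda>\<alpha>. \<bar>c \<alpha>\<bar> * monomial_at B \<alpha> (\<lambda>_. r)) has_sum m) (multi_indices B)" "m \<le> M"
    "((\<lambda>\<alpha>. c \<alpha> * monomial_at B \<alpha> s) has_sum f s) (multi_indices B)"
    using assms unfolding majorized_def by blast
  have le: "\<bar>c \<alpha> * monomial_at B \<alpha> s\<bar> \<le> \<bar>c \<alpha>\<bar> * monomial_at B \<alpha> (\<lambda>_. r)" for \<alpha>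
    unfolding abs_mult using abs_monomial_at_le[OF assms(2)] by (intro mult_left_mono) auto
  have "f s \<le> m" using le by (intro has_sum_mono[OF c(3,1)]) (meson abs_le_D1)
  moreover have "- f s \<le> m"
    using le by (intro has_sum_mono[OF has_sum_uminusI[OF c(3)] c(1)]) (meson abs_le_D2)
  ultimately show ?thesis using c(2) by simp
qed

text \<open>
  The series may be indexed by any set \<open>J\<close> and repeat monomials; terms with the same exponent are collected.
  Sums, infinite sums and products all reduce to this regrouping, with \<open>J\<close> a product of index sets.
\<close>

lemma majorizedI:
  fixes a :: "'j \<Rightarrow> 'v \<Rightarrow> nat" and c :: "'j \<Rightarrow> real"
  assumes r: "r > 0" and a: "\<And>j. j \<in> J \<Longrightarrow> a j \<in> multi_indices B"
    and m: "((\<lambda>j. \<bar>c j\<bar> * monomial_at B (a j) (\<lambda>_. r)) has_sum m) J" "m \<le> M"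
    and f: "\<And>s. s \<in> polydisc B r \<Longrightarrow> ((\<lambda>j. c j * monomial_at B (a j) s) has_sum f s) J"
  shows "majorized B r M f"
proof -
  let ?w = "\<lambda>\<gamma>. monomial_at B \<gamma> (\<lambda>_. r)"
  define F where "F \<gamma> = {j \<in> J. a j = \<gamma>}" for \<gamma>
  define e where "e \<gamma> = infsum c (F \<gamma>)" for \<gamma>
  define d where "d \<gamma> = (\<Sum>\<^sub>\<infinity>j\<in>F \<gamma>. \<bar>c j\<bar> * ?w \<gamma>)" for \<gamma>
  have img: "snd ` Sigma (multi_indices B) F = J" unfolding F_def using a by force
  have inj: "inj_on snd (Sigma (multi_indices B) F)" unfolding F_def inj_on_def by auto
  have regroup: "((\<lambda>(\<gamma>, j). h j) has_sum S) (Sigma (multi_indices B) F)" if "(h has_sum S) J" for h :: "'j \<Rightarrow> real" and S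
    using has_sum_reindex[OF inj, of h S] that unfolding img by (simp add: o_def case_prod_unfold)
  have abs_c: "(\<lambda>j. \<bar>c j\<bar>) summable_on F \<gamma>" for \<gamma>
  proof -
    have "(\<lambda>j. \<bar>c j\<bar> * monomial_at B (a j) (\<lambda>_. r)) summable_on F \<gamma>"
      using summable_on_subset_banach[OF has_sum_imp_summable[OF m(1)]] unfolding F_def by auto
    moreover have "(\<lambda>j. \<bar>c j\<bar> * monomial_at B (a j) (\<lambda>_. r)) summable_on F \<gamma> \<longleftrightarrow> (\<lambda>j. \<bar>c j\<bar> * ?w \<gamma>) summable_on F \<gamma>"
      by (rule summable_on_cong) (auto simp: F_def)
    ultimately show ?thesis using monomial_at_pos[OF r, of B \<gamma>] summable_on_cmult_left'[of "?w \<gamma>" "\<lambda>j. \<bar>c j\<bar>"] by simp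
  qed
  have sum_d: "((\<lambda>j. \<bar>c j\<bar> * monomial_at B (a j) (\<lambda>_. r)) has_sum d \<gamma>) (F \<gamma>)" for \<gamma>
  proof -
    have "((\<lambda>j. \<bar>c j\<bar> * ?w \<gamma>) has_sum d \<gamma>) (F \<gamma>)"
      unfolding d_def using summable_on_cmult_left[OF abs_c, of "?w \<gamma>"] by (rule has_sum_infsum)
    moreover have "((\<lambda>j. \<bar>c j\<bar> * monomial_at B (a j) (\<lambda>_. r)) has_sum d \<gamma>) (F \<gamma>) \<longleftrightarrow> ((\<lambda>j. \<bar>c j\<bar> * ?w \<gamma>) has_sum d \<gamma>) (F \<gamma>)"
      by (rule has_sum_cong) (auto simp: F_def)
    ultimately show ?thesis by simp
  qed
  have d: "(d has_sum m) (multi_indices B)"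
    by (rule has_sum_SigmaD[OF regroup[OF m(1)]]) (use sum_d in simp)
  have sum_e: "(c has_sum e \<gamma>) (F \<gamma>)" for \<gamma>
    unfolding e_def using abs_c[of \<gamma>] abs_summable_summable[of c] by (intro has_sum_infsum) simp
  have le: "\<bar>e \<gamma>\<bar> * ?w \<gamma> \<le> d \<gamma>" for \<gamma>
  proof -
    have "\<bar>e \<gamma>\<bar> \<le> (\<Sum>\<^sub>\<infinity>j\<in>F \<gamma>. \<bar>c j\<bar>)" unfolding e_def using norm_infsum_bound[of c] abs_c[of \<gamma>] by simp
    then have "\<bar>e \<gamma>\<bar> * ?w \<gamma> \<le> (\<Sum>\<^sub>\<infinity>j\<in>F \<gamma>. \<bar>c j\<bar>) * ?w \<gamma>"
      using monomial_at_pos[OF r, of B \<gamma>] by (intro mult_right_mono) auto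
    also have "\<dots> = d \<gamma>" unfolding d_def using abs_c by (simp add: infsum_cmult_left)
    finally show ?thesis .
  qed
  have summ: "(\<lambda>\<gamma>. \<bar>e \<gamma>\<bar> * ?w \<gamma>) summable_on multi_indices B"
    by (rule summable_on_comparison_test[OF has_sum_imp_summable[OF d] le])
      (simp add: monomial_at_nonneg r)
  have norm_le: "(\<Sum>\<^sub>\<infinity>\<gamma>\<in>multi_indices B. \<bar>e \<gamma>\<bar> * ?w \<gamma>) \<le> m"
    using has_sum_mono[OF has_sum_infsum[OF summ] d] le by blast
  have "((\<lambda>\<gamma>. e \<gamma> * monomial_at B \<gamma> s) has_sum f s) (multi_indices B)" if s: "s \<in> polydisc B r" for s
  proof (rule has_sum_SigmaD[OF regroup[OF f[OF s]]])
    fix \<gamma> :: "'v \<Rightarrow> nat"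
    have "((\<lambda>j. c j * monomial_at B \<gamma> s) has_sum e \<gamma> * monomial_at B \<gamma> s) (F \<gamma>)"
      by (rule has_sum_cmult_left[OF sum_e])
    moreover have "((\<lambda>j. c j * monomial_at B (a j) s) has_sum e \<gamma> * monomial_at B \<gamma> s) (F \<gamma>) \<longleftrightarrow> ((\<lambda>j. c j * monomial_at B \<gamma> s) has_sum e \<gamma> * monomial_at B \<gamma> s) (F \<gamma>)"
      by (rule has_sum_cong) (auto simp: F_def)
    ultimately show "((\<lambda>y. case (\<gamma>, y) of (\<gamma>, j) \<Rightarrow> c j * monomial_at B (a j) s) has_sum e \<gamma> * monomial_at B \<gamma> s) (F \<gamma>)"
      by simp
  qed
  with has_sum_infsum[OF summ] norm_le m(2) show ?thesis
    unfolding majorized_def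
    by (intro exI[of _ e] exI[of _ "\<Sum>\<^sub>\<infinity>\<gamma>\<in>multi_indices B. \<bar>e \<gamma>\<bar> * ?w \<gamma>"] conjI ballI) auto
qed

lemma majorized_const: "r > 0 \<Longrightarrow> \<bar>k\<bar> \<le> M \<Longrightarrow> majorized B r M (\<lambda>_. k)"
  by (rule majorizedI[where J = "{()}" and a = "\<lambda>_ _. 0" and c = "\<lambda>_. k" and m = "\<bar>k\<bar>"])
    (auto simp: multi_indices_def monomial_at_def has_sum_finite_iff)

lemma majorized_coordinate:
  assumes "r > 0" "finite B" "b0 \<in> B"
  shows "majorized B r r (\<lambda>s. s b0)"
proof -
  have "monomial_at B (\<lambda>b. if b = b0 then 1 else 0) s = s b0" for s
  proof -
    have "monomial_at B (\<lambda>b. if b = b0 then 1 else 0) s = (\<Prod>b\<in>B. if b = b0 then s b else 1)"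
      unfolding monomial_at_def by (intro prod.cong) auto
    then show ?thesis using assms by simp
  qed
  then show ?thesis using assms
    by (intro majorizedI[where J = "{()}" and a = "\<lambda>_ b. if b = b0 then 1 else 0" and c = "\<lambda>_. 1" and m = r])
      (auto simp: multi_indices_def has_sum_finite_iff)
qed

text \<open>
  Completeness: a series of functions converges in the algebra if the bounds are summable.
\<close>

lemma majorized_infsum:
  fixes f :: "'k \<Rightarrow> ('v \<Rightarrow> real) \<Rightarrow> real"
  assumes r: "r > 0" and f: "\<And>k. k \<in> K \<Longrightarrow> majorized B r (M k) (f k)" and M: "(M has_sum S) K"
  shows "majorized B r S (\<lambda>s. \<Sum>\<^sub>\<infinity>k\<in>K. f k s)"
    and "s \<in> polydisc B r \<Longrightarrow> (\<lambda>k. f k s) summable_on K"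
proof -
  let ?w = "\<lambda>\<alpha>. monomial_at B \<alpha> (\<lambda>_. r)"
  define Q where "Q k p \<longleftrightarrow> ((\<lambda>\<alpha>. \<bar>fst p \<alpha>\<bar> * ?w \<alpha>) has_sum snd p) (multi_indices B) \<and> snd p \<le> M k \<and>
     (\<forall>s\<in>polydisc B r. ((\<lambda>\<alpha>. fst p \<alpha> * monomial_at B \<alpha> s) has_sum f k s) (multi_indices B))" for k p
  have "\<exists>p. Q k p" if k: "k \<in> K" for k
  proof -
    obtain c m where "((\<lambda>\<alpha>. \<bar>c \<alpha>\<bar> * ?w \<alpha>) has_sum m) (multi_indices B)" "m \<le> M k"
      "\<forall>s\<in>polydisc B r. ((\<lambda>\<alpha>. c \<alpha> * monomial_at B \<alpha> s) has_sum f k s) (multi_indices B)"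
      using f[OF k] unfolding majorized_def by blast
    then have "Q k (c, m)" unfolding Q_def by simp
    then show ?thesis by blast
  qed
  then obtain p where p: "\<And>k. k \<in> K \<Longrightarrow> Q k (p k)" by metis
  define c m where "c k = fst (p k)" and "m k = snd (p k)" for k
  have c: "((\<lambda>\<alpha>. \<bar>c k \<alpha>\<bar> * ?w \<alpha>) has_sum m k) (multi_indices B)" and m: "m k \<le> M k"
    and fk: "\<And>s. s \<in> polydisc B r \<Longrightarrow> ((\<lambda>\<alpha>. c k \<alpha> * monomial_at B \<alpha> s) has_sum f k s) (multi_indices B)"
    if "k \<in> K" for k
    using p[OF that] unfolding Q_def c_def m_def by blast+
  have m0: "m k \<ge> 0" if "k \<in> K" for k
    by (rule has_sum_nonneg[OF c[OF that]]) (simp add: monomial_at_nonneg r)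
  have summ_m: "m summable_on K"
    by (rule summable_on_comparison_test[OF has_sum_imp_summable[OF M] m m0])
  define J where "J = K \<times> multi_indices B"
  have summ: "(\<lambda>j. \<bar>c (fst j) (snd j)\<bar> * ?w (snd j)) summable_on J"
    unfolding J_def using c summ_m
    by (intro summable_on_SigmaI[where g = m]) (simp_all add: monomial_at_nonneg r)
  have tot: "((\<lambda>j. \<bar>c (fst j) (snd j)\<bar> * ?w (snd j)) has_sum infsum m K) J"
    unfolding J_def using c has_sum_infsum[OF summ_m] summ
    by (intro has_sum_SigmaI[where g = m]) (auto simp: J_def)
  have mS: "infsum m K \<le> S" using has_sum_mono[OF has_sum_infsum[OF summ_m] M] m by blast
  have fs: "((\<lambda>j. c (fst j) (snd j) * monomial_at B (snd j) s) has_sum (\<Sum>\<^sub>\<infinity>k\<in>K. f k s)) J \<and> (\<lambda>k. f k s) summable_on K"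
    if s: "s \<in> polydisc B r" for s
  proof -
    have "(\<lambda>j. norm (c (fst j) (snd j) * monomial_at B (snd j) s)) summable_on J"
    proof (rule summable_on_comparison_test[OF summ])
      show "norm (c (fst j) (snd j) * monomial_at B (snd j) s) \<le> \<bar>c (fst j) (snd j)\<bar> * ?w (snd j)" for j
        using abs_monomial_at_le[OF s, of "snd j"] by (simp add: abs_mult mult_left_mono)
    qed simp
    from has_sum_infsum[OF abs_summable_summable[OF this]]
    obtain T where T: "((\<lambda>j. c (fst j) (snd j) * monomial_at B (snd j) s) has_sum T) J" by blast
    have "((\<lambda>k. f k s) has_sum T) K"
      by (rule has_sum_SigmaD[OF T[unfolded J_def]]) (simp add: fk s)
    then have "(\<lambda>k. f k s) summable_on K" "(\<Sum>\<^sub>\<infinity>k\<in>K. f k s) = T"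
      by (auto dest: has_sum_imp_summable intro: infsumI)
    then show ?thesis using T by simp
  qed
  show "majorized B r S (\<lambda>s. \<Sum>\<^sub>\<infinity>k\<in>K. f k s)"
  proof (rule majorizedI[OF r _ tot mS])
    show "snd j \<in> multi_indices B" if "j \<in> J" for j using that unfolding J_def by auto
    show "((\<lambda>j. c (fst j) (snd j) * monomial_at B (snd j) s) has_sum (\<Sum>\<^sub>\<infinity>k\<in>K. f k s)) J"
      if "s \<in> polydisc B r" for s using fs[OF that] by blast
  qed
  show "s \<in> polydisc B r \<Longrightarrow> (\<lambda>k. f k s) summable_on K" using fs by blast
qed

lemma majorized_add:
  assumes "r > 0" "majorized B r M f" "majorized B r M' f'"
  shows "majorized B r (M + M') (\<lambda>s. f s + f' s)"
  using majorized_infsum(1)[of r "UNIV::bool set" B "\<lambda>k. if k then M else M'" "\<lambda>k. if k then f else f'" "M + M'"] assms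
  by (simp add: has_sum_finite_iff UNIV_bool add.commute)

lemma majorized_sum:
  assumes "r > 0" "finite K" "\<And>k. k \<in> K \<Longrightarrow> majorized B r (M k) (f k)"
  shows "majorized B r (sum M K) (\<lambda>s. \<Sum>k\<in>K. f k s)"
  using majorized_infsum(1)[of r K B M f "sum M K"] assms by (simp add: has_sum_finite_iff)

lemma majorized_mult:
  assumes r: "r > 0" and f: "majorized B r M f" and f': "majorized B r M' f'"
  shows "majorized B r (M * M') (\<lambda>s. f s * f' s)"
proof -
  let ?w = "\<lambda>\<alpha>. monomial_at B \<alpha> (\<lambda>_. r)"
  let ?I = "multi_indices B"
  obtain c m where c: "((\<lambda>\<alpha>. \<bar>c \<alpha>\<bar> * ?w \<alpha>) has_sum m) ?I" "m \<le> M"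
    "\<And>s. s \<in> polydisc B r \<Longrightarrow> ((\<lambda>\<alpha>. c \<alpha> * monomial_at B \<alpha> s) has_sum f s) ?I"
    using f unfolding majorized_def by blast
  obtain c' m' where c': "((\<lambda>\<alpha>. \<bar>c' \<alpha>\<bar> * ?w \<alpha>) has_sum m') ?I" "m' \<le> M'"
    "\<And>s. s \<in> polydisc B r \<Longrightarrow> ((\<lambda>\<alpha>. c' \<alpha> * monomial_at B \<alpha> s) has_sum f' s) ?I"
    using f' unfolding majorized_def by blast
  have w: "?w \<alpha> \<ge> 0" for \<alpha> by (rule monomial_at_nonneg[OF r])
  have m0: "m \<ge> 0" "m' \<ge> 0" using has_sum_nonneg[OF c(1)] has_sum_nonneg[OF c'(1)] w by auto
  define t where "t j = (\<bar>c (fst j)\<bar> * ?w (fst j)) * (\<bar>c' (snd j)\<bar> * ?w (snd j))" for j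
  have row: "((\<lambda>\<beta>. t (\<alpha>, \<beta>)) has_sum (\<bar>c \<alpha>\<bar> * ?w \<alpha>) * m') ?I" for \<alpha>
    unfolding t_def by (simp add: has_sum_cmult_right[OF c'(1)])
  have col: "((\<lambda>\<alpha>. (\<bar>c \<alpha>\<bar> * ?w \<alpha>) * m') has_sum m * m') ?I" by (rule has_sum_cmult_left[OF c(1)])
  have summ: "t summable_on ?I \<times> ?I"
    by (rule summable_on_SigmaI[OF row has_sum_imp_summable[OF col]]) (use w in \<open>auto simp: t_def\<close>)
  have tot: "(t has_sum m * m') (?I \<times> ?I)"
    by (rule has_sum_SigmaI[OF row col summ])
  have "((\<lambda>j. (c (fst j) * c' (snd j)) * monomial_at B (\<lambda>b. fst j b + snd j b) s) has_sum f s * f' s) (?I \<times> ?I)"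
    if s: "s \<in> polydisc B r" for s
  proof (rule has_sum_SigmaI)
    show "((\<lambda>\<alpha>. (c \<alpha> * monomial_at B \<alpha> s) * f' s) has_sum f s * f' s) ?I"
      by (rule has_sum_cmult_left[OF c(3)[OF s]])
    show "((\<lambda>\<beta>. (c (fst (\<alpha>, \<beta>)) * c' (snd (\<alpha>, \<beta>))) * monomial_at B (\<lambda>b. fst (\<alpha>, \<beta>) b + snd (\<alpha>, \<beta>) b) s) has_sum (c \<alpha> * monomial_at B \<alpha> s) * f' s) ?I" for \<alpha>
      using has_sum_cmult_right[OF c'(3)[OF s], of "c \<alpha> * monomial_at B \<alpha> s"]
      by (simp add: monomial_at_add mult_ac)
    have "(\<lambda>j. norm ((c (fst j) * c' (snd j)) * monomial_at B (\<lambda>b. fst j b + snd j b) s)) summable_on ?I \<times> ?I"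
    proof (rule summable_on_comparison_test[OF summ])
      fix j
      have "norm ((c (fst j) * c' (snd j)) * monomial_at B (\<lambda>b. fst j b + snd j b) s)
          = (\<bar>c (fst j)\<bar> * \<bar>monomial_at B (fst j) s\<bar>) * (\<bar>c' (snd j)\<bar> * \<bar>monomial_at B (snd j) s\<bar>)"
        by (simp add: monomial_at_add abs_mult)
      also have "\<dots> \<le> t j" unfolding t_def
        by (intro mult_mono mult_left_mono abs_monomial_at_le[OF s]) (auto intro!: mult_nonneg_nonneg w)
      finally show "norm ((c (fst j) * c' (snd j)) * monomial_at B (\<lambda>b. fst j b + snd j b) s) \<le> t j" .
    qed simp
    then show "(\<lambda>j. (c (fst j) * c' (snd j)) * monomial_at B (\<lambda>b. fst j b + snd j b) s) summable_on ?I \<times> ?I"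
      by (rule abs_summable_summable)
  qed
  moreover have "((\<lambda>j. \<bar>c (fst j) * c' (snd j)\<bar> * monomial_at B (\<lambda>b. fst j b + snd j b) (\<lambda>_. r)) has_sum m * m') (?I \<times> ?I)"
    using tot unfolding t_def monomial_at_add by (simp add: abs_mult mult_ac)
  moreover have "m * m' \<le> M * M'" using c(2) c'(2) m0 by (intro mult_mono) auto
  ultimately show ?thesis
    by (intro majorizedI[OF r, where J = "?I \<times> ?I" and a = "\<lambda>j b. fst j b + snd j b"]) (auto simp: multi_indices_def)
qed

lemma majorized_cmult:
  assumes "r > 0" "majorized B r M f"
  shows "majorized B r (\<bar>k\<bar> * M) (\<lambda>s. k * f s)"
  by (rule majorized_mult[OF assms(1) majorized_const[OF assms(1) order_refl] assms(2)])

lemma majorized_power: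
  assumes "r > 0" "majorized B r M f"
  shows "majorized B r (M ^ n) (\<lambda>s. f s ^ n)"
  by (induction n) (auto intro!: majorized_const majorized_mult assms)

text \<open>
  Geometric series in \<open>(a - f) / a\<close>, whose norm is at most \<open>M / a < 1\<close>.
\<close>

lemma majorized_inverse:
  assumes r: "r > 0" and f: "majorized B r M (\<lambda>s. f s - a)" and a: "a > 0" "M < a"
  shows "\<exists>M'. majorized B r M' (\<lambda>s. 1 / f s)"
proof -
  have "polydisc B r \<noteq> {}" using r unfolding polydisc_def by (auto intro!: exI[of _ "\<lambda>_. 0"])
  then have M0: "M \<ge> 0" using majorized_bound[OF f] by force
  let ?h = "\<lambda>k s. (1 / a) * ((- 1 / a) * (f s - a)) ^ k"
  have h: "majorized B r ((1 / a) * (M / a) ^ k) (?h k)" for k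
    using majorized_cmult[OF r majorized_power[OF r majorized_cmult[OF r f, of "- 1 / a"], of k], of "1 / a"] a by simp
  have "((\<lambda>k. (M / a) ^ k) has_sum (1 / (1 - M / a))) UNIV"
    using a M0 by (intro sums_nonneg_imp_has_sum geometric_sums) auto
  then have S: "((\<lambda>k. (1 / a) * (M / a) ^ k) has_sum (1 / a) * (1 / (1 - M / a))) UNIV"
    by (rule has_sum_cmult_right)
  have "majorized B r ((1 / a) * (1 / (1 - M / a))) (\<lambda>s. \<Sum>\<^sub>\<infinity>k. ?h k s)"
    by (rule majorized_infsum(1)[OF r h S])
  then have "majorized B r ((1 / a) * (1 / (1 - M / a))) (\<lambda>s. 1 / f s)"
  proof (rule majorized_cong)
    fix s assume s: "s \<in> polydisc B r"
    let ?q = "(- 1 / a) * (f s - a)"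
    have "\<bar>f s - a\<bar> < a" using majorized_bound[OF f s] a(2) by simp
    then have q: "norm ?q < 1" and fs: "f s > 0" using a by (auto simp: abs_mult)
    have "(\<lambda>k. (1 / a) * ?q ^ k) sums ((1 / a) * (1 / (1 - ?q)))"
      using geometric_sums[OF q] by (rule sums_mult)
    moreover have "(\<lambda>k. ?h k s) sums (\<Sum>\<^sub>\<infinity>k. ?h k s)"
      by (intro has_sum_imp_sums has_sum_infsum majorized_infsum(2)[OF r h S s])
    ultimately have "(\<Sum>\<^sub>\<infinity>k. ?h k s) = (1 / a) * (1 / (1 - ?q))" by (rule sums_unique2[symmetric])
    also have "\<dots> = 1 / f s" using a fs by (simp add: field_simps)
    finally show "(\<Sum>\<^sub>\<infinity>k. ?h k s) = 1 / f s" .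
  qed
  then show ?thesis by blast
qed

section \<open>Analytic solution of fixed point equations\<close>

definition majorized_vec :: "'v set \<Rightarrow> real \<Rightarrow> real \<Rightarrow> (('v \<Rightarrow> real) \<Rightarrow> 'a::euclidean_space) \<Rightarrow> bool" where
  "majorized_vec B r M u \<longleftrightarrow> (\<forall>i\<in>Basis. majorized B r M (\<lambda>s. u s \<bullet> i))"

lemma majorized_linear:
  fixes f :: "'a::euclidean_space \<Rightarrow> real"
  assumes r: "r > 0" and f: "bounded_linear f" and u: "majorized_vec B r M u"
  shows "majorized B r ((\<Sum>i\<in>Basis. \<bar>f i\<bar>) * M) (\<lambda>s. f (u s))"
proof -
  interpret bounded_linear f by fact
  have coords: "f x = (\<Sum>i\<in>Basis. f i * (x \<bullet> i))" for x
  proof -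
    have "f x = f (\<Sum>i\<in>Basis. (x \<bullet> i) *\<^sub>R i)" by (simp only: euclidean_representation)
    also have "\<dots> = (\<Sum>i\<in>Basis. f i * (x \<bullet> i))" unfolding sum scaleR by (simp add: mult.commute)
    finally show ?thesis .
  qed
  have "majorized B r (\<Sum>i\<in>Basis. \<bar>f i\<bar> * M) (\<lambda>s. \<Sum>i\<in>Basis. f i * (u s \<bullet> i))"
    by (rule majorized_sum[OF r finite_Basis], rule majorized_cmult[OF r])
      (use u in \<open>simp add: majorized_vec_def\<close>)
  then have "majorized B r (\<Sum>i\<in>Basis. \<bar>f i\<bar> * M) (\<lambda>s. f (u s))"
    by (rule majorized_cong) (rule coords[symmetric])
  then show ?thesis by (simp only: sum_distrib_right)
qed

lemma majorized_vec_nonneg: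
  fixes u :: "('v \<Rightarrow> real) \<Rightarrow> 'a::euclidean_space"
  assumes "r > 0" "majorized_vec B r M u"
  shows "M \<ge> 0"
proof -
  obtain i :: 'a where "i \<in> Basis" using nonempty_Basis by blast
  then have "majorized B r M (\<lambda>s. u s \<bullet> i)" using assms(2) unfolding majorized_vec_def by blast
  moreover have "(\<lambda>_. 0) \<in> polydisc B r" using assms(1) by (simp add: polydisc_def)
  ultimately have "\<bar>u (\<lambda>_. 0) \<bullet> i\<bar> \<le> M" by (rule majorized_bound)
  then show ?thesis by linarith
qed

text \<open>
  Substitution of small vector functions \<open>u\<close>, \<open>v\<close> into \<open>f\<close>: the first clause is a Lipschitz estimate, the second says that
  after removal of the linear part \<open>D\<close> the Lipschitz constant on the ball of radius \<open>\<rho>\<close> is of order \<open>\<rho>\<close>. The constant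
  \<open>K\<close> does not depend on the radius \<open>r\<close> of the polydisc, which can therefore be fixed last.
\<close>

definition lipschitz_majorized :: "'v set \<Rightarrow> real \<Rightarrow> ('a::euclidean_space \<Rightarrow> real) \<Rightarrow> ('a \<Rightarrow> real) \<Rightarrow> bool" where
  "lipschitz_majorized B K D f \<longleftrightarrow>
    (\<forall>r \<rho> \<delta> u v. r > 0 \<longrightarrow> \<rho> \<le> 1 \<longrightarrow>
       majorized_vec B r \<rho> u \<longrightarrow> majorized_vec B r \<rho> v \<longrightarrow> majorized_vec B r \<delta> (\<lambda>s. u s - v s) \<longrightarrow>
       majorized B r (K * \<delta>) (\<lambda>s. f (u s) - f (v s)) \<and>
       majorized B r (K * \<rho> * \<delta>) (\<lambda>s. f (u s) - f (v s) - D (u s - v s)))"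

lemma lipschitz_majorizedD:
  assumes "lipschitz_majorized B K D f" "r > 0" "\<rho> \<le> 1"
    "majorized_vec B r \<rho> u" "majorized_vec B r \<rho> v" "majorized_vec B r \<delta> (\<lambda>s. u s - v s)"
  shows "majorized B r (K * \<delta>) (\<lambda>s. f (u s) - f (v s))"
    "majorized B r (K * \<rho> * \<delta>) (\<lambda>s. f (u s) - f (v s) - D (u s - v s))"
  using assms unfolding lipschitz_majorized_def by blast+

lemma majorized_vec_0: "r > 0 \<Longrightarrow> 0 \<le> M \<Longrightarrow> majorized_vec B r M (\<lambda>_. 0)"
  unfolding majorized_vec_def by (simp add: majorized_const)

lemma lipschitz_majorized_at_0:
  assumes "lipschitz_majorized B K D f" "r > 0" "\<rho> \<le> 1" "majorized_vec B r \<rho> u"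
  shows "majorized B r (K * \<rho>) (\<lambda>s. f (u s) - f 0)"
  using lipschitz_majorizedD(1)[OF assms majorized_vec_0, of \<rho>] assms majorized_vec_nonneg by auto

text \<open>
  Induction over the construction of a polynomial function; only products require a computation.
\<close>

lemma polynomial_lipschitz_majorized:
  fixes f :: "'a::euclidean_space \<Rightarrow> real"
  assumes "real_polynomial_function f"
  shows "\<exists>K>0. \<exists>D. (f has_derivative D) (at 0) \<and> lipschitz_majorized B K D f"
  using assms
proof (induction f rule: real_polynomial_function.induct)
  case (linear f)
  interpret bounded_linear f by fact
  let ?K = "1 + (\<Sum>i\<in>Basis. \<bar>f i\<bar>)"
  have K: "0 < ?K" by (simp add: add_pos_nonneg sum_nonneg)
  have "lipschitz_majorized B ?K f f"
    unfolding lipschitz_majorized_def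
  proof (intro allI impI)
    fix r \<rho> \<delta> :: real and u v :: "('b \<Rightarrow> real) \<Rightarrow> 'a"
    assume r: "r > 0" and u: "majorized_vec B r \<rho> u" and w: "majorized_vec B r \<delta> (\<lambda>s. u s - v s)"
    note \<rho> = majorized_vec_nonneg[OF r u] and \<delta> = majorized_vec_nonneg[OF r w]
    have "majorized B r ((\<Sum>i\<in>Basis. \<bar>f i\<bar>) * \<delta>) (\<lambda>s. f (u s) - f (v s))"
      using majorized_linear[OF r \<open>bounded_linear f\<close> w] by (simp add: diff)
    then have "majorized B r (?K * \<delta>) (\<lambda>s. f (u s) - f (v s))"
      by (rule majorized_mono) (simp add: \<delta> mult_right_mono)
    moreover have "majorized B r (?K * \<rho> * \<delta>) (\<lambda>s. f (u s) - f (v s) - f (u s - v s))"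
      using r \<rho> \<delta> K by (simp add: diff majorized_const)
    ultimately show "majorized B r (?K * \<delta>) (\<lambda>s. f (u s) - f (v s)) \<and>
       majorized B r (?K * \<rho> * \<delta>) (\<lambda>s. f (u s) - f (v s) - f (u s - v s))" ..
  qed
  moreover have "(f has_derivative f) (at 0)" by (rule bounded_linear_imp_has_derivative) fact
  ultimately show ?case using K by blast
next
  case (const c)
  have "lipschitz_majorized B 1 (\<lambda>_. 0) (\<lambda>_::'a. c)"
    unfolding lipschitz_majorized_def
  proof (intro allI impI)
    fix r \<rho> \<delta> :: real and u v :: "('b \<Rightarrow> real) \<Rightarrow> 'a"
    assume r: "r > 0" and u: "majorized_vec B r \<rho> u" and w: "majorized_vec B r \<delta> (\<lambda>s. u s - v s)"
    show "majorized B r (1 * \<delta>) (\<lambda>s. c - c) \<and> majorized B r (1 * \<rho> * \<delta>) (\<lambda>s. c - c - 0)"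
      using majorized_vec_nonneg[OF r u] majorized_vec_nonneg[OF r w] r by (simp add: majorized_const)
  qed
  moreover have "((\<lambda>_::'a. c) has_derivative (\<lambda>_. 0)) (at 0)" by simp
  ultimately show ?case using zero_less_one by blast
next
  case (add f g)
  then obtain K1 D1 K2 D2 where K: "K1 > 0" "K2 > 0"
    and D: "(f has_derivative D1) (at 0)" "(g has_derivative D2) (at 0)"
    and f: "lipschitz_majorized B K1 D1 f" and g: "lipschitz_majorized B K2 D2 g"
    by blast
  have "lipschitz_majorized B (K1 + K2) (\<lambda>x. D1 x + D2 x) (\<lambda>x. f x + g x)"
    unfolding lipschitz_majorized_def
  proof (intro allI impI conjI)
    fix r \<rho> \<delta> :: real and u v :: "('b \<Rightarrow> real) \<Rightarrow> 'a"
    assume *: "r > 0" "\<rho> \<le> 1" "majorized_vec B r \<rho> u" "majorized_vec B r \<rho> v" "majorized_vec B r \<delta> (\<lambda>s. u s - v s)"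
    show "majorized B r ((K1 + K2) * \<delta>) (\<lambda>s. f (u s) + g (u s) - (f (v s) + g (v s)))"
      using majorized_add[OF *(1) lipschitz_majorizedD(1)[OF f *] lipschitz_majorizedD(1)[OF g *]] by (simp add: algebra_simps)
    show "majorized B r ((K1 + K2) * \<rho> * \<delta>) (\<lambda>s. f (u s) + g (u s) - (f (v s) + g (v s)) - (D1 (u s - v s) + D2 (u s - v s)))"
      using majorized_add[OF *(1) lipschitz_majorizedD(2)[OF f *] lipschitz_majorizedD(2)[OF g *]] by (simp add: algebra_simps)
  qed
  then show ?case using has_derivative_add[OF D] K by (meson add_pos_pos)
next
  case (mult f g)
  then obtain K1 D1 K2 D2 where K: "K1 > 0" "K2 > 0"
    and D: "(f has_derivative D1) (at 0)" "(g has_derivative D2) (at 0)"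
    and f: "lipschitz_majorized B K1 D1 f" and g: "lipschitz_majorized B K2 D2 g"
    by blast
  let ?a = "f 0" and ?b = "g 0"
  let ?K = "(\<bar>?a\<bar> + K1) * K2 + K1 * (\<bar>?b\<bar> + K2)"
  have "lipschitz_majorized B ?K (\<lambda>x. ?a * D2 x + D1 x * ?b) (\<lambda>x. f x * g x)"
    unfolding lipschitz_majorized_def
  proof (intro allI impI conjI)
    fix r \<rho> \<delta> :: real and u v :: "('b \<Rightarrow> real) \<Rightarrow> 'a"
    assume *: "r > 0" "\<rho> \<le> 1" "majorized_vec B r \<rho> u" "majorized_vec B r \<rho> v" "majorized_vec B r \<delta> (\<lambda>s. u s - v s)"
    note r = *(1)
    note fu = lipschitz_majorized_at_0[OF f *(1,2,3)] and gv = lipschitz_majorized_at_0[OF g *(1,2,4)]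
    have a: "majorized B r \<bar>?a\<bar> (\<lambda>_. ?a)" and b: "majorized B r \<bar>?b\<bar> (\<lambda>_. ?b)"
      using r by (simp_all add: majorized_const)
    have fu': "majorized B r (\<bar>?a\<bar> + K1) (\<lambda>s. f (u s))"
      using majorized_mono[OF majorized_add[OF r a fu], of "\<bar>?a\<bar> + K1"] K * by (simp add: mult_left_le)
    have gv': "majorized B r (\<bar>?b\<bar> + K2) (\<lambda>s. g (v s))"
      using majorized_mono[OF majorized_add[OF r b gv], of "\<bar>?b\<bar> + K2"] K * by (simp add: mult_left_le)
    note df = lipschitz_majorizedD(1)[OF f *] and dg = lipschitz_majorizedD(1)[OF g *]
    note ddf = lipschitz_majorizedD(2)[OF f *] and ddg = lipschitz_majorizedD(2)[OF g *]
    \<comment> \<open>\<open>f u g u - f v g v = f u (g u - g v) + (f u - f v) g v\<close>\<close>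
    show "majorized B r (?K * \<delta>) (\<lambda>s. f (u s) * g (u s) - f (v s) * g (v s))"
      using majorized_add[OF r majorized_mult[OF r fu' dg] majorized_mult[OF r df gv']]
      by (simp add: algebra_simps)
    show "majorized B r (?K * \<rho> * \<delta>) (\<lambda>s. f (u s) * g (u s) - f (v s) * g (v s) - (?a * D2 (u s - v s) + D1 (u s - v s) * ?b))"
      using majorized_add[OF r
            majorized_add[OF r majorized_mult[OF r a ddg] majorized_mult[OF r fu dg]]
            majorized_add[OF r majorized_mult[OF r ddf b] majorized_mult[OF r df gv]]]
      by (simp add: algebra_simps)
  qed
  moreover have "?K > 0" using K by (intro add_pos_pos mult_pos_pos add_nonneg_pos) auto
  ultimately show ?case using has_derivative_mult[OF D] by blast
qed

text \<open>
  Picard iteration from \<open>0\<close> in the norm of \<open>majorized_vec\<close>. As \<open>Q\<close> vanishes to second order, it contracts by a factor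
  \<open>1/4\<close> on a small ball; the perturbation carries the factors \<open>s b\<close>, of norm \<open>r\<close>, and contributes another
  \<open>1/4\<close> once \<open>r\<close> is small. The increments are then summable in norm, with sum \<open>\<rho>\<close>.
\<close>

lemma analytic_fixed_point:
  fixes Q :: "'a::euclidean_space \<Rightarrow> 'a" and q :: "'v \<Rightarrow> 'a \<Rightarrow> 'a" and B :: "'v set"
  assumes B: "finite B" and Q: "polynomial_function Q" "Q 0 = 0" "(Q has_derivative (\<lambda>_. 0)) (at 0)"
    and q: "\<And>b. polynomial_function (q b)" and \<rho>0: "\<rho>0 > 0"
  obtains r \<rho> u where "r > 0" "\<rho> > 0" "\<rho> \<le> \<rho>0" "majorized_vec B r \<rho> u"
    "\<forall>s\<in>polydisc B r. u s = Q (u s) + (\<Sum>b\<in>B. s b *\<^sub>R q b (u s))"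
proof -
  have "\<exists>K>0. lipschitz_majorized B K (\<lambda>_. 0) (\<lambda>x. Q x \<bullet> i)" for i
  proof -
    have "real_polynomial_function (\<lambda>x. Q x \<bullet> i)"
      using polynomial_function_inner[OF Q(1)] by (simp add: real_polynomial_function_eq)
    then obtain K D where K: "K > 0" "((\<lambda>x. Q x \<bullet> i) has_derivative D) (at 0)" "lipschitz_majorized B K D (\<lambda>x. Q x \<bullet> i)"
      using polynomial_lipschitz_majorized by blast
    have "((\<lambda>x. Q x \<bullet> i) has_derivative (\<lambda>_. 0)) (at 0)"
      using has_derivative_inner_left[OF Q(3), of i] by simp
    then have "D = (\<lambda>_. 0)" using K(2) has_derivative_unique by blast
    then show ?thesis using K by blast
  qed
  then obtain K where K: "\<And>i. K i > 0" "\<And>i. lipschitz_majorized B (K i) (\<lambda>_. 0) (\<lambda>x. Q x \<bullet> i)" by metis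
  have "\<exists>L>0. \<exists>D. lipschitz_majorized B L D (\<lambda>x. q b x \<bullet> i)" for b i
    using polynomial_lipschitz_majorized[of "\<lambda>x. q b x \<bullet> i" B] polynomial_function_inner[OF q]
    by (auto simp: real_polynomial_function_eq)
  then obtain L D where L: "\<And>b i. L b i > 0" "\<And>b i. lipschitz_majorized B (L b i) (D b i) (\<lambda>x. q b x \<bullet> i)" by metis
  \<comment> \<open>\<open>\<kappa>\<close> bounds the constants of \<open>Q\<close>, and \<open>\<mu>\<close> the constants and the values at \<open>0\<close> of the perturbation.\<close>
  define \<kappa> where "\<kappa> = 1 + (\<Sum>i\<in>Basis. K i)"
  define \<mu> where "\<mu> = 1 + (\<Sum>i\<in>Basis. \<Sum>b\<in>B. L b i + \<bar>q b 0 \<bullet> i\<bar>)"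
  have \<kappa>: "\<kappa> > 0" "\<And>i. i \<in> Basis \<Longrightarrow> K i \<le> \<kappa>"
  proof -
    show "\<kappa> > 0" unfolding \<kappa>_def using K(1) by (intro add_pos_nonneg sum_nonneg) (auto intro: less_imp_le)
    show "K i \<le> \<kappa>" if "i \<in> Basis" for i
      unfolding \<kappa>_def using member_le_sum[OF that, of K] K(1) by (simp add: less_imp_le add_increasing)
  qed
  have inner_nonneg: "0 \<le> (\<Sum>b\<in>B. L b i + \<bar>q b 0 \<bullet> i\<bar>)" for i
    using L(1) by (intro sum_nonneg add_nonneg_nonneg) (auto intro: less_imp_le)
  have \<mu>: "\<mu> > 0" "\<And>i. i \<in> Basis \<Longrightarrow> (\<Sum>b\<in>B. L b i + \<bar>q b 0 \<bullet> i\<bar>) \<le> \<mu>"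
  proof -
    have "0 \<le> (\<Sum>i\<in>Basis. \<Sum>b\<in>B. L b i + \<bar>q b 0 \<bullet> i\<bar>)" by (rule sum_nonneg) (rule inner_nonneg)
    then show "\<mu> > 0" unfolding \<mu>_def by linarith
    show "(\<Sum>b\<in>B. L b i + \<bar>q b 0 \<bullet> i\<bar>) \<le> \<mu>" if "i \<in> Basis" for i
      unfolding \<mu>_def using member_le_sum[OF that, of "\<lambda>i. \<Sum>b\<in>B. L b i + \<bar>q b 0 \<bullet> i\<bar>"] inner_nonneg by simp
  qed
  have L_le: "(\<Sum>b\<in>B. L b i) \<le> \<mu>" and q_le: "(\<Sum>b\<in>B. \<bar>q b 0 \<bullet> i\<bar>) \<le> \<mu>" if "i \<in> Basis" for i
  proof -
    have "(\<Sum>b\<in>B. L b i) \<le> (\<Sum>b\<in>B. L b i + \<bar>q b 0 \<bullet> i\<bar>)" by (intro sum_mono) simp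
    then show "(\<Sum>b\<in>B. L b i) \<le> \<mu>" using \<mu>(2)[OF that] by simp
    have "(\<Sum>b\<in>B. \<bar>q b 0 \<bullet> i\<bar>) \<le> (\<Sum>b\<in>B. L b i + \<bar>q b 0 \<bullet> i\<bar>)" using L(1) by (intro sum_mono) (simp add: less_imp_le)
    then show "(\<Sum>b\<in>B. \<bar>q b 0 \<bullet> i\<bar>) \<le> \<mu>" using \<mu>(2)[OF that] by simp
  qed
  define \<rho> where "\<rho> = min \<rho>0 (min 1 (1 / (4 * \<kappa>)))"
  have \<rho>: "\<rho> > 0" "\<rho> \<le> \<rho>0" "\<rho> \<le> 1" "\<kappa> * \<rho> \<le> 1 / 4"
  proof -
    show "\<rho> > 0" "\<rho> \<le> \<rho>0" "\<rho> \<le> 1" unfolding \<rho>_def using \<rho>0 \<kappa>(1) by auto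
    have "\<rho> \<le> 1 / (4 * \<kappa>)" unfolding \<rho>_def by simp
    then show "\<kappa> * \<rho> \<le> 1 / 4" using \<kappa>(1) by (simp add: field_simps)
  qed
  define r where "r = min (1 / (4 * \<mu>)) (\<rho> / (2 * \<mu>))"
  have r: "r > 0" "r * \<mu> \<le> 1 / 4" "r * \<mu> \<le> \<rho> / 2"
  proof -
    show "r > 0" unfolding r_def using \<mu>(1) \<rho>(1) by simp
    have "r \<le> 1 / (4 * \<mu>)" "r \<le> \<rho> / (2 * \<mu>)" unfolding r_def by auto
    then show "r * \<mu> \<le> 1 / 4" "r * \<mu> \<le> \<rho> / 2" using \<mu>(1) by (simp_all add: field_simps)
  qed
  note r0 = r(1)
  define T where "T s x = Q x + (\<Sum>b\<in>B. s b *\<^sub>R q b x)" for s :: "'v \<Rightarrow> real" and x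
  have contraction: "majorized_vec B r (\<delta> / 2) (\<lambda>s. T s (u s) - T s (v s))"
    if u: "majorized_vec B r \<rho> u" and v: "majorized_vec B r \<rho> v" and w: "majorized_vec B r \<delta> (\<lambda>s. u s - v s)" for u v \<delta>
    unfolding majorized_vec_def
  proof
    fix i :: 'a assume i: "i \<in> Basis"
    have \<delta>: "\<delta> \<ge> 0" using majorized_vec_nonneg[OF r0 w] .
    have "majorized B r (K i * \<rho> * \<delta>) (\<lambda>s. Q (u s) \<bullet> i - Q (v s) \<bullet> i)"
      using lipschitz_majorizedD(2)[OF K(2) r0 \<rho>(3) u v w, of i] by simp
    moreover have "K i * \<rho> * \<delta> \<le> \<delta> / 4"
    proof -
      have "K i * \<rho> \<le> 1 / 4" using mult_right_mono[OF \<kappa>(2)[OF i], of \<rho>] \<rho>(1,4) by linarith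
      from mult_right_mono[OF this \<delta>] show ?thesis by simp
    qed
    ultimately have 1: "majorized B r (\<delta> / 4) (\<lambda>s. Q (u s) \<bullet> i - Q (v s) \<bullet> i)" by (rule majorized_mono)
    have "majorized B r (\<Sum>b\<in>B. r * (L b i * \<delta>)) (\<lambda>s. \<Sum>b\<in>B. s b * (q b (u s) \<bullet> i - q b (v s) \<bullet> i))"
      by (rule majorized_sum[OF r0 B], rule majorized_mult[OF r0 majorized_coordinate[OF r0 B]])
        (auto intro: lipschitz_majorizedD(1)[OF L(2) r0 \<rho>(3) u v w])
    moreover have "(\<Sum>b\<in>B. r * (L b i * \<delta>)) \<le> \<delta> / 4"
    proof -
      have "(\<Sum>b\<in>B. r * (L b i * \<delta>)) = r * (\<Sum>b\<in>B. L b i) * \<delta>" by (simp add: sum_distrib_left sum_distrib_right mult.assoc)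
      also have "\<dots> \<le> r * \<mu> * \<delta>" using L_le[OF i] r0 \<delta> by (intro mult_right_mono mult_left_mono) auto
      also have "\<dots> \<le> \<delta> / 4" using mult_right_mono[OF r(2) \<delta>] by simp
      finally show ?thesis .
    qed
    ultimately have 2: "majorized B r (\<delta> / 4) (\<lambda>s. \<Sum>b\<in>B. s b * (q b (u s) \<bullet> i - q b (v s) \<bullet> i))" by (rule majorized_mono)
    have eq: "(T s (u s) - T s (v s)) \<bullet> i = Q (u s) \<bullet> i - Q (v s) \<bullet> i + (\<Sum>b\<in>B. s b * (q b (u s) \<bullet> i - q b (v s) \<bullet> i))" for s
      unfolding T_def by (simp add: inner_diff_left inner_add_left inner_sum_left right_diff_distrib sum_subtractf)
    show "majorized B r (\<delta> / 2) (\<lambda>s. (T s (u s) - T s (v s)) \<bullet> i)"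
      unfolding eq using majorized_add[OF r0 1 2] by simp
  qed
  define u where "u n s = ((T s) ^^ n) 0" for n s
  have u0: "u 0 s = 0" and uS: "u (Suc n) s = T s (u n s)" for n s unfolding u_def by simp_all
  have vec_add: "majorized_vec B r (M + M') (\<lambda>s. f s + f' s)" if "majorized_vec B r M f" "majorized_vec B r M' f'" for M M' and f f' :: "('v \<Rightarrow> real) \<Rightarrow> 'a"
    using that unfolding majorized_vec_def by (auto simp: inner_add_left intro: majorized_add[OF r0])
  have iter: "majorized_vec B r (\<rho> * (1 - (1/2) ^ n)) (u n) \<and> majorized_vec B r (\<rho> * (1/2) ^ Suc n) (\<lambda>s. u (Suc n) s - u n s)" for n
  proof (induction n)
    case 0
    have "majorized B r (\<rho> / 2) (\<lambda>s. T s 0 \<bullet> i)" if i: "i \<in> Basis" for i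
    proof -
      have "majorized B r (\<Sum>b\<in>B. r * \<bar>q b 0 \<bullet> i\<bar>) (\<lambda>s. \<Sum>b\<in>B. s b * (q b 0 \<bullet> i))"
        by (rule majorized_sum[OF r0 B], rule majorized_mult[OF r0 majorized_coordinate[OF r0 B]])
          (auto intro: majorized_const[OF r0])
      moreover have "(\<Sum>b\<in>B. r * \<bar>q b 0 \<bullet> i\<bar>) \<le> \<rho> / 2"
        using mult_left_mono[OF q_le[OF i], of r] r0 r(3) by (simp add: sum_distrib_left)
      ultimately show ?thesis unfolding T_def using Q(2) by (simp add: inner_sum_left majorized_mono)
    qed
    then show ?case using majorized_vec_0[OF r0, where 'b='a and B=B] by (simp add: u0 uS majorized_vec_def)
  next
    case (Suc n)
    have le: "\<rho> * (1 - (1/2) ^ k) \<le> \<rho>" for k using \<rho>(1) by simp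
    have mono: "majorized_vec B r M' f" if "majorized_vec B r M f" "M \<le> M'" for M M' and f :: "('v \<Rightarrow> real) \<Rightarrow> 'a"
      using that majorized_mono unfolding majorized_vec_def by blast
    have "majorized_vec B r (\<rho> * (1 - (1/2) ^ n) + \<rho> * (1/2) ^ Suc n) (\<lambda>s. u n s + (u (Suc n) s - u n s))"
      using Suc by (intro vec_add) auto
    moreover have "\<rho> * (1 - (1/2) ^ n) + \<rho> * (1/2) ^ Suc n = \<rho> * (1 - (1/2) ^ Suc n)" by (simp add: algebra_simps)
    ultimately have un: "majorized_vec B r (\<rho> * (1 - (1/2) ^ Suc n)) (u (Suc n))" by simp
    have "majorized_vec B r (\<rho> * (1/2) ^ Suc n / 2) (\<lambda>s. T s (u (Suc n) s) - T s (u n s))"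
      using Suc by (intro contraction mono[OF un le] mono[OF _ le]) auto
    then show ?case using un unfolding uS[of "Suc n"] uS[of n, symmetric] by simp
  qed
  define d where "d i n s = (u (Suc n) s - u n s) \<bullet> i" for i n s
  have d: "majorized B r (\<rho> * (1/2) ^ Suc n) (d i n)" if "i \<in> Basis" for i n
    using iter[of n] that unfolding majorized_vec_def d_def by blast
  have half: "((\<lambda>n. \<rho> * (1/2) ^ Suc n) has_sum \<rho>) UNIV"
    using power_half_series \<rho>(1) sums_mult[OF power_half_series, of \<rho>]
    by (intro sums_nonneg_imp_has_sum) auto
  define U where "U s = (\<Sum>i\<in>Basis. (\<Sum>\<^sub>\<infinity>n. d i n s) *\<^sub>R i)" for s
  have U_comp: "U s \<bullet> i = (\<Sum>\<^sub>\<infinity>n. d i n s)" if "i \<in> Basis" for i s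
    unfolding U_def using that by simp
  have U_major: "majorized_vec B r \<rho> U"
    unfolding majorized_vec_def
  proof
    fix i :: 'a assume i: "i \<in> Basis"
    show "majorized B r \<rho> (\<lambda>s. U s \<bullet> i)"
      unfolding U_comp[OF i] by (rule majorized_infsum(1)[OF r0 d[OF i] half])
  qed
  have "U s = Q (U s) + (\<Sum>b\<in>B. s b *\<^sub>R q b (U s))" if s: "s \<in> polydisc B r" for s
  proof -
    have "(\<lambda>n. u n s) \<longlonglongrightarrow> U s"
    proof (rule tendsto_componentwise_iff[THEN iffD2], rule ballI)
      fix i :: 'a assume i: "i \<in> Basis"
      have "(\<lambda>n. d i n s) sums (U s \<bullet> i)"
        unfolding U_comp[OF i]
        by (intro has_sum_imp_sums has_sum_infsum majorized_infsum(2)[OF r0 d[OF i] half s])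
      moreover have "(\<Sum>k<n. d i k s) = u n s \<bullet> i" for n
        by (induction n) (simp_all add: u0 d_def inner_diff_left)
      ultimately show "(\<lambda>n. u n s \<bullet> i) \<longlonglongrightarrow> U s \<bullet> i" unfolding sums_def by simp
    qed
    moreover have "isCont (T s) (U s)"
      unfolding T_def using continuous_polymonial_function[OF Q(1)] continuous_polymonial_function[OF q]
      by (intro continuous_intros) auto
    ultimately have "(\<lambda>n. T s (u n s)) \<longlonglongrightarrow> T s (U s)" by (rule isCont_tendsto_compose[rotated])
    moreover have "(\<lambda>n. T s (u n s)) \<longlonglongrightarrow> U s"
      using LIMSEQ_Suc[OF \<open>(\<lambda>n. u n s) \<longlonglongrightarrow> U s\<close>] by (simp add: uS)
    ultimately show ?thesis unfolding T_def using LIMSEQ_unique by blast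
  qed
  then have "\<forall>s\<in>polydisc B r. U s = Q (U s) + (\<Sum>b\<in>B. s b *\<^sub>R q b (U s))" by blast
  with r0 \<rho>(1,2) U_major show thesis by (rule that)
qed

section \<open>Analyticity of the dual function\<close>

lemma polynomial_gradient:
  fixes f :: "'a::euclidean_space \<Rightarrow> real"
  assumes "real_polynomial_function f"
  shows "\<exists>G. polynomial_function G \<and> (\<forall>x. (f has_derivative (\<lambda>v. G x \<bullet> v)) (at x))"
  using assms
proof (induction f rule: real_polynomial_function.induct)
  case (linear f)
  interpret bounded_linear f by fact
  have "f v = (\<Sum>i\<in>Basis. f i *\<^sub>R i) \<bullet> v" for v
  proof -
    have "f v = f (\<Sum>i\<in>Basis. (v \<bullet> i) *\<^sub>R i)" by (simp only: euclidean_representation)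
    also have "\<dots> = (\<Sum>i\<in>Basis. f i *\<^sub>R i) \<bullet> v" unfolding sum scaleR by (simp add: inner_sum_left inner_commute[of v] mult.commute)
    finally show ?thesis .
  qed
  then have "f = (\<lambda>v. (\<Sum>i\<in>Basis. f i *\<^sub>R i) \<bullet> v)" by (rule ext)
  moreover have "(f has_derivative f) (at x)" for x by (rule bounded_linear_imp_has_derivative) fact
  ultimately have "(f has_derivative (\<lambda>v. (\<Sum>i\<in>Basis. f i *\<^sub>R i) \<bullet> v)) (at x)" for x by metis
  then show ?case by (intro exI[of _ "\<lambda>_. \<Sum>i\<in>Basis. f i *\<^sub>R i"]) simp
next
  case (const c)
  show ?case by (intro exI[of _ "\<lambda>_. 0"]) simp
next
  case (add f g)
  then obtain F G where FG: "polynomial_function F" "\<And>x. (f has_derivative (\<lambda>v. F x \<bullet> v)) (at x)"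
    "polynomial_function G" "\<And>x. (g has_derivative (\<lambda>v. G x \<bullet> v)) (at x)" by blast
  have "((\<lambda>x. f x + g x) has_derivative (\<lambda>v. (F x + G x) \<bullet> v)) (at x)" for x
    using has_derivative_add[OF FG(2,4)] by (simp add: inner_add_left)
  then show ?case using FG by (intro exI[of _ "\<lambda>x. F x + G x"]) auto
next
  case (mult f g)
  then obtain F G where FG: "polynomial_function F" "\<And>x. (f has_derivative (\<lambda>v. F x \<bullet> v)) (at x)"
    "polynomial_function G" "\<And>x. (g has_derivative (\<lambda>v. G x \<bullet> v)) (at x)" by blast
  have "((\<lambda>x. f x * g x) has_derivative (\<lambda>v. (f x *\<^sub>R G x + g x *\<^sub>R F x) \<bullet> v)) (at x)" for x
    using has_derivative_mult[OF FG(2,4)] by (simp add: inner_add_left mult.commute)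
  then show ?case using FG mult.hyps
    by (intro exI[of _ "\<lambda>x. f x *\<^sub>R G x + g x *\<^sub>R F x"]) (auto simp: real_polynomial_function_eq)
qed

text \<open>
  The second derivative is twice the second elementary symmetric function of the \<open>l\<close>, written by power sums.
\<close>

lemma prod_mset_second_derivative:
  fixes A :: "real multiset"
  shows "\<exists>p. (\<forall>t. ((\<lambda>t. \<Prod>l\<in>#A. 1 + t * l) has_real_derivative p t) (at t)) \<and> p 0 = \<Sum>\<^sub># A \<and>
    (p has_real_derivative ((\<Sum>\<^sub># A)\<^sup>2 - (\<Sum>l\<in>#A. l\<^sup>2))) (at 0)"
proof (induction A)
  case empty
  show ?case by (intro exI[of _ "\<lambda>_. 0"]) simp
next
  case (add l A)
  then obtain p where p: "\<And>t. ((\<lambda>t. \<Prod>l\<in>#A. 1 + t * l) has_real_derivative p t) (at t)" "p 0 = \<Sum>\<^sub># A"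
    "(p has_real_derivative ((\<Sum>\<^sub># A)\<^sup>2 - (\<Sum>l\<in>#A. l\<^sup>2))) (at 0)" by blast
  have lin: "((\<lambda>t. 1 + t * l) has_real_derivative l) (at t)" for t
    by (auto intro!: derivative_eq_intros)
  let ?p = "\<lambda>t. l * (\<Prod>l\<in>#A. 1 + t * l) + p t * (1 + t * l)"
  have first: "((\<lambda>t. \<Prod>l\<in>#add_mset l A. 1 + t * l) has_real_derivative ?p t) (at t)" for t
    using DERIV_mult[OF lin p(1)] by simp
  have "(?p has_real_derivative (l * p 0 + (((\<Sum>\<^sub># A)\<^sup>2 - (\<Sum>l\<in>#A. l\<^sup>2)) * (1 + 0 * l) + l * p 0))) (at 0)"
    by (intro DERIV_add DERIV_cmult DERIV_mult lin p)
  moreover have "l * p 0 + (((\<Sum>\<^sub># A)\<^sup>2 - (\<Sum>l\<in>#A. l\<^sup>2)) * (1 + 0 * l) + l * p 0)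
      = (\<Sum>\<^sub># (add_mset l A))\<^sup>2 - (\<Sum>l\<in>#add_mset l A. l\<^sup>2)"
    by (simp add: p(2) power2_eq_square algebra_simps)
  ultimately have second: "(?p has_real_derivative (\<Sum>\<^sub># (add_mset l A))\<^sup>2 - (\<Sum>l\<in>#add_mset l A. l\<^sup>2)) (at 0)"
    by (simp only:)
  have zero: "?p 0 = \<Sum>\<^sub># (add_mset l A)" by (simp add: p(2))
  show ?case by (intro exI[of _ ?p] conjI allI first second zero)
qed

lemma finite_if_independent_blinfun:
  fixes B :: "('a::euclidean_space \<Rightarrow>\<^sub>L real) set"
  assumes "independent B"
  shows "finite B"
proof -
  have "B \<subseteq> span (blinfun_inner_right ` Basis)"
  proof
    fix y :: "'a \<Rightarrow>\<^sub>L real"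
    have "y = (\<Sum>i\<in>Basis. blinfun_apply y i *\<^sub>R blinfun_inner_right i)"
    proof (rule blinfun_eqI)
      fix x
      have "blinfun_apply y x = blinfun_apply y (\<Sum>i\<in>Basis. (x \<bullet> i) *\<^sub>R i)" by (simp only: euclidean_representation)
      then show "blinfun_apply y x = blinfun_apply (\<Sum>i\<in>Basis. blinfun_apply y i *\<^sub>R blinfun_inner_right i) x"
        by (simp add: blinfun.sum_right blinfun.scaleR_right blinfun.sum_left blinfun.scaleR_left inner_commute[of x] mult.commute)
    qed
    also have "\<dots> \<in> span (blinfun_inner_right ` Basis)"
      by (intro span_sum span_scale span_base) auto
    finally show "y \<in> span (blinfun_inner_right ` Basis)" .
  qed
  then show ?thesis using independent_span_bound[of "blinfun_inner_right ` Basis" B] assms by simp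
qed

context garding_pair
begin

text \<open>
  The expression is \<open>g x\<close> times the second derivative of \<open>ln g\<close> along \<open>v\<close>, which equals minus the sum of the squares
  of the roots \<open>l\<close>.
\<close>

lemma hessian_nondegenerate:
  assumes x: "x \<in> \<Gamma>" and G: "\<And>x. (g has_derivative (\<lambda>v. G x \<bullet> v)) (at x)"
    and H: "(G has_derivative H) (at x)" 
  shows "H v \<bullet> v - (G x \<bullet> v) * (G x \<bullet> v) / g x \<le> 0"
    and "H v \<bullet> v - (G x \<bullet> v) * (G x \<bullet> v) / g x = 0 \<Longrightarrow> v \<in> edge"
proof -
  obtain \<Lambda> where L: "\<And>t. g (x + t *\<^sub>R v) = g x * (\<Prod>l\<in>#\<Lambda>. 1 + t * l)" using line_roots[OF x] by blast
  obtain p where p: "\<And>t. ((\<lambda>t. \<Prod>l\<in>#\<Lambda>. 1 + t * l) has_real_derivative p t) (at t)" "p 0 = \<Sum>\<^sub># \<Lambda>"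
    "(p has_real_derivative ((\<Sum>\<^sub># \<Lambda>)\<^sup>2 - (\<Sum>l\<in>#\<Lambda>. l\<^sup>2))) (at 0)"
    using prod_mset_second_derivative by blast
  have line: "((\<lambda>t. x + t *\<^sub>R v) has_derivative (\<lambda>t. t *\<^sub>R v)) (at t)" for t
    by (auto intro!: derivative_eq_intros)
  have "((\<lambda>t. g (x + t *\<^sub>R v)) has_real_derivative G (x + t *\<^sub>R v) \<bullet> v) (at t)" for t
    using has_derivative_compose[OF line G] 
    by (rule has_derivative_imp_has_field_derivative) (simp add: mult.commute)
  moreover have "((\<lambda>t. g (x + t *\<^sub>R v)) has_real_derivative g x * p t) (at t)" for t
    unfolding L by (rule DERIV_cmult[OF p(1)])
  ultimately have Gp: "G (x + t *\<^sub>R v) \<bullet> v = g x * p t" for t using DERIV_unique by blast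
  have "((\<lambda>t. G (x + t *\<^sub>R v)) has_derivative (\<lambda>t. H (t *\<^sub>R v))) (at 0)"
    using has_derivative_compose[OF line[of 0], of G H] H by simp
  then have "((\<lambda>t. G (x + t *\<^sub>R v) \<bullet> v) has_derivative (\<lambda>t. H (t *\<^sub>R v) \<bullet> v)) (at 0)"
    by (rule has_derivative_inner_left)
  then have "((\<lambda>t. G (x + t *\<^sub>R v) \<bullet> v) has_real_derivative H v \<bullet> v) (at 0)"
    by (rule has_derivative_imp_has_field_derivative)
      (simp add: linear_scale[OF has_derivative_linear[OF H]] mult.commute)
  moreover have "((\<lambda>t. G (x + t *\<^sub>R v) \<bullet> v) has_real_derivative g x * ((\<Sum>\<^sub># \<Lambda>)\<^sup>2 - (\<Sum>l\<in>#\<Lambda>. l\<^sup>2))) (at 0)"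
    unfolding Gp by (rule DERIV_cmult[OF p(3)])
  ultimately have "H v \<bullet> v = g x * ((\<Sum>\<^sub># \<Lambda>)\<^sup>2 - (\<Sum>l\<in>#\<Lambda>. l\<^sup>2))" by (rule DERIV_unique)
  moreover have "G x \<bullet> v = g x * \<Sum>\<^sub># \<Lambda>" using Gp[of 0] p(2) by simp
  ultimately have eq: "H v \<bullet> v - (G x \<bullet> v) * (G x \<bullet> v) / g x = - g x * (\<Sum>l\<in>#\<Lambda>. l\<^sup>2)"
    using pos[OF x] by (simp add: power2_eq_square algebra_simps)
  have sq: "(\<Sum>l\<in>#A. l\<^sup>2) \<ge> 0 \<and> ((\<Sum>l\<in>#A. l\<^sup>2) = 0 \<longrightarrow> (\<forall>l. l \<in># A \<longrightarrow> l = 0))" for A :: "real multiset"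
  proof (induction A)
    case (add l A)
    then show ?case by (auto simp: add_nonneg_eq_0_iff)
  qed simp
  show "H v \<bullet> v - (G x \<bullet> v) * (G x \<bullet> v) / g x \<le> 0"
    unfolding eq using sq[of \<Lambda>] pos[OF x] by simp
  assume "H v \<bullet> v - (G x \<bullet> v) * (G x \<bullet> v) / g x = 0"
  then have "(\<Sum>l\<in>#\<Lambda>. l\<^sup>2) = 0" unfolding eq using pos[OF x] by simp
  then have "l = 0" if "l \<in># \<Lambda>" for l using sq[of \<Lambda>] that by blast
  then have "g (x + t *\<^sub>R v) = g x" for t unfolding L using prod_roots_zero[of \<Lambda> t] by simp
  then show "v \<in> edge" by (rule edgeI[OF x])
qed

lemma dlog_gradient:
  assumes x: "x \<in> \<Gamma>" and G: "\<And>x. (g has_derivative (\<lambda>v. G x \<bullet> v)) (at x)"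
  shows "blinfun_apply (dlog g x) v = (G x \<bullet> v) / g x"
proof (rule dlog_eqI[OF x])
  have "((\<lambda>t. x + t *\<^sub>R v) has_derivative (\<lambda>t. t *\<^sub>R v)) (at 0)"
    by (auto intro!: derivative_eq_intros)
  from has_derivative_compose[OF this, of g "\<lambda>v. G x \<bullet> v"] G[of x]
  have "((\<lambda>t. g (x + t *\<^sub>R v)) has_derivative (\<lambda>t. G x \<bullet> (t *\<^sub>R v))) (at 0)" by simp
  then show "((\<lambda>t. g (x + t *\<^sub>R v)) has_real_derivative g x * ((G x \<bullet> v) / g x)) (at 0)"
    by (rule has_derivative_imp_has_field_derivative) (use pos[OF x] in simp)
qed

text \<open>
  For \<open>P \<xi> = \<Sum>(\<xi> \<bullet> e) e\<close> over such a set, \<open>P \<xi> \<bullet> \<xi>\<close> is a sum of squares that vanishes only if \<open>\<xi>\<close> is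
  orthogonal to the set, so that \<open>P\<close> can stand in for the projection onto the edge.
\<close>

lemma edge_finite_test_set:
  obtains E0 where "finite E0" "E0 \<subseteq> edge" "\<forall>v\<in>edge. (\<forall>e\<in>E0. v \<bullet> e = 0) \<longrightarrow> v = 0"
proof -
  obtain E0 where E0: "E0 \<subseteq> edge" "independent E0" "edge \<subseteq> span E0" "card E0 = dim edge"
    by (rule basis_exists)
  have "\<forall>v\<in>edge. (\<forall>e\<in>E0. v \<bullet> e = 0) \<longrightarrow> v = 0"
  proof (intro ballI impI)
    fix v assume v: "v \<in> edge" "\<forall>e\<in>E0. v \<bullet> e = 0"
    have "v \<in> span E0" using v(1) E0(3) by blast
    then have "orthogonal v v"
      by (rule orthogonal_to_span) (use v(2) in \<open>simp add: orthogonal_def\<close>)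
    then show "v = 0" by (simp add: orthogonal_self)
  qed
  with independent_imp_finite[OF E0(2)] E0(1) show thesis by (rule that)
qed

text \<open>
  Let \<open>G\<close> be the gradient of \<open>g\<close>, and let \<open>y0\<close> and \<open>\<sigma>\<close> be the vectors that represent \<open>y\<close> and its increment. Instead of \<open>F x = y + \<sigma>\<close>
  one solves \<open>G x - g x (y0 + \<sigma>) = P (x - x0)\<close>, where \<open>P\<close> maps into the edge and makes the linearisation invertible. For \<open>x\<close> in
  the cone the left side is orthogonal to the edge and the right side lies in it, so both vanish
  and \<open>F x = y + \<sigma>\<close>.
\<close>

lemma dual_majorized:
  assumes y: "y \<in> open_polar \<Gamma>" and B: "finite B" "B \<subseteq> annihilator"
  shows "\<exists>r>0. \<exists>M. majorized B r M (\<lambda>s. dual_garding g \<Gamma> (y + (\<Sum>b\<in>B. s b *\<^sub>R b)))"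
proof -
  obtain x0 where x0: "x0 \<in> \<Gamma>" "dlog g x0 = y" using dlog_surj[OF y] by blast
  obtain G where G: "polynomial_function G" "\<And>x. (g has_derivative (\<lambda>v. G x \<bullet> v)) (at x)"
    using polynomial_gradient[OF poly] by blast
  obtain H where H: "(G has_derivative H) (at x0)"
    using differentiable_at_polynomial_function[OF G(1)] unfolding differentiable_def by blast
  obtain E0 where E0: "finite E0" "E0 \<subseteq> edge" "\<forall>v\<in>edge. (\<forall>e\<in>E0. v \<bullet> e = 0) \<longrightarrow> v = 0"
    by (rule edge_finite_test_set)
  define P where "P \<xi> = (\<Sum>e\<in>E0. (\<xi> \<bullet> e) *\<^sub>R e)" for \<xi>
  have P_lin: "bounded_linear P" unfolding P_def
    by (intro bounded_linear_sum bounded_linear_scaleR_const bounded_linear_inner_left)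
  have P_edge: "P \<xi> \<in> edge" for \<xi>
    unfolding P_def using E0(2) by (intro subspace_sum subspace_edge subspace_scale) auto
  define \<beta> :: "('a \<Rightarrow>\<^sub>L real) \<Rightarrow> 'a" where "\<beta> b = (SOME r. b = blinfun_inner_right r)" for b
  have \<beta>_apply: "blinfun_apply b v = \<beta> b \<bullet> v" for b v
  proof -
    have "b = blinfun_inner_right (\<beta> b)" unfolding \<beta>_def by (rule someI_ex[OF riesz_representation])
    then have "blinfun_apply b v = blinfun_apply (blinfun_inner_right (\<beta> b)) v" by (rule arg_cong)
    then show ?thesis by simp
  qed
  define y0 where "y0 = \<beta> y"
  note g0 = pos[OF x0(1)]
  have G0: "G x0 = g x0 *\<^sub>R y0"
  proof (rule vector_eq_rdot[THEN iffD1, rule_format])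
    show "G x0 \<bullet> z = (g x0 *\<^sub>R y0) \<bullet> z" for z
      using dlog_gradient[OF x0(1) G(2), of z] g0 \<beta>_apply[of y z] unfolding x0(2) y0_def by (simp add: field_simps inner_commute)
  qed
  \<comment> \<open>The derivative at \<open>0\<close> of the function \<open>R\<close> below; \<open>A \<xi> \<bullet> \<xi>\<close> is a sum of two nonpositive terms.\<close>
  define A where "A \<xi> = H \<xi> - (G x0 \<bullet> \<xi>) *\<^sub>R y0 - P \<xi>" for \<xi>
  have A_lin: "bounded_linear A" unfolding A_def
    by (intro bounded_linear_sub has_derivative_bounded_linear[OF H] P_lin bounded_linear_scaleR_const bounded_linear_inner_right)
  have "\<xi> = 0" if A0: "A \<xi> = 0" for \<xi>
  proof -
    have "y0 \<bullet> \<xi> = (G x0 \<bullet> \<xi>) / g x0" using g0 G0 by simp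
    moreover have "P \<xi> \<bullet> \<xi> = (\<Sum>e\<in>E0. (\<xi> \<bullet> e)\<^sup>2)"
      unfolding P_def by (simp add: inner_sum_right power2_eq_square inner_commute[of _ \<xi>])
    ultimately have "A \<xi> \<bullet> \<xi> = (H \<xi> \<bullet> \<xi> - (G x0 \<bullet> \<xi>) * (G x0 \<bullet> \<xi>) / g x0) - (\<Sum>e\<in>E0. (\<xi> \<bullet> e)\<^sup>2)"
      unfolding A_def inner_diff_left inner_scaleR_left by simp
    moreover have "(\<Sum>e\<in>E0. (\<xi> \<bullet> e)\<^sup>2) \<ge> 0" by (intro sum_nonneg) auto
    ultimately have "H \<xi> \<bullet> \<xi> - (G x0 \<bullet> \<xi>) * (G x0 \<bullet> \<xi>) / g x0 = 0" "(\<Sum>e\<in>E0. (\<xi> \<bullet> e)\<^sup>2) = 0"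
      using hessian_nondegenerate(1)[OF x0(1) G(2) H, of \<xi>] A0 by auto
    then have "\<xi> \<in> edge" "\<forall>e\<in>E0. \<xi> \<bullet> e = 0"
      using hessian_nondegenerate(2)[OF x0(1) G(2) H] E0(1) by (auto simp: sum_nonneg_eq_0_iff)
    then show ?thesis using E0(3) by blast
  qed
  then have "inj A" using linear_injective_0[OF bounded_linear.linear[OF A_lin]] by blast
  then obtain A' where A': "linear A'" "\<And>x. A' (A x) = x" "\<And>x. A (A' x) = x"
    using linear_injective_isomorphism[OF bounded_linear.linear[OF A_lin]] by blast
  have A'_lin: "bounded_linear A'" using A'(1) linear_conv_bounded_linear by blast
  have shift: "polynomial_function (\<lambda>\<xi>. x0 + \<xi>)" by auto
  have g_poly: "real_polynomial_function (\<lambda>\<xi>. g (x0 + \<xi>))"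
    using real_polynomial_function_compose[OF shift poly] by (simp add: o_def)
  have G_poly: "polynomial_function (\<lambda>\<xi>. G (x0 + \<xi>))"
    using polynomial_function_compose[OF shift G(1)] by (simp add: o_def)
  define R where "R \<xi> = G (x0 + \<xi>) - g (x0 + \<xi>) *\<^sub>R y0 - P \<xi>" for \<xi>
  have R_poly: "polynomial_function R"
    unfolding R_def using g_poly G_poly polynomial_function_bounded_linear[OF P_lin]
    by (intro polynomial_function_diff polynomial_function_mult polynomial_function_const) (auto simp: real_polynomial_function_eq)
  have shift_deriv: "((\<lambda>\<xi>. x0 + \<xi>) has_derivative (\<lambda>\<xi>. \<xi>)) (at 0)" by (auto intro!: derivative_eq_intros)
  have R_deriv: "(R has_derivative A) (at 0)"
    unfolding R_def A_def
    using has_derivative_compose[OF shift_deriv, of G H] H has_derivative_compose[OF shift_deriv, of g "\<lambda>v. G x0 \<bullet> v"] G(2)[of x0]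
    by (intro has_derivative_diff bounded_linear_imp_has_derivative[OF P_lin] has_derivative_scaleR_left) simp_all
  have R0: "R 0 = 0" unfolding R_def using G0 bounded_linear.linear[OF P_lin] by (simp add: linear_0)
  \<comment> \<open>Newton form of the equation \<open>R \<xi> = g (x0 + \<xi>) \<sigma>\<close>: \<open>Q\<close> has no linear part.\<close>
  define Q where "Q \<xi> = \<xi> - A' (R \<xi>)" for \<xi>
  define q where "q b \<xi> = g (x0 + \<xi>) *\<^sub>R A' (\<beta> b)" for b \<xi>
  have Q_poly: "polynomial_function Q"
    unfolding Q_def
    using polynomial_function_compose[OF R_poly polynomial_function_bounded_linear[OF A'_lin]]
    by (intro polynomial_function_diff polynomial_function_id) (simp add: o_def)
  have Q_0: "Q 0 = 0" unfolding Q_def R0 using linear_0[OF A'(1)] by simp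
  have "(Q has_derivative (\<lambda>\<xi>. \<xi> - A' (A \<xi>))) (at 0)"
    unfolding Q_def by (intro has_derivative_diff has_derivative_ident bounded_linear.has_derivative[OF A'_lin] R_deriv)
  then have Q_deriv: "(Q has_derivative (\<lambda>_. 0)) (at 0)" unfolding A'(2) by simp
  have q_poly: "polynomial_function (q b)" for b
    unfolding q_def using g_poly by (intro polynomial_function_mult polynomial_function_const) (simp add: real_polynomial_function_eq)
  obtain K D where K: "K > 0" "lipschitz_majorized B K D (\<lambda>\<xi>. g (x0 + \<xi>))"
    using polynomial_lipschitz_majorized[OF g_poly] by blast
  obtain \<epsilon> where \<epsilon>: "\<epsilon> > 0" "ball x0 \<epsilon> \<subseteq> \<Gamma>" using open_cone x0(1) open_contains_ball by blast
  \<comment> \<open>The second bound keeps \<open>x0 + u s\<close> in the cone, the third keeps \<open>g (x0 + u s)\<close> away from \<open>0\<close>.\<close>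
  define \<rho>0 where "\<rho>0 = min 1 (min (\<epsilon> / (2 * DIM('a))) (g x0 / (2 * K)))"
  have \<rho>0: "\<rho>0 > 0" unfolding \<rho>0_def using \<epsilon>(1) g0 K(1) by simp
  obtain r \<rho> u where r: "r > 0" and \<rho>: "\<rho> > 0" "\<rho> \<le> \<rho>0" and u: "majorized_vec B r \<rho> u"
    and fix_u: "\<forall>s\<in>polydisc B r. u s = Q (u s) + (\<Sum>b\<in>B. s b *\<^sub>R q b (u s))"
    by (rule analytic_fixed_point[OF B(1) Q_poly Q_0 Q_deriv q_poly \<rho>0])
  have \<rho>1: "\<rho> \<le> 1" "\<rho> \<le> \<epsilon> / (2 * DIM('a))" "\<rho> \<le> g x0 / (2 * K)" using \<rho>(2) unfolding \<rho>0_def by auto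
  have dual_eq: "dual_garding g \<Gamma> (y + (\<Sum>b\<in>B. s b *\<^sub>R b)) = 1 / g (x0 + u s)" if s: "s \<in> polydisc B r" for s
  proof -
    have "norm (u s) \<le> (\<Sum>i\<in>Basis. \<bar>u s \<bullet> i\<bar>)" by (rule norm_le_l1)
    also have "\<dots> \<le> (\<Sum>i\<in>(Basis::'a set). \<rho>)"
      using u s majorized_bound unfolding majorized_vec_def by (intro sum_mono) blast
    also have "\<dots> \<le> \<epsilon> / 2" using \<rho>1(2) by (simp add: field_simps)
    also have "\<dots> < \<epsilon>" using \<epsilon>(1) by simp
    finally have x: "x0 + u s \<in> \<Gamma>" using \<epsilon>(2) by (auto simp: subset_eq dist_norm)
    define \<sigma> where "\<sigma> = (\<Sum>b\<in>B. s b *\<^sub>R \<beta> b)"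
    have "A' (R (u s)) = (\<Sum>b\<in>B. s b *\<^sub>R q b (u s))" using fix_u[rule_format, OF s] unfolding Q_def by (simp add: algebra_simps)
    also have "\<dots> = A' (g (x0 + u s) *\<^sub>R \<sigma>)"
      unfolding q_def \<sigma>_def by (simp add: linear_sum[OF A'(1)] linear_scale[OF A'(1)] scaleR_sum_right mult.commute)
    finally have "R (u s) = g (x0 + u s) *\<^sub>R \<sigma>" using A'(3) by metis
    then have P_eq: "G (x0 + u s) - g (x0 + u s) *\<^sub>R (y0 + \<sigma>) = P (u s)"
      unfolding R_def by (simp add: algebra_simps)
    have "(G (x0 + u s) - g (x0 + u s) *\<^sub>R (y0 + \<sigma>)) \<bullet> v = 0" if v: "v \<in> edge" for v
    proof -
      have Gv: "G (x0 + u s) \<bullet> v = 0"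
        using dlog_gradient[OF x G(2), of v] dlog_edge[OF x v] pos[OF x] by simp
      have y0v: "y0 \<bullet> v = 0"
        using y open_polar_subset_annihilator v \<beta>_apply[of y v] unfolding annihilator_def y0_def by auto
      have "\<beta> b \<bullet> v = 0" if "b \<in> B" for b
        using B(2) v that \<beta>_apply[of b v] unfolding annihilator_def by auto
      then have "\<sigma> \<bullet> v = 0" unfolding \<sigma>_def by (simp add: inner_sum_left)
      then show ?thesis using Gv y0v by (simp add: inner_diff_left inner_add_left)
    qed
    then have "P (u s) \<bullet> P (u s) = 0" using P_edge P_eq by metis
    then have grad: "G (x0 + u s) = g (x0 + u s) *\<^sub>R (y0 + \<sigma>)" using P_eq by simp
    have "dlog g (x0 + u s) = y + (\<Sum>b\<in>B. s b *\<^sub>R b)"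
    proof (rule blinfun_eqI)
      fix v
      have "blinfun_apply (dlog g (x0 + u s)) v = (y0 + \<sigma>) \<bullet> v"
        using dlog_gradient[OF x G(2), of v] pos[OF x] unfolding grad by simp
      also have "\<dots> = blinfun_apply y v + (\<Sum>b\<in>B. s b * blinfun_apply b v)"
        unfolding \<beta>_apply y0_def \<sigma>_def by (simp add: inner_add_left inner_sum_left)
      also have "\<dots> = blinfun_apply (y + (\<Sum>b\<in>B. s b *\<^sub>R b)) v"
        by (simp add: blinfun.add_left blinfun.sum_left blinfun.scaleR_left)
      finally show "blinfun_apply (dlog g (x0 + u s)) v = blinfun_apply (y + (\<Sum>b\<in>B. s b *\<^sub>R b)) v" .
    qed
    then show ?thesis using dual_dlog[OF x] by simp
  qed
  have near: "majorized B r (K * \<rho>) (\<lambda>s. g (x0 + u s) - g x0)"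
    using lipschitz_majorized_at_0[OF K(2) r \<rho>1(1) u] by simp
  have "K * \<rho> \<le> g x0 / 2" using \<rho>1(3) K(1) by (simp add: field_simps)
  then have "K * \<rho> < g x0" using g0 by simp
  then obtain M where "majorized B r M (\<lambda>s. 1 / g (x0 + u s))"
    using majorized_inverse[where f = "\<lambda>s. g (x0 + u s)", OF r near g0] by blast
  then have "majorized B r M (\<lambda>s. dual_garding g \<Gamma> (y + (\<Sum>b\<in>B. s b *\<^sub>R b)))"
    by (rule majorized_cong) (simp add: dual_eq)
  then show ?thesis using r by blast
qed

theorem dual_analytic: "real_analytic_on annihilator (open_polar \<Gamma>) (dual_garding g \<Gamma>)"
  unfolding real_analytic_on_def
proof (intro allI impI ballI, elim conjE)
  fix B :: "('a \<Rightarrow>\<^sub>L real) set" and y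
  assume B: "independent B" "span B = annihilator" and y: "y \<in> open_polar \<Gamma>"
  have "B \<subseteq> annihilator" using B(2) span_superset by blast
  then obtain r M where r: "r > 0" and "majorized B r M (\<lambda>s. dual_garding g \<Gamma> (y + (\<Sum>b\<in>B. s b *\<^sub>R b)))"
    using dual_majorized[OF y finite_if_independent_blinfun[OF B(1)]] by blast
  then show "\<exists>r>0. \<exists>c. \<forall>s. (\<forall>b\<in>B. \<bar>s b\<bar> < r) \<longrightarrow>
      ((\<lambda>\<alpha>. c \<alpha> * (\<Prod>b\<in>B. s b ^ \<alpha> b)) has_sum dual_garding g \<Gamma> (y + (\<Sum>b\<in>B. s b *\<^sub>R b))) {\<alpha>. \<forall>b. b \<notin> B \<longrightarrow> \<alpha> b = 0}"
    unfolding majorized_def polydisc_def multi_indices_def monomial_at_def by blast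
qed

lemma dual_continuous_extension:
  "\<exists>h. continuous_on (top_of_set annihilator closure_of open_polar \<Gamma>) h \<and>
     (\<forall>y\<in>open_polar \<Gamma>. h y = dual_garding g \<Gamma> y \<and> h y > 0) \<and>
     (\<forall>y\<in>top_of_set annihilator frontier_of open_polar \<Gamma>. h y = 0)"
proof (intro exI[of _ dual_extension] conjI ballI)
  show "continuous_on (top_of_set annihilator closure_of open_polar \<Gamma>) dual_extension"
    using dual_extension_continuous closure_of_open_polar_subset by (rule continuous_on_subset)
qed (use dual_pos frontier_of_open_polar in \<open>auto simp: dual_extension_def\<close>)

end

theorem theorem10p1:
  fixes g :: "'a::euclidean_space \<Rightarrow> real" and \<Gamma> :: "'a set" and N :: nat
  assumes "N \<ge> 1" and "garding N g \<Gamma>"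
  shows
    "real_analytic_on (span (polar \<Gamma>)) (open_polar \<Gamma>) (dual_garding g \<Gamma>) \<and>
     strictly_concave_on (open_polar \<Gamma>) (\<lambda>y. ln (dual_garding g \<Gamma> y)) \<and>
     (\<forall>y\<in>open_polar \<Gamma>. \<forall>t>0.
        t *\<^sub>R y \<in> open_polar \<Gamma> \<and> dual_garding g \<Gamma> (t *\<^sub>R y) = t ^ N * dual_garding g \<Gamma> y) \<and>
     (\<forall>y\<in>open_polar \<Gamma>. \<forall>z\<in>open_polar \<Gamma>.
        y + z \<in> open_polar \<Gamma> \<and> dual_garding g \<Gamma> (y + z) > dual_garding g \<Gamma> y) \<and>
     (\<exists>h. continuous_on (top_of_set (span (polar \<Gamma>)) closure_of open_polar \<Gamma>) h \<and>
        (\<forall>y\<in>open_polar \<Gamma>. h y = dual_garding g \<Gamma> y \<and> h y > 0) \<and>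
        (\<forall>y\<in>top_of_set (span (polar \<Gamma>)) frontier_of open_polar \<Gamma>. h y = 0)) \<and>
     (\<forall>x\<in>\<Gamma>.
        strictly_convex_on (open_polar \<Gamma>)
          (\<lambda>y. blinfun_apply y x - ln (dual_garding g \<Gamma> y)) \<and>
        (\<forall>c. compact {y \<in> open_polar \<Gamma>. blinfun_apply y x - ln (dual_garding g \<Gamma> y) \<le> c}))"
proof -
  interpret garding_pair g \<Gamma> N
    using assms by unfold_locales
  show ?thesis
    unfolding span_polar
    using dual_analytic ln_dual_strictly_concave open_polar_scale dual_homogeneous open_polar_add
      dual_monotone dual_continuous_extension psi_strictly_convex psi_exhaustion
    by blast
qed

end
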